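(* Let $\Sigma$ be a topologically mixing Markov shift with countable alphabet $I$ having the big images and preimages (b.i.p.) property, let $G$ be a countable group, let $\Psi:I^{*}\to G$ be a semigroup homomorphism such that the group extended Markov system $(\Sigma\times G,\sigma\rtimes\Psi)$ is irreducible, and let $\varphi:\Sigma\to\mathbb{R}$ be Hölder continuous with $\mathcal{P}(\varphi,\sigma)<\infty$. Let $\rho(\mathcal{L}_{\varphi\circ\pi_1})$ be the spectral radius of the Perron–Frobenius operator $\mathcal{L}_{\varphi\circ\pi_1}:\mathcal{H}_\infty\to\mathcal{H}_\infty$. Then $\log\rho(\mathcal{L}_{\varphi\circ\pi_1})\le\mathcal{P}(\varphi,\sigma)$, and $\log\rho(\mathcal{L}_{\varphi\circ\pi_1})=\mathcal{P}(\varphi,\sigma)$ if and only if $G$ is amenable.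
   Context: Markov shift: for a countable alphabet $I\subset\mathbb{N}$ and a matrix $A=(a(i,j))\in\{0,1\}^{I\times I}$, $\Sigma=\{\omega\in I^{\mathbb{N}}: a(\omega_i,\omega_{i+1})=1\ \forall i\}$ with left shift $\sigma$; $\Sigma^n$ is the set of admissible words of length $n$, $\Sigma^*=\bigcup_n\Sigma^n$, $[\omega]=\{\tau\in\Sigma:\tau_1\dots\tau_n=\omega\}$ for $\omega\in\Sigma^n$, and $\omega a\in\Sigma^*$ denotes that the concatenation is admissible. $\Sigma$ is topologically mixing if for all $i,j\in I$ there is $n_0$ such that for all $n\ge n_0$ there is $\omega\in\Sigma^n$ with $i\omega j\in\Sigma^*$. $\Sigma$ has the b.i.p. property if there is a finite $\Lambda\subset I$ such that for every $i\in I$ there are $a,b\in\Lambda$ with $aib\in\Sigma^3$. The metric is $d_\beta(\omega,\tau)=e^{-\beta|\omega\wedge\tau|}$, $|\omega\wedge\tau|$ the length of the longest common initial block; $\varphi$ is Hölder continuous if for some $\beta>0$, $\sup\{|\varphi(\omega)-\varphi(\tau)|/d_\beta(\omega,\tau):\omega,\tau\in\Sigma,\ |\omega\wedge\tau|\ge1\}<\infty$. $S_n\varphi=\sum_{i=0}^{n-1}\varphi\circ\sigma^i$. Gurevič pressure: for $a\in I$, $\mathcal{P}(\varphi,\sigma)=\limsup_n\frac1n\log\sum_{\omega\in\Sigma^n,\omega_1=a,\omega a\in\Sigma^*}e^{\sup S_n\varphi|_{[\omega]}}$ (independent of $a$). $I^*$ is the free semigroup of finite words over $I$; for a word $\omega$,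 $\Psi(\omega)=\Psi(\omega_1)\cdots\Psi(\omega_n)$. The group extended Markov system is $(\sigma\rtimes\Psi)(\omega,g)=(\sigma\omega,g\Psi(\omega_1))$ on $\Sigma\times G$; it is a Markov shift over alphabet $I\times G$ and is called irreducible if this Markov shift is irreducible (for all letters $x,y$ of $I\times G$ there is an admissible word from $x$ to $y$). $\pi_1:\Sigma\times G\to\Sigma$ is the projection. The Perron–Frobenius operator is $\mathcal{L}_{\varphi\circ\pi_1}f(x)=\sum_{(\sigma\rtimes\Psi)(y)=x}e^{\varphi(\pi_1 y)}f(y)$. Let $\mu_\varphi$ be the unique $\sigma$-invariant Gibbs measure for $\varphi$ (a Borel probability measure with $C^{-1}\le\mu([\omega])/e^{S_{|\omega|}\varphi(\tau)-|\omega|\mathcal{P}(\varphi,\sigma)}\le C$ for all $\omega\in\Sigma^*$, $\tau\in[\omega]$, some $C\ge1$), which exists under these hypotheses. $\mathcal{H}_\infty=\{f:\Sigma\times G\to\mathbb{R}: |f|_\infty<\infty\}$ with $|f|_\infty=\big(\sum_{g\in G}\|f(\cdot,g)\|_{L^\infty(\mu_\varphi)}^2\big)^{1/2}$; $\mathcal{L}_{\varphi\circ\pi_1}$ is a bounded operator on this Banach space. *)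

theory Defs
  imports "HOL-Probability.Probability" "HOL-Algebra.Coset"
begin

text \<open>Points of the shift are sequences indexed from 0 (omega 0 is the first letter).
  The transition matrix is a 0/1 matrix, rendered as a predicate A i j (a(i,j) = 1).\<close>

definition shift_space :: "nat set \<Rightarrow> (nat \<Rightarrow> nat \<Rightarrow> bool) \<Rightarrow> (nat \<Rightarrow> nat) set" where
  "shift_space I A = {\<omega>. (\<forall>k. \<omega> k \<in> I) \<and> (\<forall>k. A (\<omega> k) (\<omega> (Suc k)))}"

definition left_shift :: "(nat \<Rightarrow> nat) \<Rightarrow> (nat \<Rightarrow> nat)" where
  "left_shift \<omega> = (\<lambda>k. \<omega> (Suc k))"

definition admissible :: "nat set \<Rightarrow> (nat \<Rightarrow> nat \<Rightarrow> bool) \<Rightarrow> nat list \<Rightarrow> bool" where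
  "admissible I A w \<longleftrightarrow> set w \<subseteq> I \<and> (\<forall>k. Suc k < length w \<longrightarrow> A (w ! k) (w ! Suc k))"

definition cylinder :: "nat set \<Rightarrow> (nat \<Rightarrow> nat \<Rightarrow> bool) \<Rightarrow> nat list \<Rightarrow> (nat \<Rightarrow> nat) set" where
  "cylinder I A w = {\<tau> \<in> shift_space I A. \<forall>k < length w. \<tau> k = w ! k}"

definition topologically_mixing :: "nat set \<Rightarrow> (nat \<Rightarrow> nat \<Rightarrow> bool) \<Rightarrow> bool" where
  "topologically_mixing I A \<longleftrightarrow>
     (\<forall>i\<in>I. \<forall>j\<in>I. \<exists>n0. \<forall>n\<ge>n0. \<exists>w. admissible I A w \<and> length w = n \<and> admissible I A (i # w @ [j]))"

definition bip :: "nat set \<Rightarrow> (nat \<Rightarrow> nat \<Rightarrow> bool) \<Rightarrow> bool" where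
  "bip I A \<longleftrightarrow> (\<exists>\<Lambda>. finite \<Lambda> \<and> \<Lambda> \<subseteq> I \<and> (\<forall>i\<in>I. \<exists>a\<in>\<Lambda>. \<exists>b\<in>\<Lambda>. admissible I A [a, i, b]))"

text \<open>Hoelder continuity w.r.t. d_beta(omega,tau) = exp(-beta |omega ^ tau|): the quotient
  |phi omega - phi tau| / d_beta(omega,tau) is bounded over pairs with a common initial block
  of length at least 1.  Here "omega and tau share the initial block of length n" is written out.\<close>
definition hoelder :: "nat set \<Rightarrow> (nat \<Rightarrow> nat \<Rightarrow> bool) \<Rightarrow> ((nat \<Rightarrow> nat) \<Rightarrow> real) \<Rightarrow> bool" where
  "hoelder I A \<phi> \<longleftrightarrow> (\<exists>\<beta>>0. \<exists>C. \<forall>\<omega>\<in>shift_space I A. \<forall>\<tau>\<in>shift_space I A. \<forall>n\<ge>1.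
      (\<forall>k<n. \<omega> k = \<tau> k) \<longrightarrow> \<bar>\<phi> \<omega> - \<phi> \<tau>\<bar> \<le> C * exp (- \<beta> * real n))"

definition birkhoff_sum :: "((nat \<Rightarrow> nat) \<Rightarrow> real) \<Rightarrow> nat \<Rightarrow> (nat \<Rightarrow> nat) \<Rightarrow> real" where
  "birkhoff_sum \<phi> n \<omega> = (\<Sum>k<n. \<phi> (\<lambda>j. \<omega> (j + k)))"

definition ereal_ln :: "ereal \<Rightarrow> ereal" where
  "ereal_ln x = (if x = \<infinity> then \<infinity> else if x \<le> 0 then -\<infinity> else ereal (ln (real_of_ereal x)))"

definition gurevic_Z :: "nat set \<Rightarrow> (nat \<Rightarrow> nat \<Rightarrow> bool) \<Rightarrow> ((nat \<Rightarrow> nat) \<Rightarrow> real) \<Rightarrow> nat \<Rightarrow> nat \<Rightarrow> ereal" where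
  "gurevic_Z I A \<phi> a n =
     (SUP F \<in> {F. finite F \<and> F \<subseteq> {w. admissible I A w \<and> length w = n \<and> w ! 0 = a \<and> admissible I A (w @ [a])}}.
        ereal (\<Sum>w\<in>F. exp (Sup (birkhoff_sum \<phi> n ` cylinder I A w))))"

definition gurevic_pressure :: "nat set \<Rightarrow> (nat \<Rightarrow> nat \<Rightarrow> bool) \<Rightarrow> ((nat \<Rightarrow> nat) \<Rightarrow> real) \<Rightarrow> nat \<Rightarrow> ereal" where
  "gurevic_pressure I A \<phi> a = limsup (\<lambda>n. ereal_ln (gurevic_Z I A \<phi> a n) / ereal (real n))"

definition invariant_gibbs_measure ::
  "nat set \<Rightarrow> (nat \<Rightarrow> nat \<Rightarrow> bool) \<Rightarrow> ((nat \<Rightarrow> nat) \<Rightarrow> real) \<Rightarrow> real \<Rightarrow> (nat \<Rightarrow> nat) measure \<Rightarrow> bool" where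
  "invariant_gibbs_measure I A \<phi> P \<mu> \<longleftrightarrow>
     prob_space \<mu> \<and> space \<mu> = shift_space I A \<and>
     sets \<mu> = sigma_sets (shift_space I A) (range (cylinder I A)) \<and>
     left_shift \<in> measurable \<mu> \<mu> \<and> distr \<mu> \<mu> left_shift = \<mu> \<and>
     (\<exists>C\<ge>1. \<forall>w. admissible I A w \<longrightarrow> (\<forall>\<tau>\<in>cylinder I A w.
        inverse C \<le> measure \<mu> (cylinder I A w) / exp (birkhoff_sum \<phi> (length w) \<tau> - real (length w) * P)
        \<and> measure \<mu> (cylinder I A w) / exp (birkhoff_sum \<phi> (length w) \<tau> - real (length w) * P) \<le> C))"

text \<open>The skew product (sigma x| Psi)(omega, g) = (sigma omega, g * Psi(omega_1)).
  Psi is the semigroup homomorphism I^* \<rightarrow> G, determined by its values on letters.\<close>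
definition skew :: "('g, 'b) monoid_scheme \<Rightarrow> (nat \<Rightarrow> 'g) \<Rightarrow> (nat \<Rightarrow> nat) \<times> 'g \<Rightarrow> (nat \<Rightarrow> nat) \<times> 'g" where
  "skew G \<Psi> x = (left_shift (fst x), snd x \<otimes>\<^bsub>G\<^esub> \<Psi> (fst x 0))"

definition ext_transition :: "nat set \<Rightarrow> (nat \<Rightarrow> nat \<Rightarrow> bool) \<Rightarrow> ('g, 'b) monoid_scheme \<Rightarrow> (nat \<Rightarrow> 'g) \<Rightarrow> ((nat \<times> 'g) \<times> (nat \<times> 'g)) set" where
  "ext_transition I A G \<Psi> = {((i, g), (j, h)). i \<in> I \<and> j \<in> I \<and> g \<in> carrier G \<and> A i j \<and> h = g \<otimes>\<^bsub>G\<^esub> \<Psi> i}"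

definition ext_irreducible :: "nat set \<Rightarrow> (nat \<Rightarrow> nat \<Rightarrow> bool) \<Rightarrow> ('g, 'b) monoid_scheme \<Rightarrow> (nat \<Rightarrow> 'g) \<Rightarrow> bool" where
  "ext_irreducible I A G \<Psi> \<longleftrightarrow>
     (\<forall>x \<in> I \<times> carrier G. \<forall>y \<in> I \<times> carrier G. (x, y) \<in> (ext_transition I A G \<Psi>)\<^sup>+)"

definition PF_op :: "nat set \<Rightarrow> (nat \<Rightarrow> nat \<Rightarrow> bool) \<Rightarrow> ('g, 'b) monoid_scheme \<Rightarrow> (nat \<Rightarrow> 'g) \<Rightarrow> ((nat \<Rightarrow> nat) \<Rightarrow> real)
    \<Rightarrow> ((nat \<Rightarrow> nat) \<times> 'g \<Rightarrow> real) \<Rightarrow> ((nat \<Rightarrow> nat) \<times> 'g \<Rightarrow> real)" where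
  "PF_op I A G \<Psi> \<phi> f x =
     (\<Sum>\<^sub>\<infinity> y \<in> {y \<in> shift_space I A \<times> carrier G. skew G \<Psi> y = x}. exp (\<phi> (fst y)) * f y)"

definition Hinf_sqnorm :: "(nat \<Rightarrow> nat) measure \<Rightarrow> ('g, 'b) monoid_scheme \<Rightarrow> ((nat \<Rightarrow> nat) \<times> 'g \<Rightarrow> real) \<Rightarrow> ereal" where
  "Hinf_sqnorm \<mu> G f =
     (SUP F \<in> {F. finite F \<and> F \<subseteq> carrier G}. (\<Sum>g\<in>F. (esssup \<mu> (\<lambda>\<omega>. ereal \<bar>f (\<omega>, g)\<bar>))\<^sup>2))"

definition in_Hinf :: "(nat \<Rightarrow> nat) measure \<Rightarrow> ('g, 'b) monoid_scheme \<Rightarrow> ((nat \<Rightarrow> nat) \<times> 'g \<Rightarrow> real) \<Rightarrow> bool" where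
  "in_Hinf \<mu> G f \<longleftrightarrow> (\<forall>g\<in>carrier G. (\<lambda>\<omega>. f (\<omega>, g)) \<in> borel_measurable \<mu>) \<and> Hinf_sqnorm \<mu> G f < \<infinity>"

definition Hinf_norm :: "(nat \<Rightarrow> nat) measure \<Rightarrow> ('g, 'b) monoid_scheme \<Rightarrow> ((nat \<Rightarrow> nat) \<times> 'g \<Rightarrow> real) \<Rightarrow> real" where
  "Hinf_norm \<mu> G f = sqrt (real_of_ereal (Hinf_sqnorm \<mu> G f))"

definition Hinf_opnorm :: "(nat \<Rightarrow> nat) measure \<Rightarrow> ('g, 'b) monoid_scheme
    \<Rightarrow> (((nat \<Rightarrow> nat) \<times> 'g \<Rightarrow> real) \<Rightarrow> ((nat \<Rightarrow> nat) \<times> 'g \<Rightarrow> real)) \<Rightarrow> real" where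
  "Hinf_opnorm \<mu> G T = Sup {Hinf_norm \<mu> G (T f) | f. in_Hinf \<mu> G f \<and> Hinf_norm \<mu> G f \<le> 1}"

text \<open>Spectral radius, via Gelfand's formula rho(T) = lim ||T^n||^(1/n) = inf_n ||T^n||^(1/n).\<close>
definition Hinf_spectral_radius :: "(nat \<Rightarrow> nat) measure \<Rightarrow> ('g, 'b) monoid_scheme
    \<Rightarrow> (((nat \<Rightarrow> nat) \<times> 'g \<Rightarrow> real) \<Rightarrow> ((nat \<Rightarrow> nat) \<times> 'g \<Rightarrow> real)) \<Rightarrow> real" where
  "Hinf_spectral_radius \<mu> G T = Inf {Hinf_opnorm \<mu> G (T ^^ n) powr (1 / real n) | n. n \<ge> 1}"

definition amenable :: "('g, 'b) monoid_scheme \<Rightarrow> bool" where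
  "amenable G \<longleftrightarrow> (\<exists>m :: 'g set \<Rightarrow> real.
      (\<forall>S \<subseteq> carrier G. m S \<ge> 0) \<and> m (carrier G) = 1 \<and>
      (\<forall>S T. S \<subseteq> carrier G \<longrightarrow> T \<subseteq> carrier G \<longrightarrow> S \<inter> T = {} \<longrightarrow> m (S \<union> T) = m S + m T) \<and>
      (\<forall>g\<in>carrier G. \<forall>S \<subseteq> carrier G. m (g <#\<^bsub>G\<^esub> S) = m S))"

end

theory Submission
  imports Defs
begin

text \<open>Write m(w) for the Gibbs measure of the cylinder of w. The Gibbs property makes m quasi-multiplicative,
  and together with b.i.p. it shows that the norm of the n-th power of the operator is comparable, up to
  constants independent of n, to exp(nP) times the norm on l^2(G) of convolution by the law of Psi(w), where w
  is a word of length n drawn with probability m(w). Hence the spectral radius is at most exp(P).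

  If G has Folner sets, normalised indicators of these show that the convolution norms are 1, and
  submultiplicativity of operator norms removes the constants. If G has no Folner sets, then some finite set E
  satisfies |F E| >= N |F| for all finite F, with N as large as we please. For F in l^2(G), the functions
  g -> F(g Psi(w)^-1), conditioned on all but the first j letters of w, form a reverse martingale in j with
  values in l^2(G). If the convolution norms did not tend to zero, its second moments would stay bounded below
  while its orthogonal increments are summable; transporting along words realising the elements of E (these
  exist by irreducibility) would then give a nonnegative function on G that is invariant under E up to a constant factor independent of E and up
  to a small error; this contradicts the expansion for large N.

  Folner sets yield an invariant mean by compactness. Conversely, without Folner sets, Hall's marriage theorem
  for the expanding set E makes G paradoxical.\<close>

section \<open>Amenability and Folner sets\<close>

text \<open>The word weights \<open>m\<close> come from a process that is neither independent nor
  symmetric, and splitting a word costs the factor \<open>K\<close>. What costs nothing is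
  prepending letters, by shift invariance of the measure. Conditioning on the tail of a word hence
  gives a martingale whose orthogonality loses no constant, and \<open>K\<close> is paid only a
  fixed number of times, when a conditional average is compared with an unconditional one. The
  resulting factor \<open>2 * K ^ 4 * (real (card \<Lambda>))\<^sup>2\<close> depends neither on
  \<open>E\<close> nor on the connecting words, so the expansion rate \<open>N\<close> can be chosen
  above it first. A second obstacle is that norms are built from essential suprema while the
  operator sums over individual preimages. Null sets must therefore be carried through inverse
  branches, although the Gibbs inequality only speaks of cylinders.\<close>

text \<open>Edges are removed as long as Hall's condition survives. Zorn's lemma gives a minimal
  relation that still satisfies it, and there every point has exactly one partner.\<close>

lemma hall_infinite:
  fixes A :: "'i \<Rightarrow> 'x set"
  assumes fin: "\<And>i. i \<in> I \<Longrightarrow> finite (A i)"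
    and hall: "\<And>J. J \<subseteq> I \<Longrightarrow> finite J \<Longrightarrow> card J \<le> card (\<Union>(A ` J))"
  shows "\<exists>f. inj_on f I \<and> (\<forall>i\<in>I. f i \<in> A i)"
proof -
  define S where "S = Sigma I A"
  define \<D> where "\<D> = {D. \<forall>J. J \<subseteq> I \<longrightarrow> finite J \<longrightarrow> card J \<le> card ((S - D) `` J)}"
  have finS: "finite (S `` J)" if "J \<subseteq> I" "finite J" for J
  proof -
    have "S `` J = \<Union>(A ` J)" using that unfolding S_def by auto
    then show ?thesis using that fin by auto
  qed
  have "\<Union>\<C> \<in> \<D>" if ch: "subset.chain \<D> \<C>" for \<C>
    unfolding \<D>_def
  proof (intro CollectI allI impI)
    fix J assume J: "J \<subseteq> I" "finite J"
    show "card J \<le> card ((S - \<Union>\<C>) `` J)"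
    proof (cases "\<C> = {}")
      case True
      have "S `` J = \<Union>(A ` J)" using J unfolding S_def by auto
      then show ?thesis using True hall[OF J] by simp
    next
      case False
      let ?E = "(S \<inter> J \<times> UNIV) \<inter> \<Union>\<C>"
      have "S \<inter> J \<times> UNIV = Sigma J A" using J unfolding S_def by auto
      then have "finite (S \<inter> J \<times> UNIV)" using J fin by auto
      \<comment> \<open>Since the sets \<open>A i\<close> are finite, only finitely many edges start
        in \<open>J\<close>; one member of the chain already removes all of them that the union
        removes.\<close>
      then obtain D where D: "D \<in> \<C>" "?E \<subseteq> D"
        using finite_subset_Union_chain[of ?E \<C> \<D>] False ch by auto
      have "(S - \<Union>\<C>) `` J = (S - D) `` J" using D by auto
      moreover have "D \<in> \<D>" using D ch unfolding subset.chain_def by auto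
      ultimately show ?thesis using J unfolding \<D>_def by auto
    qed
  qed
  then obtain M where M: "M \<in> \<D>" and mx: "\<And>X. X \<in> \<D> \<Longrightarrow> M \<subseteq> X \<Longrightarrow> X = M"
    using subset_Zorn'[of \<D>] by blast
  define R where "R = S - M"
  have RH: "card J \<le> card (R `` J)" if "J \<subseteq> I" "finite J" for J
    using M that unfolding \<D>_def R_def by auto
  have finR: "finite (R `` J)" if "J \<subseteq> I" "finite J" for J
    unfolding R_def by (rule finite_subset[OF _ finS[OF that]]) auto
  \<comment> \<open>By minimality, removing one more edge violates the condition at some finite set.
    That set must contain \<open>i\<close>; \<open>J\<close> is the rest of it.\<close>
  have crit: "\<exists>J. J \<subseteq> I \<and> finite J \<and> i \<notin> J \<and> card (R `` J \<union> (R `` {i} - {x})) \<le> card J"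
    if i: "i \<in> I" and x: "(i, x) \<in> R" for i x
  proof -
    have "insert (i, x) M \<notin> \<D>" using mx[of "insert (i, x) M"] x unfolding R_def by auto
    then obtain J where J: "J \<subseteq> I" "finite J" and "\<not> card J \<le> card ((S - insert (i, x) M) `` J)"
      unfolding \<D>_def mem_Collect_eq by blast
    then have J3: "card ((S - insert (i, x) M) `` J) < card J" by linarith
    have eq: "S - insert (i, x) M = R - {(i, x)}" unfolding R_def by auto
    have iJ: "i \<in> J"
    proof (rule ccontr)
      assume "i \<notin> J"
      then have "(R - {(i, x)}) `` J = R `` J" by auto
      then show False using J J3 RH[of J] eq by simp
    qed
    have "(R - {(i, x)}) `` J = R `` (J - {i}) \<union> (R `` {i} - {x})" using iJ by auto
    then have "card (R `` (J - {i}) \<union> (R `` {i} - {x})) < card J" using J3 eq by simp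
    then have "card (R `` (J - {i}) \<union> (R `` {i} - {x})) \<le> card (J - {i})" using iJ J by simp
    then show ?thesis using J by (intro exI[of _ "J - {i}"]) auto
  qed
  have uniq: "x = y" if i: "i \<in> I" and x: "(i, x) \<in> R" and y: "(i, y) \<in> R" for i x y
  proof (rule ccontr)
    assume ne: "x \<noteq> y"
    obtain J where J: "J \<subseteq> I" "finite J" "i \<notin> J" "card (R `` J \<union> (R `` {i} - {x})) \<le> card J"
      using crit[OF i x] by blast
    obtain L where L: "L \<subseteq> I" "finite L" "i \<notin> L" "card (R `` L \<union> (R `` {i} - {y})) \<le> card L"
      using crit[OF i y] by blast
    let ?X = "R `` J \<union> (R `` {i} - {x})" and ?Y = "R `` L \<union> (R `` {i} - {y})"
    have fX: "finite ?X" "finite ?Y" using finR[of J] finR[of L] finR[of "{i}"] J L i by auto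
    \<comment> \<open>As \<open>x\<close> and \<open>y\<close> differ, each is supplied by the other
      set, so the union sees all neighbours of \<open>i\<close>. Counting union and intersection
      together exceeds \<open>card J + card L\<close> by one.\<close>
    have "?X \<union> ?Y = R `` (insert i (J \<union> L))" using ne by auto
    moreover have "card (insert i (J \<union> L)) \<le> card (R `` (insert i (J \<union> L)))"
      using J L i by (intro RH) auto
    ultimately have 1: "card (J \<union> L) + 1 \<le> card (?X \<union> ?Y)" using J L by simp
    have "card (J \<inter> L) \<le> card (R `` (J \<inter> L))" using J by (intro RH) auto
    also have "\<dots> \<le> card (?X \<inter> ?Y)" using fX by (intro card_mono) auto
    finally have 2: "card (J \<inter> L) \<le> card (?X \<inter> ?Y)" .
    show False
      using 1 2 card_Un_Int[OF fX] card_Un_Int[OF J(2) L(2)] J(4) L(4) by linarith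
  qed
  have ex: "\<exists>x. (i, x) \<in> R" if "i \<in> I" for i
    using RH[of "{i}"] that by (cases "R `` {i} = {}") auto
  define f where "f i = (SOME x. (i, x) \<in> R)" for i
  have f: "(i, f i) \<in> R" if "i \<in> I" for i using someI_ex[OF ex[OF that]] unfolding f_def .
  have "inj_on f I"
  proof (rule inj_onI, rule ccontr)
    fix i j assume ij: "i \<in> I" "j \<in> I" "f i = f j" "i \<noteq> j"
    have "R `` {i, j} \<subseteq> {f i}" using uniq f ij by auto
    then have "card (R `` {i, j}) \<le> 1" by (metis card_mono finite.intros is_singletonI is_singleton_altdef)
    then show False using RH[of "{i, j}"] ij by simp
  qed
  then show ?thesis using f unfolding R_def S_def by auto
qed

text \<open>Right translates, because the skew product multiplies by \<open>\<Psi>\<close> on the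
  right. Means in \<open>amenable\<close> are invariant on the left, so both implications below pass
  through inversion.\<close>

definition folner :: "('g, 'b) monoid_scheme \<Rightarrow> bool" where
  "folner G \<longleftrightarrow> (\<forall>E \<epsilon>. finite E \<longrightarrow> E \<subseteq> carrier G \<longrightarrow> (0::real) < \<epsilon> \<longrightarrow>
     (\<exists>F. finite F \<and> F \<noteq> {} \<and> F \<subseteq> carrier G \<and>
        (\<forall>s\<in>E. real (card ((F #>\<^bsub>G\<^esub> s) - F)) \<le> \<epsilon> * real (card F))))"

lemma (in group) card_r_coset:
  assumes "F \<subseteq> carrier G" "s \<in> carrier G"
  shows "card (F #> s) = card F"
proof -
  have "F #> s = (\<lambda>x. x \<otimes> s) ` F" unfolding r_coset_def by auto
  moreover have "inj_on (\<lambda>x. x \<otimes> s) F" using assms by (auto simp: inj_on_def subset_iff)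
  ultimately show ?thesis by (simp add: card_image)
qed

lemma (in group) finite_set_mult: "finite F \<Longrightarrow> finite E \<Longrightarrow> finite (F <#> E)"
  unfolding set_mult_def by auto

text \<open>A set that defeats the Folner condition, with \<open>\<one>\<close> adjoined, enlarges
  every finite set by the factor \<open>1 + \<epsilon>\<close>. This also applies to the already
  enlarged sets, so product sets of \<open>k\<close> factors enlarge by
  \<open>(1 + \<epsilon>) ^ k\<close>.\<close>

lemma (in group) not_folner_expanding:
  assumes "\<not> folner G"
  obtains E where "finite E" "E \<subseteq> carrier G"
    "\<And>F. finite F \<Longrightarrow> F \<subseteq> carrier G \<Longrightarrow> N * card F \<le> card (F <#> E)"
proof -
  obtain E \<epsilon> where E: "finite E" "E \<subseteq> carrier G" and \<epsilon>: "0 < (\<epsilon>::real)"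
    and bad: "\<And>F. finite F \<Longrightarrow> F \<noteq> {} \<Longrightarrow> F \<subseteq> carrier G \<Longrightarrow>
        \<exists>s\<in>E. real (card ((F #> s) - F)) > \<epsilon> * real (card F)"
    using assms unfolding folner_def by (meson not_le)
  define E1 where "E1 = insert \<one> E"
  have E1: "finite E1" "E1 \<subseteq> carrier G" using E unfolding E1_def by auto
  have step: "(1 + \<epsilon>) * real (card F) \<le> real (card (F <#> E1))"
    if F: "finite F" "F \<subseteq> carrier G" for F
  proof (cases "F = {}")
    case False
    obtain s where s: "s \<in> E" "real (card ((F #> s) - F)) > \<epsilon> * real (card F)"
      using bad[OF F(1) False F(2)] by blast
    have "F \<union> ((F #> s) - F) \<subseteq> F <#> E1"
      using F s unfolding E1_def set_mult_def r_coset_def by (fastforce simp: subset_iff)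
    then have "card (F \<union> ((F #> s) - F)) \<le> card (F <#> E1)"
      using finite_set_mult[OF F(1) E1(1)] by (rule card_mono[rotated])
    moreover have "finite (F #> s)" using F unfolding r_coset_def by auto
    then have "card (F \<union> ((F #> s) - F)) = card F + card ((F #> s) - F)"
      using F by (intro card_Un_disjoint) auto
    ultimately show ?thesis using s by (simp add: algebra_simps)
  qed (simp add: set_mult_def)
  have iter: "\<exists>E'. finite E' \<and> E' \<subseteq> carrier G \<and>
      (\<forall>F. finite F \<longrightarrow> F \<subseteq> carrier G \<longrightarrow> (1 + \<epsilon>) ^ k * real (card F) \<le> real (card (F <#> E')))" for k
  proof (induction k)
    case 0
    have "F <#> {\<one>} = F" if "F \<subseteq> carrier G" for F
      using that unfolding set_mult_def by (auto simp: subset_iff)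
    then show ?case by (intro exI[of _ "{\<one>}"]) auto
  next
    case (Suc k)
    then obtain E' where E': "finite E'" "E' \<subseteq> carrier G"
      "\<And>F. finite F \<Longrightarrow> F \<subseteq> carrier G \<Longrightarrow> (1 + \<epsilon>) ^ k * real (card F) \<le> real (card (F <#> E'))"
      by blast
    show ?case
    proof (intro exI[of _ "E' <#> E1"] conjI allI impI)
      show "finite (E' <#> E1)" using finite_set_mult E' E1 by blast
      show "E' <#> E1 \<subseteq> carrier G" using set_mult_closed E' E1 by blast
      fix F assume F: "finite F" "F \<subseteq> carrier G"
      have "(1 + \<epsilon>) ^ Suc k * real (card F) = (1 + \<epsilon>) * ((1 + \<epsilon>) ^ k * real (card F))" by simp
      also have "\<dots> \<le> (1 + \<epsilon>) * real (card (F <#> E'))" using E'(3)[OF F] \<epsilon> by simp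
      also have "\<dots> \<le> real (card ((F <#> E') <#> E1))"
        using F E' finite_set_mult set_mult_closed by (intro step) auto
      also have "(F <#> E') <#> E1 = F <#> (E' <#> E1)"
        using F E' E1 by (intro set_mult_assoc) auto
      finally show "(1 + \<epsilon>) ^ Suc k * real (card F) \<le> real (card (F <#> (E' <#> E1)))" .
    qed
  qed
  obtain k where k: "real N < (1 + \<epsilon>) ^ k" using real_arch_pow[of "1 + \<epsilon>" "real N"] \<epsilon> by auto
  obtain E' where E': "finite E'" "E' \<subseteq> carrier G"
      "\<And>F. finite F \<Longrightarrow> F \<subseteq> carrier G \<Longrightarrow> (1 + \<epsilon>) ^ k * real (card F) \<le> real (card (F <#> E'))"
    using iter[of k] by blast
  have "N * card F \<le> card (F <#> E')" if "finite F" "F \<subseteq> carrier G" for F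
  proof -
    have "real N * real (card F) \<le> (1 + \<epsilon>) ^ k * real (card F)" using k by (intro mult_right_mono) auto
    also have "\<dots> \<le> real (card (F <#> E'))" using E'(3) that by blast
    finally show ?thesis by (metis of_nat_le_iff of_nat_mult)
  qed
  then show ?thesis using that E' by blast
qed

lemma finitely_additive_sum:
  fixes m :: "'a set \<Rightarrow> real"
  assumes add: "\<And>S T. S \<subseteq> X \<Longrightarrow> T \<subseteq> X \<Longrightarrow> S \<inter> T = {} \<Longrightarrow> m (S \<union> T) = m S + m T"
    and "finite K" "\<And>k. k \<in> K \<Longrightarrow> B k \<subseteq> X" "disjoint_family_on B K"
  shows "m (\<Union>k\<in>K. B k) = (\<Sum>k\<in>K. m (B k))"
  using assms(2-)
proof (induction K rule: finite_induct)
  case empty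
  have "m ({} \<union> {}) = m {} + m {}" by (rule add) auto
  then show ?case by simp
next
  case (insert k K)
  have "B k \<inter> (\<Union>k\<in>K. B k) = {}"
    using insert.prems(2) insert.hyps unfolding disjoint_family_on_def by auto
  then have "m (B k \<union> (\<Union>k\<in>K. B k)) = m (B k) + m (\<Union>k\<in>K. B k)"
    using insert.prems by (intro add) auto
  moreover have "disjoint_family_on B K" using insert.prems(2) unfolding disjoint_family_on_def by auto
  ultimately show ?case using insert by simp
qed

text \<open>An expanding set gives, by the marriage theorem, two disjoint piecewise translated copies of the
  group inside itself.\<close>
lemma (in group) amenable_imp_folner:
  assumes "amenable G"
  shows "folner G"
proof (rule ccontr)
  assume "\<not> folner G"
  then obtain E where E: "finite E" "E \<subseteq> carrier G"
    and ex: "\<And>F. finite F \<Longrightarrow> F \<subseteq> carrier G \<Longrightarrow> 2 * card F \<le> card (F <#> E)"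
    using not_folner_expanding[of 2] by metis
  have "\<exists>f. inj_on f (carrier G \<times> {False, True}) \<and>
     (\<forall>i \<in> carrier G \<times> {False, True}. f i \<in> {fst i} <#> E)"
  proof (rule hall_infinite)
    fix i assume "i \<in> carrier G \<times> {False, True}"
    show "finite ({fst i} <#> E)" using finite_set_mult E by simp
  next
    fix J assume J: "J \<subseteq> carrier G \<times> {False, True}" "finite J"
    have "J \<subseteq> fst ` J \<times> UNIV" by force
    then have "card J \<le> card (fst ` J \<times> (UNIV :: bool set))" using J by (intro card_mono) auto
    also have "\<dots> = 2 * card (fst ` J)" by (simp add: card_cartesian_product)
    also have "\<dots> \<le> card ((fst ` J) <#> E)" using J by (intro ex) auto
    also have "(fst ` J) <#> E = (\<Union>p\<in>J. {fst p} <#> E)" unfolding set_mult_def by auto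
    finally show "card J \<le> card (\<Union>p\<in>J. {fst p} <#> E)" .
  qed
  then obtain f where inj: "inj_on f (carrier G \<times> {False, True})"
    and f0: "\<forall>p \<in> carrier G \<times> {False, True}. f p \<in> {fst p} <#> E" by (elim exE conjE) (rule that)
  have f: "f (x, i) \<in> {x} <#> E" if "x \<in> carrier G" for x i
  proof -
    have "(x, i) \<in> carrier G \<times> {False, True}" using that by (cases i) simp_all
    then show ?thesis using f0 by fastforce
  qed
  obtain m :: "'a set \<Rightarrow> real" where m: "(\<forall>S \<subseteq> carrier G. m S \<ge> 0) \<and> m (carrier G) = 1 \<and>
      (\<forall>S T. S \<subseteq> carrier G \<longrightarrow> T \<subseteq> carrier G \<longrightarrow> S \<inter> T = {} \<longrightarrow> m (S \<union> T) = m S + m T) \<and>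
      (\<forall>g\<in>carrier G. \<forall>S \<subseteq> carrier G. m (g <#\<^bsub>G\<^esub> S) = m S)"
    using assms unfolding amenable_def by (elim exE)
  have pos: "m S \<ge> 0" if "S \<subseteq> carrier G" for S using m that by simp
  have one: "m (carrier G) = 1" using m by simp
  have add: "m (S \<union> T) = m S + m T" if "S \<subseteq> carrier G" "T \<subseteq> carrier G" "S \<inter> T = {}" for S T
    using m that by simp
  have inv: "m (g <#\<^bsub>G\<^esub> S) = m S" if "g \<in> carrier G" "S \<subseteq> carrier G" for g S using m that by simp
  \<comment> \<open>Inversion turns the right translations made by \<open>f\<close> into left
    translations, under which the mean is invariant.\<close>
  define iv where "iv S = (\<lambda>x. inv x) ` S" for S
  define B where "B = (\<lambda>(i, s). {x \<in> carrier G. f (x, i) = x \<otimes> s \<and> (\<forall>t\<in>E. f (x, i) = x \<otimes> t \<longrightarrow> s = t)})"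
  have Bc: "B p \<subseteq> carrier G" for p unfolding B_def by auto
  have ivc: "iv S \<subseteq> carrier G" if "S \<subseteq> carrier G" for S using that unfolding iv_def by auto
  have ivd: "iv S \<inter> iv T = {}" if "S \<inter> T = {}" "S \<subseteq> carrier G" "T \<subseteq> carrier G" for S T
    using that unfolding iv_def by (auto simp: subset_iff) (metis disjoint_iff inv_inv)
  have Bs: "\<exists>s\<in>E. x \<in> B (i, s)" if "x \<in> carrier G" for x i
    using f[OF that, of i] that E unfolding B_def set_mult_def by (auto simp: subset_iff)
  have copy: "(\<Sum>s\<in>E. m (iv (B (i, s)))) = 1" for i
  proof -
    have "m (\<Union>s\<in>E. iv (B (i, s))) = (\<Sum>s\<in>E. m (iv (B (i, s))))"
    proof (rule finitely_additive_sum[OF add])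
      show "disjoint_family_on (\<lambda>s. iv (B (i, s))) E"
        unfolding disjoint_family_on_def
      proof (intro ballI impI ivd Bc)
        fix s t assume "s \<in> E" "t \<in> E" "s \<noteq> t"
        then show "B (i, s) \<inter> B (i, t) = {}" unfolding B_def by auto
      qed
    qed (use E ivc[OF Bc] in auto)
    moreover have "(\<Union>s\<in>E. iv (B (i, s))) = carrier G"
    proof
      show "carrier G \<subseteq> (\<Union>s\<in>E. iv (B (i, s)))"
      proof
        fix x assume x: "x \<in> carrier G"
        then obtain s where "s \<in> E" "inv x \<in> B (i, s)" using Bs[of "inv x" i] by auto
        then show "x \<in> (\<Union>s\<in>E. iv (B (i, s)))" unfolding iv_def using x by force
      qed
    qed (use ivc[OF Bc] in blast)
    ultimately show ?thesis using one by simp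
  qed
  define C where "C = (\<lambda>(i, s). iv ((\<lambda>x. f (x, i)) ` B (i, s)))"
  have fc: "f (x, i) \<in> carrier G" if "x \<in> carrier G" for x i
    using f[OF that, of i] that E unfolding set_mult_def by (auto simp: subset_iff)
  have mC: "m (C (i, s)) = m (iv (B (i, s)))" if s: "s \<in> E" for i s
  proof -
    have sc: "s \<in> carrier G" using s E by auto
    have "C (i, s) = (\<lambda>x. inv (x \<otimes> s)) ` B (i, s)"
      unfolding C_def iv_def by (auto simp: B_def image_iff)
    also have "\<dots> = (\<lambda>x. inv s \<otimes> inv x) ` B (i, s)"
      by (intro image_cong refl inv_mult_group) (use Bc sc in auto)
    also have "\<dots> = inv s <# iv (B (i, s))" unfolding l_coset_def iv_def by auto
    finally show ?thesis using inv[of "inv s" "iv (B (i, s))"] sc ivc Bc by simp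
  qed
  \<comment> \<open>The translated pieces of both copies are pairwise disjoint in the group, yet
    their masses add up to 2.\<close>
  have "m (\<Union>p\<in>UNIV \<times> E. C p) = (\<Sum>p\<in>UNIV \<times> E. m (C p))"
  proof (rule finitely_additive_sum[OF add])
    show "disjoint_family_on C (UNIV \<times> E)"
      unfolding disjoint_family_on_def
    proof (intro ballI impI)
      fix p q :: "bool \<times> 'a" assume pq: "p \<in> UNIV \<times> E" "q \<in> UNIV \<times> E" "p \<noteq> q"
      obtain i s j t where p: "p = (i, s)" "q = (j, t)" by (cases p, cases q)
      have "(\<lambda>x. f (x, i)) ` B (i, s) \<inter> (\<lambda>x. f (x, j)) ` B (j, t) = {}"
      proof -
        have False if "x \<in> B (i, s)" "y \<in> B (j, t)" "f (x, i) = f (y, j)" for x y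
        proof -
          have "(x, i) = (y, j)" using that inj Bc by (intro inj_onD[OF inj that(3)]) auto
          then have xy: "x = y" "i = j" by simp_all
          have "t \<in> E" "s \<noteq> t" using pq p xy by auto
          moreover have "f (x, i) = x \<otimes> t" using that(2) xy unfolding B_def by simp
          moreover have "\<forall>t\<in>E. f (x, i) = x \<otimes> t \<longrightarrow> s = t" using that(1) unfolding B_def prod.case mem_Collect_eq by (elim conjE)
          ultimately show False by blast
        qed
        then show ?thesis by blast
      qed
      then show "C p \<inter> C q = {}" unfolding p C_def prod.case using fc subsetD[OF Bc]
        by (intro ivd) auto
    qed
  next
    fix p assume "p \<in> (UNIV :: bool set) \<times> E"
    show "C p \<subseteq> carrier G" unfolding C_def using fc subsetD[OF Bc] by (cases p) (auto intro!: ivc)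
  qed (use E in auto)
  also have "(\<Sum>p\<in>UNIV \<times> E. m (C p)) = (\<Sum>i\<in>UNIV. \<Sum>s\<in>E. m (C (i, s)))"
    by (simp add: sum.cartesian_product)
  also have "\<dots> = (\<Sum>i\<in>(UNIV :: bool set). 1)" using mC copy by simp
  finally have two: "m (\<Union>p\<in>UNIV \<times> E. C p) = 2" by simp
  let ?U = "\<Union>p\<in>UNIV \<times> E. C p"
  have Uc: "?U \<subseteq> carrier G" unfolding C_def iv_def using fc subsetD[OF Bc] by auto
  have "m (?U \<union> (carrier G - ?U)) = m ?U + m (carrier G - ?U)" using Uc by (intro add) auto
  moreover have "?U \<union> (carrier G - ?U) = carrier G" using Uc by auto
  ultimately show False using two one pos[of "carrier G - ?U"] by auto
qed

text \<open>Set functions with values in \<open>{0..1}\<close> form a compact product space.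
  Approximate invariance is a closed condition there, and Folner sets satisfy any finite number of
  these conditions at once.\<close>

lemma (in group) folner_imp_amenable:
  assumes fol: "folner G"
  shows "amenable G"
proof -
  define add where "add = (\<lambda>m :: 'a set \<Rightarrow> real. m (carrier G) = 1 \<and>
      (\<forall>S T. S \<subseteq> carrier G \<longrightarrow> T \<subseteq> carrier G \<longrightarrow> S \<inter> T = {} \<longrightarrow> m (S \<union> T) = m S + m T))"
  define C where "C = (\<lambda>(g, n). {m. add m \<and>
      (\<forall>S. S \<subseteq> carrier G \<longrightarrow> \<bar>m (g <#\<^bsub>G\<^esub> S) - m S\<bar> \<le> 1 / real (Suc n))})"
  define X where "X = PiE UNIV (\<lambda>_ :: 'a set. {0..1::real})"
  have "compactin (product_topology (\<lambda>_ :: 'a set. euclidean :: real topology) UNIV) X"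
    unfolding X_def compactin_PiE by auto
  then have compX: "compact X" by (simp add: euclidean_product_topology)
  have cont: "continuous_on UNIV (\<lambda>m :: 'a set \<Rightarrow> real. m S)" for S
    by (rule continuous_on_product_coordinates)
  have clC: "closed (C p)" for p
    unfolding C_def add_def case_prod_beta
    by (intro closed_Collect_conj closed_Collect_all closed_Collect_imp closed_Collect_eq
         closed_Collect_le open_Collect_const continuous_intros cont)
  have "X \<inter> (\<Inter>p\<in>carrier G \<times> UNIV. C p) \<noteq> {}"
  proof (rule compact_imp_fip_image[OF compX clC])
    fix P assume P: "finite P" "P \<subseteq> carrier G \<times> (UNIV :: nat set)"
    define E where "E = fst ` P"
    define n where "n = Max (insert 0 (snd ` P))"
    have E: "finite E" "E \<subseteq> carrier G" using P unfolding E_def by auto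
    have nb: "snd p \<le> n" if "p \<in> P" for p using that P unfolding n_def by auto
    obtain F where F: "finite F" "F \<noteq> {}" "F \<subseteq> carrier G"
      and inv: "\<And>s. s \<in> E \<Longrightarrow> real (card ((F #> s) - F)) \<le> 1 / real (Suc n) * real (card F)"
      using fol E unfolding folner_def by (metis of_nat_0_less_iff zero_less_Suc zero_less_divide_1_iff)
    have cF: "real (card F) > 0" using F by (simp add: card_gt_0_iff)
    \<comment> \<open>Counting inverses converts almost invariance of \<open>F\<close> under right
      translation into almost invariance of \<open>m\<close> under left translation.\<close>
    define m where "m S = real (card {x \<in> F. inv x \<in> S}) / real (card F)" for S
    have m01: "0 \<le> m S" "m S \<le> 1" for S
      using F cF unfolding m_def by (auto intro!: card_mono)
    have "m \<in> X" unfolding X_def using m01 by auto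
    moreover have "add m" unfolding add_def
    proof (intro conjI allI impI)
      have "{x \<in> F. inv x \<in> carrier G} = F" using F by auto
      then show "m (carrier G) = 1" using cF unfolding m_def by simp
      fix S T :: "'a set" assume "S \<inter> T = {}"
      then have "card ({x \<in> F. inv x \<in> S} \<union> {x \<in> F. inv x \<in> T}) =
         card {x \<in> F. inv x \<in> S} + card {x \<in> F. inv x \<in> T}"
        using F by (intro card_Un_disjoint) auto
      moreover have "{x \<in> F. inv x \<in> S} \<union> {x \<in> F. inv x \<in> T} = {x \<in> F. inv x \<in> S \<union> T}" by auto
      ultimately show "m (S \<union> T) = m S + m T" unfolding m_def by (simp add: add_divide_distrib)
    qed
    moreover have "\<bar>m (g <#\<^bsub>G\<^esub> S) - m S\<bar> \<le> 1 / real (Suc n)" if g: "g \<in> E" and S: "S \<subseteq> carrier G" for g S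
    proof -
      have gc: "g \<in> carrier G" using g E by auto
      have "(\<lambda>x. x \<otimes> g) ` {x \<in> F. inv x \<in> g <#\<^bsub>G\<^esub> S} = {y \<in> F #> g. inv y \<in> S}"
      proof -
        have "inv x \<in> g <#\<^bsub>G\<^esub> S \<longleftrightarrow> inv (x \<otimes> g) \<in> S" if "x \<in> F" for x
        proof -
          have x: "x \<in> carrier G" using that F by auto
          have "inv x \<in> g <#\<^bsub>G\<^esub> S \<longleftrightarrow> (\<exists>h\<in>S. inv x = g \<otimes> h)" unfolding l_coset_def by auto
          also have "\<dots> \<longleftrightarrow> (\<exists>h\<in>S. h = inv g \<otimes> inv x)"
            using x gc S by (metis inv_closed inv_solve_left subset_iff)
          finally show ?thesis using x gc by (simp add: inv_mult_group)
        qed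
        then show ?thesis unfolding r_coset_def by auto
      qed
      then have "card {y \<in> F #> g. inv y \<in> S} = card ((\<lambda>x. x \<otimes> g) ` {x \<in> F. inv x \<in> g <#\<^bsub>G\<^esub> S})" by simp
      also have "\<dots> = card {x \<in> F. inv x \<in> g <#\<^bsub>G\<^esub> S}"
        by (rule card_image) (use F gc in \<open>auto simp: inj_on_def subset_iff\<close>)
      finally have eq: "card {x \<in> F. inv x \<in> g <#\<^bsub>G\<^esub> S} = card {y \<in> F #> g. inv y \<in> S}" by (rule sym)
      have fFg: "finite (F #> g)" using F unfolding r_coset_def by auto
      have cFg: "card (F #> g) = card F" using F gc by (intro card_r_coset)
      have d: "card (F - (F #> g)) = card ((F #> g) - F)"
        using card_Diff_subset_Int[of F "F #> g"] card_Diff_subset_Int[of "F #> g" F] F fFg cFg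
        by (simp add: Int_commute)
      have "card {y \<in> F #> g. inv y \<in> S} \<le> card ({x \<in> F. inv x \<in> S} \<union> ((F #> g) - F))"
        using F fFg by (intro card_mono) auto
      then have 1: "card {y \<in> F #> g. inv y \<in> S} \<le> card {x \<in> F. inv x \<in> S} + card ((F #> g) - F)"
        using card_Un_le[of "{x \<in> F. inv x \<in> S}" "(F #> g) - F"] by linarith
      have "card {x \<in> F. inv x \<in> S} \<le> card ({y \<in> F #> g. inv y \<in> S} \<union> (F - (F #> g)))"
        using F fFg by (intro card_mono) auto
      then have 2: "card {x \<in> F. inv x \<in> S} \<le> card {y \<in> F #> g. inv y \<in> S} + card ((F #> g) - F)"
        using card_Un_le[of "{y \<in> F #> g. inv y \<in> S}" "F - (F #> g)"] d by linarith
      have "\<bar>m (g <#\<^bsub>G\<^esub> S) - m S\<bar> = \<bar>real (card {y \<in> F #> g. inv y \<in> S}) - real (card {x \<in> F. inv x \<in> S})\<bar> / real (card F)"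
        unfolding m_def eq using cF by (simp add: diff_divide_distrib[symmetric])
      also have "\<dots> \<le> real (card ((F #> g) - F)) / real (card F)"
        using 1 2 by (intro divide_right_mono) auto
      also have "\<dots> \<le> 1 / real (Suc n)" using inv[OF g] cF by (simp add: field_simps)
      finally show ?thesis .
    qed
    then have "m \<in> C p" if "p \<in> P" for p
    proof -
      have "1 / real (Suc n) \<le> 1 / real (Suc (snd p))" using nb[OF that] by (simp add: field_simps)
      moreover have "fst p \<in> E" using that unfolding E_def by auto
      ultimately show ?thesis
        using \<open>add m\<close> \<open>\<And>g S. g \<in> E \<Longrightarrow> S \<subseteq> carrier G \<Longrightarrow> \<bar>m (g <#\<^bsub>G\<^esub> S) - m S\<bar> \<le> 1 / real (Suc n)\<close>
        unfolding C_def case_prod_beta by (auto intro: order_trans)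
    qed
    ultimately show "X \<inter> (\<Inter>p\<in>P. C p) \<noteq> {}" by blast
  qed
  then obtain m where mX: "m \<in> X" and mC: "\<And>g n. g \<in> carrier G \<Longrightarrow> m \<in> C (g, n)" by blast
  have "m (g <#\<^bsub>G\<^esub> S) = m S" if "g \<in> carrier G" "S \<subseteq> carrier G" for g S
  proof (rule ccontr)
    assume "m (g <#\<^bsub>G\<^esub> S) \<noteq> m S"
    then have "\<bar>m (g <#\<^bsub>G\<^esub> S) - m S\<bar> > 0" by simp
    then obtain n where "inverse (real (Suc n)) < \<bar>m (g <#\<^bsub>G\<^esub> S) - m S\<bar>" using reals_Archimedean by blast
    moreover have "\<bar>m (g <#\<^bsub>G\<^esub> S) - m S\<bar> \<le> 1 / real (Suc n)"
      using mC[OF that(1), of n] that(2) unfolding C_def prod.case mem_Collect_eq by blast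
    ultimately show False by (simp add: inverse_eq_divide)
  qed
  note inv = this
  have "add m"
    using mC[OF one_closed, of 0] unfolding C_def prod.case mem_Collect_eq by (rule conjunct1)
  then have one: "m (carrier G) = 1"
    and ad: "\<And>S T. S \<subseteq> carrier G \<Longrightarrow> T \<subseteq> carrier G \<Longrightarrow> S \<inter> T = {} \<Longrightarrow> m (S \<union> T) = m S + m T"
    unfolding add_def by simp_all
  have pos: "m S \<ge> 0" for S using mX unfolding X_def by (auto simp: PiE_iff)
  show ?thesis unfolding amenable_def
    by (intro exI[of _ m] conjI allI impI ballI) (simp_all add: one pos ad inv)
qed

lemma (in group) expanding_layer_cake:
  fixes P :: "'a \<Rightarrow> real"
  assumes E: "finite E" "E \<subseteq> carrier G"
    and ex: "\<And>F. finite F \<Longrightarrow> F \<subseteq> carrier G \<Longrightarrow> N * card F \<le> card (F <#> E)"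
    and \<Gamma>: "finite \<Gamma>" "\<Gamma> \<subseteq> carrier G"
    and P: "\<And>g. g \<in> \<Gamma> \<Longrightarrow> P g \<ge> 0"
    and q: "\<And>g s. g \<in> \<Gamma> \<Longrightarrow> s \<in> E \<Longrightarrow> P g \<le> q (g \<otimes> s)"
  shows "real N * sum P \<Gamma> \<le> sum q (\<Gamma> <#> E)"
  using \<Gamma> P q
proof (induction "card \<Gamma>" arbitrary: \<Gamma> P q rule: less_induct)
  case less
  show ?case
  proof (cases "\<Gamma> = {}")
    case True
    then show ?thesis by (simp add: set_mult_def)
  next
    case False
    define t where "t = Min (P ` \<Gamma>)"
    have "t \<in> P ` \<Gamma>" unfolding t_def using less.prems False by (intro Min_in) auto
    then obtain g0 where g0: "g0 \<in> \<Gamma>" "P g0 = t" by auto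
    have tle: "t \<le> P g" if "g \<in> \<Gamma>" for g unfolding t_def using that less.prems by auto
    have t0: "t \<ge> 0" using g0 less.prems by metis
    define \<Gamma>' where "\<Gamma>' = \<Gamma> - {g0}"
    have IH: "real N * (\<Sum>g\<in>\<Gamma>'. P g - t) \<le> (\<Sum>g\<in>\<Gamma>' <#> E. q g - t)"
    proof (rule less.hyps)
      show "card \<Gamma>' < card \<Gamma>" unfolding \<Gamma>'_def using g0 less.prems(1) by (intro psubset_card_mono) auto
    qed (use less.prems tle in \<open>auto simp: \<Gamma>'_def intro: diff_right_mono\<close>)
    have sub: "\<Gamma>' <#> E \<subseteq> \<Gamma> <#> E" unfolding \<Gamma>'_def set_mult_def by auto
    have fin: "finite (\<Gamma> <#> E)" using finite_set_mult less.prems E by blast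
    have qt: "q g \<ge> t" if "g \<in> \<Gamma> <#> E" for g
      using that less.prems(4) tle unfolding set_mult_def by (force intro: order_trans)
    have "(\<Sum>g\<in>\<Gamma>' <#> E. q g - t) \<le> (\<Sum>g\<in>\<Gamma> <#> E. q g - t)"
      using sub fin qt by (intro sum_mono2) auto
    moreover have "(\<Sum>g\<in>\<Gamma>'. P g - t) = (\<Sum>g\<in>\<Gamma>. P g - t)"
      unfolding \<Gamma>'_def using g0 less.prems(1) by (simp add: sum.remove[OF less.prems(1) g0(1)])
    ultimately have "real N * (\<Sum>g\<in>\<Gamma>. P g - t) \<le> (\<Sum>g\<in>\<Gamma> <#> E. q g - t)" using IH by simp
    then have "real N * sum P \<Gamma> \<le> sum q (\<Gamma> <#> E) + (real N * card \<Gamma> - card (\<Gamma> <#> E)) * t"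
      by (simp add: sum_subtractf algebra_simps)
    moreover have "real N * card \<Gamma> - card (\<Gamma> <#> E) \<le> 0"
      using ex[OF less.prems(1,2)] by (metis diff_le_0_iff_le of_nat_le_iff of_nat_mult)
    then have "(real N * card \<Gamma> - card (\<Gamma> <#> E)) * t \<le> 0" using t0 by (simp add: mult_nonpos_nonneg)
    ultimately show ?thesis by linarith
  qed
qed

section \<open>Word weights of a Gibbs measure\<close>

text \<open>The inverse branch of an iterate of the shift that is labelled by
  \<open>w\<close>.\<close>

definition pre :: "nat list \<Rightarrow> (nat \<Rightarrow> nat) \<Rightarrow> (nat \<Rightarrow> nat)" where
  "pre w x = foldr case_nat w x"

lemma pre_Nil [simp]: "pre [] x = x" and pre_Cons [simp]: "pre (i # w) x = case_nat i (pre w x)"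
  by (simp_all add: pre_def)

lemma pre_append: "pre (u @ v) x = pre u (pre v x)"
  by (induction u) auto

lemma left_shift_case_nat [simp]: "left_shift (case_nat i x) = x"
  by (simp add: left_shift_def)

lemma case_nat_left_shift: "x 0 = i \<Longrightarrow> case_nat i (left_shift x) = x"
  by (auto simp: left_shift_def fun_eq_iff split: nat.splits)

lemma left_shift_in_shift_space: "x \<in> shift_space I A \<Longrightarrow> left_shift x \<in> shift_space I A"
  by (auto simp: shift_space_def left_shift_def)

lemma case_nat_in_shift_space:
  "case_nat i x \<in> shift_space I A \<longleftrightarrow> i \<in> I \<and> A i (x 0) \<and> x \<in> shift_space I A"
proof -
  have 1: "(\<forall>k. case_nat i x k \<in> I) \<longleftrightarrow> i \<in> I \<and> (\<forall>k. x k \<in> I)"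
    by (metis nat.case not0_implies_Suc)
  have 2: "(\<forall>k. A (case_nat i x k) (x k)) \<longleftrightarrow> A i (x 0) \<and> (\<forall>k. A (x k) (x (Suc k)))"
    by (metis nat.case not0_implies_Suc)
  show ?thesis by (auto simp: shift_space_def 1 2)
qed

lemma admissible_Nil [simp]: "admissible I A []"
  by (simp add: admissible_def)

lemma admissible_Cons:
  "admissible I A (i # w) \<longleftrightarrow> i \<in> I \<and> (w = [] \<or> A i (hd w)) \<and> admissible I A w"
proof -
  have "(\<forall>k. Suc k < length (i # w) \<longrightarrow> A ((i # w) ! k) ((i # w) ! Suc k)) \<longleftrightarrow>
      (w = [] \<or> A i (hd w)) \<and> (\<forall>k. Suc k < length w \<longrightarrow> A (w ! k) (w ! Suc k))"
    (is "?L \<longleftrightarrow> ?R")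
  proof
    assume L: ?L
    have "w = [] \<or> A i (hd w)" using L[rule_format, of 0] by (cases w) auto
    moreover have "A (w ! k) (w ! Suc k)" if "Suc k < length w" for k
      using L[rule_format, of "Suc k"] that by auto
    ultimately show ?R by auto
  next
    assume R: ?R
    show ?L
    proof (intro allI impI)
      fix k assume k: "Suc k < length (i # w)"
      show "A ((i # w) ! k) ((i # w) ! Suc k)"
      proof (cases k)
        case 0
        then show ?thesis using R k by (auto simp: hd_conv_nth)
      next
        case (Suc l)
        then show ?thesis using R k by auto
      qed
    qed
  qed
  then show ?thesis unfolding admissible_def by auto
qed

lemma admissible_append:
  "admissible I A (u @ v) \<longleftrightarrow> admissible I A u \<and> admissible I A v \<and> (u = [] \<or> v = [] \<or> A (last u) (hd v))"
  by (induction u) (auto simp: admissible_Cons hd_append split: if_splits)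

lemma pre_in_shift_space:
  "pre w x \<in> shift_space I A \<longleftrightarrow> admissible I A (w @ [x 0]) \<and> x \<in> shift_space I A"
proof (induction w)
  case Nil
  then show ?case by (auto simp: admissible_Cons shift_space_def)
next
  case (Cons i w)
  have "pre w x 0 = hd (w @ [x 0])" by (cases w) auto
  then show ?case using Cons by (auto simp: case_nat_in_shift_space admissible_Cons)
qed

lemma cylinder_Nil [simp]: "cylinder I A [] = shift_space I A"
  by (auto simp: cylinder_def)

lemma mem_cylinder_Cons:
  "x \<in> cylinder I A (i # w) \<longleftrightarrow> x \<in> shift_space I A \<and> x 0 = i \<and> left_shift x \<in> cylinder I A w"
proof -
  have "(\<forall>k<length (i # w). x k = (i # w) ! k) \<longleftrightarrow> x 0 = i \<and> (\<forall>k<length w. x (Suc k) = w ! k)"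
    by (simp add: All_less_Suc2)
  then show ?thesis unfolding cylinder_def using left_shift_in_shift_space
    by (auto simp: left_shift_def)
qed

lemma cylinder_subset: "cylinder I A w \<subseteq> shift_space I A"
  by (auto simp: cylinder_def)

lemma pre_in_cylinder: "pre w x \<in> shift_space I A \<Longrightarrow> pre w x \<in> cylinder I A w"
  by (induction w) (auto simp: mem_cylinder_Cons case_nat_in_shift_space)

lemma cylinder_disjoint:
  assumes "length u = length v" "u \<noteq> v"
  shows "cylinder I A u \<inter> cylinder I A v = {}"
  using assms nth_equalityI[of u v] by (auto simp: cylinder_def)

lemma cylinder_admissible:
  "x \<in> cylinder I A w \<Longrightarrow> admissible I A w"
  unfolding cylinder_def shift_space_def admissible_def
  by (auto simp: in_set_conv_nth) (metis Suc_lessD)+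

lemma mem_cylinder_append:
  "x \<in> cylinder I A (u @ v) \<longleftrightarrow> x \<in> cylinder I A u \<and> (\<lambda>j. x (j + length u)) \<in> cylinder I A v"
proof (induction u arbitrary: x)
  case Nil
  then show ?case using cylinder_subset by auto
next
  case (Cons i u)
  have "(\<lambda>j. x (j + length (i # u))) = (\<lambda>j. left_shift x (j + length u))"
    by (simp add: left_shift_def)
  then show ?case unfolding append_Cons mem_cylinder_Cons Cons.IH by simp
qed

lemma birkhoff_sum_add:
  "birkhoff_sum \<phi> (k + l) x = birkhoff_sum \<phi> k x + birkhoff_sum \<phi> l (\<lambda>j. x (j + k))"
  by (induction l) (simp_all add: birkhoff_sum_def add.assoc add.commute add.left_commute)

section \<open>Standing hypotheses and quasi-multiplicativity of the Gibbs measure\<close>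

text \<open>Here \<open>P\<close> is any real number for which the Gibbs bounds hold. It is
  identified with the pressure only in the final theorem.\<close>

locale gibbs_extension = group G for G :: "('g, 'b) monoid_scheme" (structure) +
  fixes I :: "nat set" and A :: "nat \<Rightarrow> nat \<Rightarrow> bool" and \<Psi> :: "nat \<Rightarrow> 'g"
    and \<phi> :: "(nat \<Rightarrow> nat) \<Rightarrow> real" and \<mu> :: "(nat \<Rightarrow> nat) measure" and P C :: real
  assumes bip: "bip I A" and nonempty: "I \<noteq> {}"
    and countable_carrier: "countable (carrier G)"
    and Psi: "\<And>i. i \<in> I \<Longrightarrow> \<Psi> i \<in> carrier G"
    and irred: "ext_irreducible I A G \<Psi>"
    and hoelder: "hoelder I A \<phi>"
    and prob: "prob_space \<mu>"
    and space: "space \<mu> = shift_space I A"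
    and sets: "sets \<mu> = sigma_sets (shift_space I A) (range (cylinder I A))"
    and shift_measurable: "left_shift \<in> measurable \<mu> \<mu>"
    and shift_invariant: "distr \<mu> \<mu> left_shift = \<mu>"
    and C1: "C \<ge> 1"
    and gibbs: "\<And>w \<tau>. admissible I A w \<Longrightarrow> \<tau> \<in> cylinder I A w \<Longrightarrow>
        inverse C \<le> measure \<mu> (cylinder I A w) / exp (birkhoff_sum \<phi> (length w) \<tau> - real (length w) * P)
        \<and> measure \<mu> (cylinder I A w) / exp (birkhoff_sum \<phi> (length w) \<tau> - real (length w) * P) \<le> C"
begin

sublocale prob_space \<mu> by (rule prob)

abbreviation "X \<equiv> shift_space I A"

abbreviation "cyl \<equiv> cylinder I A"

abbreviation "adm \<equiv> admissible I A"

abbreviation "nrm \<equiv> Hinf_norm \<mu> G"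

definition m :: "nat list \<Rightarrow> real" where "m w = prob (cyl w)"

text \<open>One factor \<open>C\<close> for each of the three cylinders \<open>u\<close>,
  \<open>v\<close> and \<open>u @ v\<close> that are compared when a word is split.\<close>

definition K :: real where "K = C ^ 3"

lemma K1: "K \<ge> 1" unfolding K_def using C1 by (rule one_le_power)

lemma cylinder_sets [measurable]: "cyl w \<in> sets \<mu>"
  unfolding sets by (auto intro: sigma_sets.Basic)

lemma successor: "i \<in> I \<Longrightarrow> \<exists>j\<in>I. A i j"
  using bip unfolding bip_def by (auto simp: admissible_Cons subset_iff)

lemma exists_point:
  assumes "i \<in> I"
  obtains x where "x \<in> X" "x 0 = i"
proof -
  obtain nx where nx: "\<And>i. i \<in> I \<Longrightarrow> nx i \<in> I \<and> A i (nx i)" using successor by metis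
  define x where "x = rec_nat i (\<lambda>_. nx)"
  have "x k \<in> I" for k by (induction k) (auto simp: x_def assms nx)
  then have "x \<in> X" unfolding shift_space_def using nx by (auto simp: x_def)
  then show ?thesis using that[of x] by (simp add: x_def)
qed

lemma cylinder_nonempty:
  assumes "adm w"
  shows "cyl w \<noteq> {}"
proof (cases w rule: rev_cases)
  case Nil
  then show ?thesis using exists_point nonempty by auto
next
  case (snoc u i)
  then have "i \<in> I" using assms by (auto simp: admissible_def)
  then obtain x where x: "x \<in> X" "x 0 = i" by (rule exists_point)
  then have "pre u x \<in> X" using assms snoc by (simp add: pre_in_shift_space)
  then have "pre w (left_shift x) \<in> X" using x snoc by (simp add: pre_append case_nat_left_shift)
  then show ?thesis using pre_in_cylinder by blast
qed

lemma m_nonneg [simp]: "m w \<ge> 0" by (simp add: m_def)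

lemma m_le_1: "m w \<le> 1" by (simp add: m_def)

lemma m_Nil [simp]: "m [] = 1" using prob_space by (simp add: m_def space)

lemma m_not_admissible: "\<not> adm w \<Longrightarrow> m w = 0"
  using cylinder_admissible by (cases "cyl w = {}") (auto simp: m_def)

lemma gibbs_lower:
  assumes "\<tau> \<in> cyl w"
  shows "exp (birkhoff_sum \<phi> (length w) \<tau>) \<le> C * exp (real (length w) * P) * m w"
  using gibbs[OF cylinder_admissible[OF assms] assms] C1
  by (simp add: m_def exp_diff field_simps)

lemma gibbs_upper:
  assumes "\<tau> \<in> cyl w"
  shows "m w * exp (real (length w) * P) \<le> C * exp (birkhoff_sum \<phi> (length w) \<tau>)"
  using gibbs[OF cylinder_admissible[OF assms] assms]
  by (simp add: m_def exp_diff field_simps)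

lemma m_pos: "adm w \<Longrightarrow> m w > 0"
proof -
  assume "adm w"
  then obtain \<tau> where t: "\<tau> \<in> cyl w" using cylinder_nonempty by blast
  have "0 < exp (birkhoff_sum \<phi> (length w) \<tau>)" by simp
  also have "\<dots> \<le> C * exp (real (length w) * P) * m w" by (rule gibbs_lower[OF t])
  finally show ?thesis by (cases "m w = 0") (auto simp: less_le)
qed

text \<open>At a point of the joint cylinder the Birkhoff sum splits exactly, so the three Gibbs
  estimates can be compared at one and the same point.\<close>

lemma m_append_bounds:
  assumes "adm (u @ v)"
  shows "m (u @ v) \<le> K * m u * m v \<and> m u * m v \<le> K * m (u @ v)"
proof -
  obtain \<tau> where t: "\<tau> \<in> cyl (u @ v)" using cylinder_nonempty[OF assms] by blast
  let ?s = "\<lambda>j. \<tau> (j + length u)"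
  have tu: "\<tau> \<in> cyl u" and tv: "?s \<in> cyl v" using t by (auto simp: mem_cylinder_append)
  define eu where "eu = exp (birkhoff_sum \<phi> (length u) \<tau>)"
  define ev where "ev = exp (birkhoff_sum \<phi> (length v) ?s)"
  define pu where "pu = exp (real (length u) * P)"
  define pv where "pv = exp (real (length v) * P)"
  have pos: "eu > 0" "ev > 0" "pu > 0" "pv > 0" unfolding eu_def ev_def pu_def pv_def by auto
  have 1: "m (u @ v) * (pu * pv) \<le> C * (eu * ev)"
    using gibbs_upper[OF t] unfolding eu_def ev_def pu_def pv_def
    by (simp add: birkhoff_sum_add exp_add[symmetric] algebra_simps)
  have ge: "eu * ev \<le> C * (pu * pv) * m (u @ v)"
    using gibbs_lower[OF t] unfolding eu_def ev_def pu_def pv_def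
    by (simp add: birkhoff_sum_add exp_add[symmetric] algebra_simps)
  have 2: "eu \<le> C * pu * m u" "ev \<le> C * pv * m v"
    using gibbs_lower[OF tu] gibbs_lower[OF tv] unfolding eu_def ev_def pu_def pv_def by auto
  have 3: "m u * pu \<le> C * eu" "m v * pv \<le> C * ev"
    using gibbs_upper[OF tu] gibbs_upper[OF tv] unfolding eu_def ev_def pu_def pv_def by auto
  have "C * (eu * ev) \<le> C * ((C * pu * m u) * (C * pv * m v))"
    using 2 pos C1 by (intro mult_left_mono mult_mono) auto
  then have "m (u @ v) * (pu * pv) \<le> (K * m u * m v) * (pu * pv)"
    using 1 unfolding K_def by (simp add: power3_eq_cube algebra_simps)
  then have a: "m (u @ v) \<le> K * m u * m v" using pos by (simp add: mult_le_cancel_right)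
  have "(m u * pu) * (m v * pv) \<le> (C * eu) * (C * ev)"
    by (rule mult_mono[OF 3]) (use pos C1 in auto)
  also have "\<dots> = C^2 * (eu * ev)" by (simp add: power2_eq_square)
  also have "\<dots> \<le> C^2 * (C * (pu * pv) * m (u @ v))" using ge by (intro mult_left_mono) auto
  finally have "(m u * m v) * (pu * pv) \<le> (K * m (u @ v)) * (pu * pv)"
    unfolding K_def by (simp add: power3_eq_cube power2_eq_square algebra_simps)
  then have b: "m u * m v \<le> K * m (u @ v)" using pos by (simp add: mult_le_cancel_right)
  show ?thesis using a b by simp
qed

lemma m_append_le: "m (u @ v) \<le> K * m u * m v"
proof (cases "adm (u @ v)")
  case False
  then show ?thesis using K1 by (simp add: m_not_admissible)
qed (use m_append_bounds in simp)

text \<open>Unlike the upper bound, this one fails when the junction is forbidden. That is why words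
  are later sorted by a letter that may follow them.\<close>

lemma m_append_ge: "adm (u @ v) \<Longrightarrow> m u * m v \<le> K * m (u @ v)"
  using m_append_bounds by simp

lemma shift_measure: "B \<in> sets \<mu> \<Longrightarrow> prob {x \<in> X. left_shift x \<in> B} = prob B"
proof -
  assume B: "B \<in> sets \<mu>"
  have "prob B = measure (distr \<mu> \<mu> left_shift) B" by (simp add: shift_invariant)
  also have "\<dots> = prob (left_shift -` B \<inter> space \<mu>)" by (rule measure_distr[OF shift_measurable B])
  also have "left_shift -` B \<inter> space \<mu> = {x \<in> X. left_shift x \<in> B}" by (auto simp: space)
  finally show ?thesis by simp
qed

lemma shift_sets: "B \<in> sets \<mu> \<Longrightarrow> {x \<in> X. left_shift x \<in> B} \<in> sets \<mu>"
  using measurable_sets[OF shift_measurable, of B] by (simp add: space vimage_def Int_def conj_commute)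

text \<open>Shift invariance of the measure. No constant is lost, in contrast to
  \<open>m_append_le\<close>; the martingale estimates rest on this.\<close>

lemma m_Cons_sum_le:
  assumes "finite J"
  shows "(\<Sum>i\<in>J. m (i # w)) \<le> m w"
proof -
  have "(\<Sum>i\<in>J. m (i # w)) = prob (\<Union>i\<in>J. cyl (i # w))"
    unfolding m_def using assms
    by (intro finite_measure_finite_Union[symmetric]) (auto simp: disjoint_family_on_def mem_cylinder_Cons)
  also have "\<dots> \<le> prob {x \<in> X. left_shift x \<in> cyl w}"
    by (intro finite_measure_mono shift_sets) (auto simp: mem_cylinder_Cons)
  finally show ?thesis by (simp add: shift_measure m_def)
qed

lemma sum_m_le_1:
  assumes "finite W" "\<And>w. w \<in> W \<Longrightarrow> length w = n"
  shows "(\<Sum>w\<in>W. m w) \<le> 1"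
proof -
  have "(\<Sum>w\<in>W. m w) = prob (\<Union>w\<in>W. cyl w)"
    unfolding m_def using assms cylinder_disjoint
    by (intro finite_measure_finite_Union[symmetric]) (auto simp: disjoint_family_on_def)
  then show ?thesis by simp
qed

end

section \<open>Decay of word averages without Folner sets\<close>

text \<open>For total weight exactly \<open>M\<close> this is the variance identity with mean
  \<open>y\<close>. Missing weight only helps, as it contributes
  \<open>y\<^sup>2 * (sum p U - M)\<close>, which is at most zero.\<close>

lemma weighted_variance_le:
  fixes p x :: "'a \<Rightarrow> real"
  assumes "sum p U \<le> M" "(\<Sum>u\<in>U. p u * x u) = M * y"
  shows "M * y\<^sup>2 + (\<Sum>u\<in>U. p u * (x u - y)\<^sup>2) \<le> (\<Sum>u\<in>U. p u * (x u)\<^sup>2)"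
proof -
  have "(\<Sum>u\<in>U. p u * (x u - y)\<^sup>2) = (\<Sum>u\<in>U. p u * (x u)\<^sup>2 - 2 * y * (p u * x u) + y\<^sup>2 * p u)"
    by (intro sum.cong refl) (simp add: power2_eq_square algebra_simps)
  also have "\<dots> = (\<Sum>u\<in>U. p u * (x u)\<^sup>2) - 2 * y * (M * y) + y\<^sup>2 * sum p U"
    by (simp add: sum.distrib sum_subtractf sum_distrib_left[symmetric] assms(2))
  also have "\<dots> \<le> (\<Sum>u\<in>U. p u * (x u)\<^sup>2) - 2 * y * (M * y) + y\<^sup>2 * M"
    using assms(1) by (simp add: mult_left_mono)
  finally show ?thesis by (simp add: power2_eq_square algebra_simps)
qed

lemma weighted_mean_square_le:
  fixes p x :: "'a \<Rightarrow> real"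
  assumes "\<And>u. u \<in> U \<Longrightarrow> p u \<ge> 0" "sum p U \<le> 1"
  shows "(\<Sum>u\<in>U. p u * x u)\<^sup>2 \<le> (\<Sum>u\<in>U. p u * (x u)\<^sup>2)"
proof -
  have "1 * (\<Sum>u\<in>U. p u * x u)\<^sup>2 + (\<Sum>u\<in>U. p u * (x u - (\<Sum>u\<in>U. p u * x u))\<^sup>2) \<le> (\<Sum>u\<in>U. p u * (x u)\<^sup>2)"
    by (rule weighted_variance_le) (use assms in auto)
  moreover have "(\<Sum>u\<in>U. p u * (x u - (\<Sum>u\<in>U. p u * x u))\<^sup>2) \<ge> 0"
    using assms by (intro sum_nonneg) auto
  ultimately show ?thesis by linarith
qed

text \<open>After cancellation only the first \<open>k\<close> terms, minus \<open>k\<close> later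
  ones, remain.\<close>

lemma antitone_telescope_le:
  fixes e :: "nat \<Rightarrow> real"
  assumes anti: "\<And>i. i < n \<Longrightarrow> e (Suc i) \<le> e i" and nn: "\<And>i. i \<le> n \<Longrightarrow> e i \<ge> 0" and "L + k \<le> n"
  shows "(\<Sum>j<L. e j - e (j + k)) \<le> real k * e 0"
proof -
  have e0: "e i \<le> e 0" if "i \<le> n" for i
    using that by (induction i) (auto intro: order_trans[OF anti])
  have "(\<Sum>j<L. e (j + k)) + (\<Sum>j<k. e j) = (\<Sum>j<L + k. e j)"
    by (induction L) (simp_all add: ac_simps)
  also have "\<dots> = (\<Sum>j<L. e j) + (\<Sum>j<k. e (L + j))"
    by (induction k) (simp_all add: ac_simps)
  finally have "(\<Sum>j<L. e j - e (j + k)) = (\<Sum>j<k. e j) - (\<Sum>j<k. e (L + j))"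
    by (simp add: sum_subtractf)
  also have "\<dots> \<le> (\<Sum>j<k. e j)"
  proof -
    have "0 \<le> (\<Sum>j<k. e (L + j))" by (intro sum_nonneg nn) (use assms(3) in auto)
    then show ?thesis by linarith
  qed
  also have "\<dots> \<le> (\<Sum>j<k. e 0)" using e0 assms(3) by (intro sum_mono) auto
  finally show ?thesis by simp
qed

text \<open>Forbidden words are included, so that word sets factor under concatenation. They do no
  harm, since \<open>m\<close> vanishes on them.\<close>

definition words :: "nat set \<Rightarrow> nat \<Rightarrow> nat list set" where
  "words J n = {w. set w \<subseteq> J \<and> length w = n}"

lemma finite_words: "finite J \<Longrightarrow> finite (words J n)"
  unfolding words_def by (rule finite_lists_length_eq)

lemma words_0 [simp]: "words J 0 = {[]}" by (auto simp: words_def)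

lemma sum_words_add:
  "(\<Sum>w\<in>words J (a + b). f w) = (\<Sum>u\<in>words J a. \<Sum>v\<in>words J b. f (u @ v))"
proof -
  have "bij_betw (\<lambda>p. fst p @ snd p) (words J a \<times> words J b) (words J (a + b))"
  proof (rule bij_betwI[of _ _ _ "\<lambda>w. (take a w, drop a w)"])
    show "(\<lambda>w. (take a w, drop a w)) \<in> words J (a + b) \<rightarrow> words J a \<times> words J b"
      unfolding words_def by (auto dest!: in_set_takeD in_set_dropD)
  qed (auto simp: words_def)
  from sum.reindex_bij_betw[OF this, of f, symmetric]
  have "(\<Sum>w\<in>words J (a + b). f w) = (\<Sum>p\<in>words J a \<times> words J b. f (fst p @ snd p))"
    by simp
  then show ?thesis by (simp add: sum.cartesian_product case_prod_beta)
qed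

lemma sum_words_Suc:
  "(\<Sum>w\<in>words J (Suc n). f w) = (\<Sum>i\<in>J. \<Sum>v\<in>words J n. f (i # v))"
proof -
  have "words J 1 = (\<lambda>i. [i]) ` J" by (auto simp: words_def length_Suc_conv)
  then show ?thesis using sum_words_add[of f J 1 n] by (simp add: sum.reindex inj_on_def)
qed

context group
begin

lemma mult_cancel_inner:
  assumes "x \<in> carrier G" "p \<in> carrier G" "q \<in> carrier G"
  shows "x \<otimes> p \<otimes> (inv p \<otimes> q) = x \<otimes> q"
proof -
  have "x \<otimes> p \<otimes> (inv p \<otimes> q) = x \<otimes> ((p \<otimes> inv p) \<otimes> q)"
    using assms by (simp only: m_assoc m_closed inv_closed)
  then show ?thesis using assms by simp
qed

lemma sum_translate_le:
  fixes x :: "'a \<Rightarrow> real"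
  assumes "finite \<Gamma>" "\<Gamma> \<subseteq> carrier G" "t \<in> carrier G" "finite \<Delta>"
    and "\<And>h. h \<in> carrier G \<Longrightarrow> x h \<ge> 0"
    and "\<And>g. g \<in> \<Gamma> \<Longrightarrow> x (g \<otimes> t) \<noteq> 0 \<Longrightarrow> g \<otimes> t \<in> \<Delta>"
    and "\<Delta> \<subseteq> carrier G"
  shows "(\<Sum>g\<in>\<Gamma>. x (g \<otimes> t)) \<le> sum x \<Delta>"
proof -
  have "inj_on (\<lambda>g. g \<otimes> t) \<Gamma>" using assms by (auto simp: inj_on_def subset_iff)
  then have "(\<Sum>g\<in>\<Gamma>. x (g \<otimes> t)) = sum x ((\<lambda>g. g \<otimes> t) ` \<Gamma>)" by (simp add: sum.reindex)
  also have "\<dots> = sum x ((\<lambda>g. g \<otimes> t) ` \<Gamma> \<inter> \<Delta>)"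
    using assms by (intro sum.mono_neutral_right) auto
  also have "\<dots> \<le> sum x \<Delta>" using assms by (intro sum_mono2) auto
  finally show ?thesis .
qed

end

context gibbs_extension
begin

definition Pw :: "nat list \<Rightarrow> 'g" where "Pw w = foldr (\<lambda>i g. \<Psi> i \<otimes> g) w \<one>"

lemma Pw_Nil [simp]: "Pw [] = \<one>" and Pw_Cons [simp]: "Pw (i # w) = \<Psi> i \<otimes> Pw w"
  by (simp_all add: Pw_def)

lemma Pw_closed [intro, simp]: "set w \<subseteq> I \<Longrightarrow> Pw w \<in> carrier G"
  using Psi by (induction w) auto

lemma Pw_append: "set u \<subseteq> I \<Longrightarrow> set v \<subseteq> I \<Longrightarrow> Pw (u @ v) = Pw u \<otimes> Pw v"
  using Psi by (induction u) (auto simp: m_assoc)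

lemma sum_words_m_le:
  assumes "finite J"
  shows "(\<Sum>u\<in>words J k. m (u @ v)) \<le> m v"
proof (induction k)
  case (Suc k)
  have "(\<Sum>u\<in>words J (Suc k). m (u @ v)) = (\<Sum>u\<in>words J k. \<Sum>i\<in>J. m (i # u @ v))"
    by (simp add: sum_words_Suc sum.swap[of _ "words J k"])
  also have "\<dots> \<le> (\<Sum>u\<in>words J k. m (u @ v))"
    using assms by (intro sum_mono m_Cons_sum_le)
  finally show ?case using Suc by simp
qed simp

lemma sum_words_m_le_1: "finite J \<Longrightarrow> (\<Sum>u\<in>words J k. m u) \<le> 1"
  using sum_words_m_le[of J "[]" k] by simp

text \<open>Every admissible word may be followed by some letter of \<open>\<Lambda>\<close>, so
  each term is counted at least once on the right. Within one group all words can be continued by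
  any admissible word starting with \<open>b\<close>, which makes \<open>m_append_ge\<close>
  applicable.\<close>

lemma sum_le_follower_sums:
  fixes x :: "nat list \<Rightarrow> real"
  assumes \<Lambda>: "finite \<Lambda>" "\<And>i. i \<in> I \<Longrightarrow> \<exists>b\<in>\<Lambda>. A i b" "\<Lambda> \<subseteq> I" "\<Lambda> \<noteq> {}"
    and W: "finite W" "\<And>w. w \<in> W \<Longrightarrow> set w \<subseteq> I"
    and x: "\<And>w. x w \<ge> 0" "\<And>w. \<not> adm w \<Longrightarrow> x w = 0"
  shows "sum x W \<le> (\<Sum>b\<in>\<Lambda>. \<Sum>w\<in>{w \<in> W. adm (w @ [b])}. x w)"
proof -
  have "sum x W \<le> (\<Sum>w\<in>W. \<Sum>b\<in>\<Lambda>. if adm (w @ [b]) then x w else 0)"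
  proof (rule sum_mono)
    fix w assume w: "w \<in> W"
    show "x w \<le> (\<Sum>b\<in>\<Lambda>. if adm (w @ [b]) then x w else 0)"
    proof (cases "adm w")
      case False
      then show ?thesis using x by (auto intro!: sum_nonneg)
    next
      case True
      obtain b where b: "b \<in> \<Lambda>" "adm (w @ [b])"
      proof (cases "w = []")
        case True
        then show ?thesis using \<Lambda> that by (auto simp: admissible_Cons)
      next
        case False
        then have "last w \<in> I" using last_in_set[OF False] W(2)[OF w] by blast
        then obtain b where "b \<in> \<Lambda>" "A (last w) b" using \<Lambda>(2) by blast
        then show ?thesis using that[of b] True \<Lambda> by (auto simp: admissible_append admissible_Cons)
      qed
      then show ?thesis using x
        by (intro order_trans[OF _ member_le_sum[OF b(1)]]) (use \<Lambda> in auto)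
    qed
  qed
  also have "\<dots> = (\<Sum>b\<in>\<Lambda>. \<Sum>w\<in>W. if adm (w @ [b]) then x w else 0)" by (rule sum.swap)
  also have "\<dots> = (\<Sum>b\<in>\<Lambda>. \<Sum>w\<in>{w \<in> W. adm (w @ [b])}. x w)"
    using W by (simp add: sum.inter_filter)
  finally show ?thesis .
qed

section \<open>The reverse martingale over a finite alphabet\<close>

context
  fixes J :: "nat set" and n :: nat and F :: "'g \<Rightarrow> real" and B :: "'g set"
  assumes J: "finite J" "J \<subseteq> I"
    and F0: "\<And>g. F g \<ge> 0" and B: "finite B" "B \<subseteq> carrier G"
    and supp: "\<And>g. g \<in> carrier G \<Longrightarrow> F g \<noteq> 0 \<Longrightarrow> g \<in> B"
    and norm1: "(\<Sum>g\<in>B. (F g)\<^sup>2) \<le> 1"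
begin

text \<open>A reverse martingale in \<open>j\<close>: \<open>Y j v g\<close> averages \<open>F (g \<otimes> inv (Pw w))\<close> over the words \<open>w\<close> that extend \<open>v\<close> to the
  left by \<open>j\<close> letters of \<open>J\<close>, and \<open>En j\<close> is its second moment. Restricting to a finite alphabet only turns
  the martingale identity \<open>sum m = 1\<close> into \<open>\<le> 1\<close>, which the variance estimate tolerates.\<close>
definition Y :: "nat \<Rightarrow> nat list \<Rightarrow> 'g \<Rightarrow> real" where
  "Y j v g = (\<Sum>u\<in>words J j. m (u @ v) * F (g \<otimes> inv (Pw (u @ v)))) / m v"

definition En :: "nat \<Rightarrow> 'g \<Rightarrow> real" where
  "En j g = (\<Sum>v\<in>words J (n - j). m v * (Y j v g)\<^sup>2)"

text \<open>The unconditioned average, which is \<open>Y j []\<close>: right convolution of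
  \<open>F\<close> with the truncated law of \<open>Pw\<close> on words of length \<open>j\<close>.
  The aim is to make \<open>Q n\<close> small in mean square.\<close>

definition Q :: "nat \<Rightarrow> 'g \<Rightarrow> real" where
  "Q j g = (\<Sum>u\<in>words J j. m u * F (g \<otimes> inv (Pw u)))"

lemma words_carrier: "w \<in> words J l \<Longrightarrow> Pw w \<in> carrier G"
  using J unfolding words_def by auto

lemma m_Y: "m v * Y j v g = (\<Sum>u\<in>words J j. m (u @ v) * F (g \<otimes> inv (Pw (u @ v))))"
proof (cases "m v = 0")
  case True
  \<comment> \<open>Division by \<open>m v = 0\<close> makes \<open>Y\<close> zero by convention;
    this agrees with the right-hand side because extensions of a null word are null.\<close>
  have "m (u @ v) = 0" for u
    using m_append_le[of u v] m_nonneg[of "u @ v"] True by simp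
  then show ?thesis using True by simp
qed (simp add: Y_def)

lemma Y_nonneg: "Y j v g \<ge> 0"
  unfolding Y_def by (intro divide_nonneg_nonneg sum_nonneg mult_nonneg_nonneg F0) auto

lemma Q_nonneg: "Q j g \<ge> 0"
  unfolding Q_def by (intro sum_nonneg mult_nonneg_nonneg F0) auto

lemma En_nonneg: "En j g \<ge> 0"
  unfolding En_def by (intro sum_nonneg) auto

text \<open>The martingale property. It is an exact identity, since only the masses, not the
  averages of \<open>F\<close>, are affected by cutting the alphabet.\<close>

lemma Y_add: "(\<Sum>u\<in>words J k. m (u @ v) * Y j (u @ v) g) = m v * Y (j + k) v g"
proof -
  have "(\<Sum>u\<in>words J k. m (u @ v) * Y j (u @ v) g) =
      (\<Sum>u\<in>words J k. \<Sum>u'\<in>words J j. m ((u' @ u) @ v) * F (g \<otimes> inv (Pw ((u' @ u) @ v))))"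
    by (simp add: m_Y)
  also have "\<dots> = (\<Sum>u'\<in>words J j. \<Sum>u\<in>words J k. m ((u' @ u) @ v) * F (g \<otimes> inv (Pw ((u' @ u) @ v))))"
    by (rule sum.swap)
  also have "\<dots> = (\<Sum>w\<in>words J (j + k). m (w @ v) * F (g \<otimes> inv (Pw (w @ v))))"
    by (rule sum_words_add[symmetric])
  finally show ?thesis by (simp add: m_Y)
qed

text \<open>Pythagoras for the martingale: the squared increments between \<open>j\<close> and
  \<open>j + k\<close> are paid for by the loss of second moment.\<close>

lemma En_drop:
  assumes "j + k \<le> n"
  shows "En (j + k) g + (\<Sum>v\<in>words J (n - j - k). \<Sum>u\<in>words J k. m (u @ v) * (Y j (u @ v) g - Y (j + k) v g)\<^sup>2)
    \<le> En j g"
proof -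
  have "m v * (Y (j + k) v g)\<^sup>2 + (\<Sum>u\<in>words J k. m (u @ v) * (Y j (u @ v) g - Y (j + k) v g)\<^sup>2)
     \<le> (\<Sum>u\<in>words J k. m (u @ v) * (Y j (u @ v) g)\<^sup>2)" for v
    by (rule weighted_variance_le[OF sum_words_m_le[OF J(1)] Y_add])
  then have "En (j + k) g + (\<Sum>v\<in>words J (n - j - k). \<Sum>u\<in>words J k. m (u @ v) * (Y j (u @ v) g - Y (j + k) v g)\<^sup>2)
    \<le> (\<Sum>v\<in>words J (n - j - k). \<Sum>u\<in>words J k. m (u @ v) * (Y j (u @ v) g)\<^sup>2)"
    unfolding En_def diff_diff_left sum.distrib[symmetric] by (intro sum_mono)
  also have "\<dots> = (\<Sum>u\<in>words J k. \<Sum>v\<in>words J (n - j - k). m (u @ v) * (Y j (u @ v) g)\<^sup>2)"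
    by (rule sum.swap)
  also have "\<dots> = En j g"
    using assms sum_words_add[of "\<lambda>w. m w * (Y j w g)\<^sup>2" J k "n - j - k"] unfolding En_def by simp
  finally show ?thesis .
qed

lemma En_mono: "j + k \<le> n \<Longrightarrow> En (j + k) g \<le> En j g"
proof -
  assume *: "j + k \<le> n"
  have "0 \<le> (\<Sum>v\<in>words J (n - j - k). \<Sum>u\<in>words J k. m (u @ v) * (Y j (u @ v) g - Y (j + k) v g)\<^sup>2)"
    by (intro sum_nonneg) auto
  then show ?thesis using En_drop[OF *, of g] by linarith
qed

lemma En_last: "En n g = (Q n g)\<^sup>2"
  unfolding En_def by (simp add: Y_def Q_def)

lemma sum_F_translate:
  assumes "finite \<Gamma>" "\<Gamma> \<subseteq> carrier G" "t \<in> carrier G"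
  shows "(\<Sum>g\<in>\<Gamma>. (F (g \<otimes> t))\<^sup>2) \<le> 1"
proof -
  have "(\<Sum>g\<in>\<Gamma>. (F (g \<otimes> t))\<^sup>2) \<le> (\<Sum>g\<in>B. (F g)\<^sup>2)"
    by (rule sum_translate_le[of \<Gamma> t B "\<lambda>g. (F g)\<^sup>2"]) (use assms B supp in auto)
  then show ?thesis using norm1 by linarith
qed

lemma sum_weighted_F_le:
  assumes "finite \<Gamma>" "\<Gamma> \<subseteq> carrier G"
  shows "(\<Sum>g\<in>\<Gamma>. \<Sum>w\<in>words J l. m w * (F (g \<otimes> inv (Pw w)))\<^sup>2) \<le> 1"
proof -
  have "(\<Sum>g\<in>\<Gamma>. \<Sum>w\<in>words J l. m w * (F (g \<otimes> inv (Pw w)))\<^sup>2) =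
      (\<Sum>w\<in>words J l. m w * (\<Sum>g\<in>\<Gamma>. (F (g \<otimes> inv (Pw w)))\<^sup>2))"
    by (simp add: sum.swap[of _ \<Gamma>] sum_distrib_left)
  also have "\<dots> \<le> (\<Sum>w\<in>words J l. m w * 1)"
    using assms words_carrier by (intro sum_mono mult_left_mono sum_F_translate) auto
  also have "\<dots> \<le> 1" using sum_words_m_le_1[OF J(1)] by simp
  finally show ?thesis .
qed

lemma En_0_sum:
  assumes "finite \<Gamma>" "\<Gamma> \<subseteq> carrier G"
  shows "(\<Sum>g\<in>\<Gamma>. En 0 g) \<le> 1"
proof -
  have "m w * (Y 0 w g)\<^sup>2 \<le> m w * (F (g \<otimes> inv (Pw w)))\<^sup>2" for w g
    by (cases "m w = 0") (auto simp: Y_def)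
  then have "(\<Sum>g\<in>\<Gamma>. En 0 g) \<le> (\<Sum>g\<in>\<Gamma>. \<Sum>w\<in>words J n. m w * (F (g \<otimes> inv (Pw w)))\<^sup>2)"
    unfolding En_def by (simp add: sum_mono)
  then show ?thesis using sum_weighted_F_le[OF assms] by (meson order_trans)
qed

lemma Q_sum:
  assumes "finite \<Gamma>" "\<Gamma> \<subseteq> carrier G"
  shows "(\<Sum>g\<in>\<Gamma>. (Q j g)\<^sup>2) \<le> 1"
proof -
  have "(Q j g)\<^sup>2 \<le> (\<Sum>w\<in>words J j. m w * (F (g \<otimes> inv (Pw w)))\<^sup>2)" for g
    unfolding Q_def by (rule weighted_mean_square_le) (auto simp: sum_words_m_le_1 J)
  then have "(\<Sum>g\<in>\<Gamma>. (Q j g)\<^sup>2) \<le> (\<Sum>g\<in>\<Gamma>. \<Sum>w\<in>words J j. m w * (F (g \<otimes> inv (Pw w)))\<^sup>2)"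
    by (intro sum_mono)
  then show ?thesis using sum_weighted_F_le[OF assms] by (meson order_trans)
qed

text \<open>By \<open>m_append_le\<close>, conditioning on the tail \<open>v\<close> costs a factor
  \<open>K\<close> and moves the base point by \<open>inv (Pw v)\<close>.\<close>

lemma Y_le_Q:
  assumes v: "v \<in> words J l" and g: "g \<in> carrier G"
  shows "Y j v g \<le> K * Q j (g \<otimes> inv (Pw v))"
proof (cases "m v = 0")
  case True
  then show ?thesis using Q_nonneg K1 by (simp add: Y_def)
next
  case False
  then have mv: "m v > 0" using m_nonneg[of v] by linarith
  have "m v * Y j v g \<le> (\<Sum>u\<in>words J j. (K * m u * m v) * F (g \<otimes> inv (Pw v) \<otimes> inv (Pw u)))"
    unfolding m_Y
  proof (intro sum_mono)
    fix u assume u: "u \<in> words J j"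
    have "g \<otimes> inv (Pw (u @ v)) = g \<otimes> inv (Pw v) \<otimes> inv (Pw u)"
      using u v g J words_carrier[OF u] words_carrier[OF v]
      by (subst Pw_append) (auto simp: words_def inv_mult_group m_assoc)
    then show "m (u @ v) * F (g \<otimes> inv (Pw (u @ v))) \<le> (K * m u * m v) * F (g \<otimes> inv (Pw v) \<otimes> inv (Pw u))"
      using m_append_le[of u v] F0 by (simp add: mult_right_mono)
  qed
  also have "\<dots> = m v * (K * Q j (g \<otimes> inv (Pw v)))"
    unfolding Q_def by (simp add: sum_distrib_left algebra_simps)
  finally show ?thesis using mv by simp
qed

text \<open>The part of \<open>Q\<close> carried by words that \<open>b\<close> may follow. Only for
  this part does the reverse comparison with \<open>Y\<close> hold, because it needs
  \<open>m_append_ge\<close>.\<close>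

definition D :: "nat \<Rightarrow> nat \<Rightarrow> 'g \<Rightarrow> real" where
  "D j b g = (\<Sum>u\<in>{u \<in> words J j. adm (u @ [b])}. m u * F (g \<otimes> inv (Pw u)))"

lemma D_nonneg: "D j b g \<ge> 0"
  unfolding D_def by (intro sum_nonneg mult_nonneg_nonneg F0) auto

lemma D_le_Y:
  assumes v: "v \<in> words J l" "v \<noteq> []" "hd v = b" "m v > 0" and g: "g \<in> carrier G"
  shows "D j b g \<le> K * Y j v (g \<otimes> Pw v)"
proof -
  have av: "adm v" using v(4) m_not_admissible[of v] by auto
  have fin: "finite (words J j)" using J by (rule_tac finite_words)
  have "m v * D j b g \<le> (\<Sum>u\<in>{u \<in> words J j. adm (u @ [b])}. K * m (u @ v) * F (g \<otimes> Pw v \<otimes> inv (Pw (u @ v))))"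
    unfolding D_def sum_distrib_left
  proof (intro sum_mono)
    fix u assume u: "u \<in> {u \<in> words J j. adm (u @ [b])}"
    then have uc: "Pw u \<in> carrier G" "set u \<subseteq> I" using words_carrier J by (auto simp: words_def)
    have vc: "Pw v \<in> carrier G" "set v \<subseteq> I" using v words_carrier J by (auto simp: words_def)
    have "g \<otimes> Pw v \<otimes> inv (Pw (u @ v)) = g \<otimes> inv (Pw u)"
      using uc vc g by (simp add: Pw_append inv_mult_group mult_cancel_inner)
    moreover have "adm (u @ v)" using u av v by (auto simp: admissible_append)
    then have "m u * m v \<le> K * m (u @ v)" by (rule m_append_ge)
    ultimately show "m v * (m u * F (g \<otimes> inv (Pw u))) \<le> K * m (u @ v) * F (g \<otimes> Pw v \<otimes> inv (Pw (u @ v)))"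
      using mult_right_mono[OF _ F0[of "g \<otimes> inv (Pw u)"], of "m u * m v" "K * m (u @ v)"]
      by (simp add: algebra_simps)
  qed
  also have "\<dots> \<le> (\<Sum>u\<in>words J j. K * m (u @ v) * F (g \<otimes> Pw v \<otimes> inv (Pw (u @ v))))"
    using fin F0 K1 by (intro sum_mono2) auto
  also have "\<dots> = K * (m v * Y j v (g \<otimes> Pw v))" unfolding m_Y by (simp add: sum_distrib_left algebra_simps)
  finally show ?thesis using v(4) by simp
qed

lemma Q_le_D:
  assumes \<Lambda>: "finite \<Lambda>" "\<And>i. i \<in> I \<Longrightarrow> \<exists>b\<in>\<Lambda>. A i b" "\<Lambda> \<subseteq> I" "\<Lambda> \<noteq> {}"
  shows "Q j g \<le> (\<Sum>b\<in>\<Lambda>. D j b g)"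
  unfolding Q_def D_def
proof (rule sum_le_follower_sums[OF \<Lambda> finite_words[OF J(1)]])
  show "set w \<subseteq> I" if "w \<in> words J j" for w using that J by (auto simp: words_def)
qed (use F0 in \<open>simp_all add: m_not_admissible\<close>)

text \<open>One finite set carries all \<open>Q j\<close> up to time \<open>n\<close>, because
  \<open>J\<close> and the support of \<open>F\<close> are finite; sums over the group become finite
  sums.\<close>

lemma Q_support:
  obtains \<Gamma> where "finite \<Gamma>" "\<Gamma> \<subseteq> carrier G"
    "\<And>j g. j \<le> n \<Longrightarrow> g \<in> carrier G \<Longrightarrow> Q j g \<noteq> 0 \<Longrightarrow> g \<in> \<Gamma>"
proof
  let ?\<Gamma> = "\<Union>j\<in>{..n}. \<Union>u\<in>words J j. (\<lambda>h. h \<otimes> Pw u) ` B"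
  show "finite ?\<Gamma>" using B J by (auto intro!: finite_words)
  show "?\<Gamma> \<subseteq> carrier G" using B words_carrier by auto
  fix j g assume j: "j \<le> n" and g: "g \<in> carrier G" and "Q j g \<noteq> 0"
  then obtain u where u: "u \<in> words J j" "F (g \<otimes> inv (Pw u)) \<noteq> 0"
    unfolding Q_def by (metis (no_types, lifting) mult_zero_right sum.not_neutral_contains_not_neutral)
  have uc: "Pw u \<in> carrier G" using words_carrier u by auto
  then have "g \<otimes> inv (Pw u) \<in> B" using supp g u by auto
  moreover have "g = g \<otimes> inv (Pw u) \<otimes> Pw u" using g uc by (simp add: m_assoc)
  ultimately show "g \<in> ?\<Gamma>" using j u(1) by blast
qed

text \<open>The last energy is dominated by every earlier one: the second moments decrease to that
  of \<open>Q n\<close>, and \<open>Y_le_Q\<close> compares them with \<open>Q j\<close>. Hence a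
  bound on the sum of energies over time makes the last one small.\<close>

lemma Q_last_le:
  assumes j: "j \<le> n" and \<Gamma>: "finite \<Gamma>" "\<Gamma> \<subseteq> carrier G"
    and \<Delta>: "finite \<Delta>" "\<Delta> \<subseteq> carrier G" "\<And>g. g \<in> carrier G \<Longrightarrow> Q j g \<noteq> 0 \<Longrightarrow> g \<in> \<Delta>"
  shows "(\<Sum>g\<in>\<Gamma>. (Q n g)\<^sup>2) \<le> K\<^sup>2 * (\<Sum>g\<in>\<Delta>. (Q j g)\<^sup>2)"
proof -
  have "(Q n g)\<^sup>2 \<le> (\<Sum>v\<in>words J (n - j). m v * (K * Q j (g \<otimes> inv (Pw v)))\<^sup>2)" if g: "g \<in> \<Gamma>" for g
  proof -
    have "(Q n g)\<^sup>2 \<le> En j g" using En_mono[of j "n - j" g] j by (simp add: En_last)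
    also have "\<dots> \<le> (\<Sum>v\<in>words J (n - j). m v * (K * Q j (g \<otimes> inv (Pw v)))\<^sup>2)"
      unfolding En_def using Y_le_Q Y_nonneg g \<Gamma> by (intro sum_mono mult_left_mono power_mono) auto
    finally show ?thesis .
  qed
  then have "(\<Sum>g\<in>\<Gamma>. (Q n g)\<^sup>2) \<le> (\<Sum>g\<in>\<Gamma>. \<Sum>v\<in>words J (n - j). m v * (K * Q j (g \<otimes> inv (Pw v)))\<^sup>2)"
    by (intro sum_mono)
  also have "\<dots> = (\<Sum>v\<in>words J (n - j). m v * (K\<^sup>2 * (\<Sum>g\<in>\<Gamma>. (Q j (g \<otimes> inv (Pw v)))\<^sup>2)))"
    by (simp add: sum.swap[of _ \<Gamma>] sum_distrib_left power_mult_distrib)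
  also have "\<dots> \<le> (\<Sum>v\<in>words J (n - j). m v * (K\<^sup>2 * (\<Sum>g\<in>\<Delta>. (Q j g)\<^sup>2)))"
  proof (intro sum_mono mult_left_mono)
    fix v assume v: "v \<in> words J (n - j)"
    show "(\<Sum>g\<in>\<Gamma>. (Q j (g \<otimes> inv (Pw v)))\<^sup>2) \<le> (\<Sum>g\<in>\<Delta>. (Q j g)\<^sup>2)"
      by (rule sum_translate_le[of \<Gamma> "inv (Pw v)" \<Delta> "\<lambda>g. (Q j g)\<^sup>2"])
         (use \<Gamma> \<Delta> words_carrier[OF v] in \<open>auto simp: subset_iff\<close>)
  qed auto
  also have "\<dots> = (\<Sum>v\<in>words J (n - j). m v) * (K\<^sup>2 * (\<Sum>g\<in>\<Delta>. (Q j g)\<^sup>2))"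
    by (simp add: sum_distrib_right)
  also have "\<dots> \<le> 1 * (K\<^sup>2 * (\<Sum>g\<in>\<Delta>. (Q j g)\<^sup>2))"
    by (intro mult_right_mono sum_words_m_le_1 J mult_nonneg_nonneg sum_nonneg) auto
  finally show ?thesis by simp
qed

text \<open>These errors telescope in \<open>j\<close>.\<close>
definition Err :: "nat list \<Rightarrow> nat \<Rightarrow> 'g \<Rightarrow> real" where
  "Err u j g = (\<Sum>v\<in>words J (n - j - length u).
     m (u @ v) * (Y j (u @ v) (g \<otimes> Pw (u @ v)) - Y (j + length u) v (g \<otimes> Pw (u @ v)))\<^sup>2)"

lemma Err_nonneg: "Err u j g \<ge> 0"
  unfolding Err_def by (intro sum_nonneg) auto

text \<open>Transport along \<open>u\<close>: \<open>D j\<close> at \<open>g\<close> is at most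
  \<open>K\<close> times \<open>Y j (u @ v)\<close>; this is replaced by
  \<open>Y (j + length u) v\<close> at the price of a martingale increment, and
  \<open>Y_le_Q\<close> returns to \<open>Q\<close> at \<open>g \<otimes> Pw u\<close>. Two factors
  \<open>K\<close>, squared, and the 2 from squaring a sum give \<open>2 * K ^ 4\<close>. Averaging
  over \<open>v\<close> requires the extensions of \<open>u\<close> to have mass at least
  \<open>\<gamma>\<close>.\<close>

lemma D_square_le:
  assumes u: "set u \<subseteq> J" "u \<noteq> []" "hd u = b" and g: "g \<in> carrier G"
    and \<gamma>: "\<gamma> > 0" "\<gamma> \<le> (\<Sum>v\<in>words J (n - j - length u). m (u @ v))"
  shows "(D j b g)\<^sup>2 \<le> 2 * K ^ 4 * (Q (j + length u) (g \<otimes> Pw u))\<^sup>2 + 2 * K\<^sup>2 / \<gamma> * Err u j g"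
proof -
  let ?l = "length u"
  define M where "M = (\<Sum>v\<in>words J (n - j - ?l). m (u @ v))"
  define q where "q = Q (j + ?l) (g \<otimes> Pw u)"
  define d where "d v = Y j (u @ v) (g \<otimes> Pw (u @ v)) - Y (j + ?l) v (g \<otimes> Pw (u @ v))" for v
  have one: "m (u @ v) * (D j b g)\<^sup>2 \<le> 2 * K ^ 4 * q\<^sup>2 * m (u @ v) + 2 * K\<^sup>2 * (m (u @ v) * (d v)\<^sup>2)"
    if v: "v \<in> words J (n - j - ?l)" for v
  proof (cases "m (u @ v) = 0")
    case False
    then have pos: "m (u @ v) > 0" using m_nonneg[of "u @ v"] by linarith
    have uv: "u @ v \<in> words J (?l + (n - j - ?l))" using u v by (auto simp: words_def)
    have 1: "D j b g \<le> K * Y j (u @ v) (g \<otimes> Pw (u @ v))"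
      by (rule D_le_Y[OF uv _ _ pos g]) (use u in auto)
    have uc: "Pw u \<in> carrier G" "Pw v \<in> carrier G" "set u \<subseteq> I" "set v \<subseteq> I"
      using u v J words_carrier by (auto simp: words_def)
    \<comment> \<open>The contribution of \<open>v\<close> cancels, so the bound is the same for all
      \<open>v\<close>.\<close>
    have "g \<otimes> Pw (u @ v) \<otimes> inv (Pw v) = g \<otimes> Pw u"
      using uc g by (simp add: Pw_append m_assoc)
    then have 2: "Y (j + ?l) v (g \<otimes> Pw (u @ v)) \<le> K * q"
      using Y_le_Q[OF v, of "g \<otimes> Pw (u @ v)" "j + ?l"] uc g unfolding q_def by (simp add: Pw_append)
    have "(D j b g)\<^sup>2 \<le> (K * Y j (u @ v) (g \<otimes> Pw (u @ v)))\<^sup>2"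
      using 1 D_nonneg by (intro power_mono) auto
    also have "\<dots> = K\<^sup>2 * (Y (j + ?l) v (g \<otimes> Pw (u @ v)) + d v)\<^sup>2"
      unfolding d_def by (simp add: power_mult_distrib)
    also have "\<dots> \<le> K\<^sup>2 * (2 * (Y (j + ?l) v (g \<otimes> Pw (u @ v)))\<^sup>2 + 2 * (d v)\<^sup>2)"
    proof (intro mult_left_mono)
      have "0 \<le> (Y (j + ?l) v (g \<otimes> Pw (u @ v)) - d v)\<^sup>2" by simp
      then show "(Y (j + ?l) v (g \<otimes> Pw (u @ v)) + d v)\<^sup>2 \<le> 2 * (Y (j + ?l) v (g \<otimes> Pw (u @ v)))\<^sup>2 + 2 * (d v)\<^sup>2"
        by (simp add: power2_eq_square algebra_simps)
    qed simp
    also have "\<dots> \<le> K\<^sup>2 * (2 * (K * q)\<^sup>2 + 2 * (d v)\<^sup>2)"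
      using 2 Y_nonneg by (intro mult_left_mono add_right_mono power_mono) auto
    also have "\<dots> = 2 * K ^ 4 * q\<^sup>2 + 2 * K\<^sup>2 * (d v)\<^sup>2"
      by (simp add: power_mult_distrib algebra_simps power_add[symmetric])
    finally have "(D j b g)\<^sup>2 \<le> 2 * K ^ 4 * q\<^sup>2 + 2 * K\<^sup>2 * (d v)\<^sup>2" .
    then have "m (u @ v) * (D j b g)\<^sup>2 \<le> m (u @ v) * (2 * K ^ 4 * q\<^sup>2 + 2 * K\<^sup>2 * (d v)\<^sup>2)"
      by (intro mult_left_mono) auto
    then show ?thesis by (simp add: algebra_simps)
  qed simp
  have "M * (D j b g)\<^sup>2 \<le> (\<Sum>v\<in>words J (n - j - ?l). 2 * K ^ 4 * q\<^sup>2 * m (u @ v) + 2 * K\<^sup>2 * (m (u @ v) * (d v)\<^sup>2))"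
    unfolding M_def sum_distrib_right by (intro sum_mono one)
  also have "\<dots> = 2 * K ^ 4 * q\<^sup>2 * M + 2 * K\<^sup>2 * Err u j g"
    unfolding M_def Err_def d_def by (simp add: sum.distrib sum_distrib_left)
  finally have *: "M * (D j b g)\<^sup>2 \<le> 2 * K ^ 4 * q\<^sup>2 * M + 2 * K\<^sup>2 * Err u j g" .
  have M: "M \<ge> \<gamma>" "M > 0" using \<gamma> unfolding M_def by auto
  have "(D j b g)\<^sup>2 \<le> 2 * K ^ 4 * q\<^sup>2 + 2 * K\<^sup>2 * Err u j g / M"
    using * M by (simp add: field_simps)
  also have "2 * K\<^sup>2 * Err u j g / M \<le> 2 * K\<^sup>2 * Err u j g / \<gamma>"
    using M \<gamma> Err_nonneg by (intro divide_left_mono mult_nonneg_nonneg) auto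
  finally show ?thesis unfolding q_def by simp
qed

text \<open>Summed over the group, the translation in \<open>Err\<close> disappears. The errors are
  then martingale increments, and their sum over all times is at most \<open>k\<close> times the
  initial second moment, whatever \<open>n\<close> is.\<close>

lemma Err_sum:
  assumes u: "set u \<subseteq> J" "length u \<le> k" and k: "k \<le> n" and \<Gamma>: "finite \<Gamma>" "\<Gamma> \<subseteq> carrier G"
  shows "(\<Sum>j<n - k. \<Sum>g\<in>\<Gamma>. Err u j g) \<le> real k"
proof -
  let ?l = "length u"
  \<comment> \<open>Large enough to contain every point of \<open>\<Gamma>\<close> translated by a
    word of length at most \<open>n\<close>.\<close>
  define \<Delta> where "\<Delta> = (\<Union>i\<in>{..n}. \<Union>w\<in>words J i. (\<lambda>g. g \<otimes> Pw w) ` \<Gamma>)"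
  have \<Delta>: "finite \<Delta>" "\<Delta> \<subseteq> carrier G"
    unfolding \<Delta>_def using \<Gamma> J words_carrier by (auto intro!: finite_words)
  have "(\<Sum>g\<in>\<Gamma>. Err u j g) \<le> (\<Sum>g\<in>\<Delta>. En j g - En (j + ?l) g)" if j: "j < n - k" for j
  proof -
    let ?N = "n - j - ?l"
    have uw: "u \<in> words J ?l" using u by (simp add: words_def)
    have "(\<Sum>g\<in>\<Gamma>. Err u j g) = (\<Sum>v\<in>words J ?N. m (u @ v) *
        (\<Sum>g\<in>\<Gamma>. (Y j (u @ v) (g \<otimes> Pw (u @ v)) - Y (j + ?l) v (g \<otimes> Pw (u @ v)))\<^sup>2))"
      unfolding Err_def by (simp add: sum.swap[of _ \<Gamma>] sum_distrib_left)
    also have "\<dots> \<le> (\<Sum>v\<in>words J ?N. m (u @ v) * (\<Sum>g\<in>\<Delta>. (Y j (u @ v) g - Y (j + ?l) v g)\<^sup>2))"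
    proof (intro sum_mono mult_left_mono)
      fix v assume v: "v \<in> words J ?N"
      then have uv: "u @ v \<in> words J (n - j)" using u j by (auto simp: words_def)
      show "(\<Sum>g\<in>\<Gamma>. (Y j (u @ v) (g \<otimes> Pw (u @ v)) - Y (j + ?l) v (g \<otimes> Pw (u @ v)))\<^sup>2)
        \<le> (\<Sum>g\<in>\<Delta>. (Y j (u @ v) g - Y (j + ?l) v g)\<^sup>2)"
      proof (rule sum_translate_le[of \<Gamma> "Pw (u @ v)" \<Delta> "\<lambda>g. (Y j (u @ v) g - Y (j + ?l) v g)\<^sup>2"])
        fix g assume "g \<in> \<Gamma>"
        then show "g \<otimes> Pw (u @ v) \<in> \<Delta>" unfolding \<Delta>_def using uv by (intro UN_I[of "n - j"]) auto
      qed (use \<Gamma> \<Delta> words_carrier[OF uv] in auto)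
    qed auto
    also have "\<dots> = (\<Sum>g\<in>\<Delta>. \<Sum>v\<in>words J ?N. m (u @ v) * (Y j (u @ v) g - Y (j + ?l) v g)\<^sup>2)"
      by (simp add: sum.swap[of _ \<Delta>] sum_distrib_left)
    \<comment> \<open>The fixed word \<open>u\<close> is one term of the sum over all words of its
      length, the form in which \<open>En_drop\<close> applies.\<close>
    also have "\<dots> \<le> (\<Sum>g\<in>\<Delta>. \<Sum>v\<in>words J ?N. \<Sum>u\<in>words J ?l. m (u @ v) * (Y j (u @ v) g - Y (j + ?l) v g)\<^sup>2)"
      using uw J by (intro sum_mono member_le_sum[of u]) (auto intro!: finite_words)
    also have "\<dots> \<le> (\<Sum>g\<in>\<Delta>. En j g - En (j + ?l) g)"
    proof (intro sum_mono)
      fix g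
      have "j + ?l \<le> n" using j u by simp
      then show "(\<Sum>v\<in>words J ?N. \<Sum>u\<in>words J ?l. m (u @ v) * (Y j (u @ v) g - Y (j + ?l) v g)\<^sup>2)
        \<le> En j g - En (j + ?l) g" using En_drop[of j ?l g] by linarith
    qed
    finally show ?thesis .
  qed
  then have "(\<Sum>j<n - k. \<Sum>g\<in>\<Gamma>. Err u j g) \<le> (\<Sum>j<n - k. \<Sum>g\<in>\<Delta>. En j g - En (j + ?l) g)"
    by (intro sum_mono) auto
  also have "\<dots> = (\<Sum>g\<in>\<Delta>. \<Sum>j<n - k. En j g - En (j + ?l) g)" by (rule sum.swap)
  also have "\<dots> \<le> (\<Sum>g\<in>\<Delta>. real ?l * En 0 g)"
  proof (intro sum_mono antitone_telescope_le[of n])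
    fix g i assume "i < n"
    then show "En (Suc i) g \<le> En i g" using En_mono[of i 1 g] by simp
  qed (use En_nonneg u k in auto)
  also have "\<dots> = real ?l * (\<Sum>g\<in>\<Delta>. En 0 g)" by (simp add: sum_distrib_left)
  also have "\<dots> \<le> real k * 1"
    using En_0_sum[OF \<Delta>] u by (intro mult_mono) (auto intro!: sum_nonneg En_nonneg)
  finally show ?thesis by simp
qed

text \<open>Transport compares the energy at \<open>g\<close>, summed over time, with the energy at
  \<open>g \<otimes> s\<close> for every \<open>s\<close> in \<open>E\<close>, up to summable
  errors. Expansion multiplies the total on the left by \<open>N\<close>, which exceeds the
  comparison constant, so the total is bounded independently of \<open>n\<close>. Since
  \<open>Q n\<close> is dominated by each \<open>Q j\<close>, its energy is of order
  \<open>1 / (n - k)\<close>.\<close>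

lemma energy_bound:
  assumes \<Lambda>: "finite \<Lambda>" "\<And>i. i \<in> I \<Longrightarrow> \<exists>b\<in>\<Lambda>. A i b" "\<Lambda> \<subseteq> I" "\<Lambda> \<noteq> {}"
    and E: "finite E" "E \<subseteq> carrier G"
    and ex: "\<And>F. finite F \<Longrightarrow> F \<subseteq> carrier G \<Longrightarrow> N * card F \<le> card (F <#> E)"
    and N: "real N \<ge> 2 * K ^ 4 * (real (card \<Lambda>))\<^sup>2 + 1"
    and u: "\<And>s b. s \<in> E \<Longrightarrow> b \<in> \<Lambda> \<Longrightarrow>
        set (u s b) \<subseteq> J \<and> u s b \<noteq> [] \<and> hd (u s b) = b \<and> Pw (u s b) = s \<and> length (u s b) \<le> k"
    and k: "k \<le> n" and \<gamma>: "\<gamma> > 0"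
    and \<gamma>_le: "\<And>s b j. s \<in> E \<Longrightarrow> b \<in> \<Lambda> \<Longrightarrow> j < n - k \<Longrightarrow>
        \<gamma> \<le> (\<Sum>v\<in>words J (n - j - length (u s b)). m (u s b @ v))"
    and \<Delta>: "finite \<Delta>" "\<Delta> \<subseteq> carrier G"
  shows "real (n - k) * (\<Sum>g\<in>\<Delta>. (Q n g)\<^sup>2) \<le> K\<^sup>2 * (2 * K ^ 4 * (real (card \<Lambda>))\<^sup>2 * real (k + 1)
      + real (card E) * ((real (card \<Lambda>))\<^sup>2 * (2 * K\<^sup>2 / \<gamma>) * real k))"
proof -
  obtain \<Gamma> where \<Gamma>: "finite \<Gamma>" "\<Gamma> \<subseteq> carrier G"
    and supp\<Gamma>: "\<And>j g. j \<le> n \<Longrightarrow> g \<in> carrier G \<Longrightarrow> Q j g \<noteq> 0 \<Longrightarrow> g \<in> \<Gamma>"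
    using Q_support by blast
  define L where "L = real (card \<Lambda>)"
  define K' where "K' = 2 * K ^ 4 * L\<^sup>2"
  \<comment> \<open>Transport moves time forward by at most \<open>k\<close>, so the first
    \<open>n - k\<close> times, collected in \<open>Pf\<close>, are compared with the times up to
    \<open>n\<close>, collected in \<open>R\<close>.\<close>
  define Pf where "Pf g = (\<Sum>j<n - k. (Q j g)\<^sup>2)" for g
  define R where "R g = (\<Sum>j\<le>n. (Q j g)\<^sup>2)" for g
  define ET where "ET s g = L * (2 * K\<^sup>2 / \<gamma>) * (\<Sum>b\<in>\<Lambda>. \<Sum>j<n - k. Err (u s b) j g)" for s g
  have L0: "L \<ge> 0" unfolding L_def by simp
  have K'0: "K' \<ge> 0" unfolding K'_def using K1 by simp
  have R0: "R g \<ge> 0" for g unfolding R_def by (intro sum_nonneg) auto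
  have Pf0: "Pf g \<ge> 0" for g unfolding Pf_def by (intro sum_nonneg) auto
  have ET0: "ET s g \<ge> 0" for s g
    unfolding ET_def using \<gamma> L0 by (intro mult_nonneg_nonneg sum_nonneg Err_nonneg) auto
  have c1: "Pf g \<le> K' * R (g \<otimes> s) + ET s g" if g: "g \<in> carrier G" and s: "s \<in> E" for g s
  proof -
    have one: "(Q j g)\<^sup>2 \<le> L * (\<Sum>b\<in>\<Lambda>. 2 * K ^ 4 * (Q (j + length (u s b)) (g \<otimes> s))\<^sup>2 + 2 * K\<^sup>2 / \<gamma> * Err (u s b) j g)"
      if j: "j < n - k" for j
    proof -
      have "(Q j g)\<^sup>2 \<le> (\<Sum>b\<in>\<Lambda>. D j b g)\<^sup>2"
        using Q_le_D[OF \<Lambda>] Q_nonneg by (intro power_mono) auto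
      also have "\<dots> \<le> (\<Sum>b\<in>\<Lambda>. (D j b g)\<^sup>2) * L"
        unfolding L_def by (rule sum_squared_le_sum_of_squares)
      also have "\<dots> \<le> (\<Sum>b\<in>\<Lambda>. 2 * K ^ 4 * (Q (j + length (u s b)) (g \<otimes> s))\<^sup>2 + 2 * K\<^sup>2 / \<gamma> * Err (u s b) j g) * L"
      proof (intro mult_right_mono sum_mono L0)
        fix b assume b: "b \<in> \<Lambda>"
        show "(D j b g)\<^sup>2 \<le> 2 * K ^ 4 * (Q (j + length (u s b)) (g \<otimes> s))\<^sup>2 + 2 * K\<^sup>2 / \<gamma> * Err (u s b) j g"
          using D_square_le[of "u s b" b g \<gamma> j] u[OF s b] g \<gamma> \<gamma>_le[OF s b j] by auto
      qed
      finally show ?thesis by (simp add: mult.commute)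
    qed
    have shiftR: "(\<Sum>j<n - k. (Q (j + l) h)\<^sup>2) \<le> R h" if "l \<le> k" for l h
    proof -
      have "(\<Sum>j<n - k. (Q (j + l) h)\<^sup>2) = (\<Sum>i\<in>(\<lambda>j. j + l) ` {..<n - k}. (Q i h)\<^sup>2)"
        by (simp add: sum.reindex)
      also have "\<dots> \<le> R h" unfolding R_def using that k by (intro sum_mono2) auto
      finally show ?thesis .
    qed
    have "Pf g \<le> (\<Sum>j<n - k. L * (\<Sum>b\<in>\<Lambda>. 2 * K ^ 4 * (Q (j + length (u s b)) (g \<otimes> s))\<^sup>2 + 2 * K\<^sup>2 / \<gamma> * Err (u s b) j g))"
      unfolding Pf_def using one by (intro sum_mono) auto
    also have "\<dots> = L * (\<Sum>b\<in>\<Lambda>. \<Sum>j<n - k. 2 * K ^ 4 * (Q (j + length (u s b)) (g \<otimes> s))\<^sup>2 + 2 * K\<^sup>2 / \<gamma> * Err (u s b) j g)"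
      by (simp only: sum_distrib_left[symmetric]) (subst sum.swap, rule refl)
    also have "\<dots> = L * (\<Sum>b\<in>\<Lambda>. 2 * K ^ 4 * (\<Sum>j<n - k. (Q (j + length (u s b)) (g \<otimes> s))\<^sup>2)
        + 2 * K\<^sup>2 / \<gamma> * (\<Sum>j<n - k. Err (u s b) j g))"
      by (simp only: sum.distrib sum_distrib_left)
    also have "\<dots> \<le> L * (\<Sum>b\<in>\<Lambda>. 2 * K ^ 4 * R (g \<otimes> s) + 2 * K\<^sup>2 / \<gamma> * (\<Sum>j<n - k. Err (u s b) j g))"
      using shiftR u s L0 by (intro mult_left_mono sum_mono add_right_mono) auto
    also have "\<dots> = K' * R (g \<otimes> s) + ET s g"
      unfolding K'_def ET_def sum.distrib sum_distrib_left[symmetric] sum_constant L_def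
      by (simp add: power2_eq_square algebra_simps)
    finally show ?thesis .
  qed
  \<comment> \<open>The layer cake inequality wants a function of the arrival point alone, so the
    error made at \<open>g\<close> is moved to \<open>g \<otimes> s\<close>.\<close>
  define w where "w s h = (if h \<otimes> inv s \<in> \<Gamma> then ET s (h \<otimes> inv s) else 0)" for s h
  have w0: "w s h \<ge> 0" for s h unfolding w_def using ET0 by simp
  have cake: "real N * sum Pf \<Gamma> \<le> (\<Sum>h\<in>\<Gamma> <#> E. K' * R h + (\<Sum>s\<in>E. w s h))"
  proof (rule expanding_layer_cake[OF E ex \<Gamma> Pf0])
    fix g s assume g: "g \<in> \<Gamma>" and s: "s \<in> E"
    then have gs: "g \<in> carrier G" "s \<in> carrier G" using \<Gamma> E by auto
    then have "w s (g \<otimes> s) = ET s g" unfolding w_def using g by (simp add: m_assoc)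
    moreover have "w s (g \<otimes> s) \<le> (\<Sum>s'\<in>E. w s' (g \<otimes> s))" using s E w0 by (intro member_le_sum) auto
    ultimately show "Pf g \<le> K' * R (g \<otimes> s) + (\<Sum>s'\<in>E. w s' (g \<otimes> s))" using c1[OF gs(1) s] by linarith
  qed
  have fE: "finite (\<Gamma> <#> E)" "\<Gamma> <#> E \<subseteq> carrier G"
    using finite_set_mult[OF \<Gamma>(1) E(1)] set_mult_closed[OF \<Gamma>(2) E(2)] by auto
  have Rz: "R h = 0" if "h \<in> carrier G" "h \<notin> \<Gamma>" for h
    unfolding R_def by (intro sum.neutral) (use supp\<Gamma> that in auto)
  have c3: "(\<Sum>h\<in>\<Gamma> <#> E. R h) \<le> sum R \<Gamma>"
  proof -
    have "(\<Sum>h\<in>\<Gamma> <#> E. R h) = sum R ((\<Gamma> <#> E) \<inter> \<Gamma>)"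
      using fE Rz by (intro sum.mono_neutral_right) auto
    also have "\<dots> \<le> sum R \<Gamma>" using \<Gamma> R0 by (intro sum_mono2) auto
    finally show ?thesis .
  qed
  have c5: "sum (ET s) \<Gamma> \<le> L\<^sup>2 * (2 * K\<^sup>2 / \<gamma>) * real k" if s: "s \<in> E" for s
  proof -
    have "sum (ET s) \<Gamma> = L * (2 * K\<^sup>2 / \<gamma>) * (\<Sum>g\<in>\<Gamma>. \<Sum>b\<in>\<Lambda>. \<Sum>j<n - k. Err (u s b) j g)"
      unfolding ET_def by (simp only: sum_distrib_left)
    also have "\<dots> = L * (2 * K\<^sup>2 / \<gamma>) * (\<Sum>b\<in>\<Lambda>. \<Sum>j<n - k. \<Sum>g\<in>\<Gamma>. Err (u s b) j g)"
      by (simp only: sum.swap[of _ \<Gamma>])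
    also have "\<dots> \<le> L * (2 * K\<^sup>2 / \<gamma>) * (\<Sum>b\<in>\<Lambda>. real k)"
      using u[OF s] L0 \<gamma> k \<Gamma> by (intro mult_left_mono sum_mono Err_sum) auto
    finally show ?thesis by (simp add: L_def power2_eq_square algebra_simps)
  qed
  have c4: "(\<Sum>h\<in>\<Gamma> <#> E. w s h) \<le> L\<^sup>2 * (2 * K\<^sup>2 / \<gamma>) * real k" if s: "s \<in> E" for s
  proof -
    have "(\<Sum>h\<in>\<Gamma> <#> E. w s h) \<le> sum (\<lambda>g. if g \<in> \<Gamma> then ET s g else 0) \<Gamma>"
      unfolding w_def
      by (rule sum_translate_le[of "\<Gamma> <#> E" "inv s" \<Gamma> "\<lambda>g. if g \<in> \<Gamma> then ET s g else 0"])
         (use fE \<Gamma> s E ET0 in \<open>auto split: if_splits\<close>)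
    also have "\<dots> = sum (ET s) \<Gamma>" by simp
    finally show ?thesis using c5[OF s] by linarith
  qed
  \<comment> \<open>The \<open>k + 1\<close> times missing from \<open>Pf\<close> have energy at
    most 1 each.\<close>
  have c6: "sum R \<Gamma> \<le> sum Pf \<Gamma> + real (k + 1)"
  proof -
    have "{..n} = {..<n - k} \<union> {n - k..n}" by auto
    then have "R g = Pf g + (\<Sum>j\<in>{n - k..n}. (Q j g)\<^sup>2)" for g
      unfolding R_def Pf_def by (simp only:) (intro sum.union_disjoint, auto)
    then have "sum R \<Gamma> = sum Pf \<Gamma> + (\<Sum>j\<in>{n - k..n}. \<Sum>g\<in>\<Gamma>. (Q j g)\<^sup>2)"
      by (simp add: sum.distrib sum.swap[of _ \<Gamma>])
    also have "\<dots> \<le> sum Pf \<Gamma> + (\<Sum>j\<in>{n - k..n}. 1)"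
      using Q_sum[OF \<Gamma>] by (intro add_left_mono sum_mono)
    finally show ?thesis using k by simp
  qed
  define Z where "Z = K' * real (k + 1) + real (card E) * (L\<^sup>2 * (2 * K\<^sup>2 / \<gamma>) * real k)"
  have "real N * sum Pf \<Gamma> \<le> K' * (\<Sum>h\<in>\<Gamma> <#> E. R h) + (\<Sum>s\<in>E. \<Sum>h\<in>\<Gamma> <#> E. w s h)"
    using cake by (simp add: sum.distrib sum_distrib_left sum.swap[of _ E])
  also have "\<dots> \<le> K' * (sum Pf \<Gamma> + real (k + 1)) + (\<Sum>s\<in>E. L\<^sup>2 * (2 * K\<^sup>2 / \<gamma>) * real k)"
    using c3 c6 K'0 c4 by (intro add_mono mult_left_mono sum_mono) linarith+
  also have "\<dots> = K' * sum Pf \<Gamma> + Z" unfolding Z_def by (simp add: algebra_simps)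
  finally have "real N * sum Pf \<Gamma> \<le> K' * sum Pf \<Gamma> + Z" .
  \<comment> \<open>As \<open>N\<close> is at least \<open>K' + 1\<close>, the term
    \<open>K' * sum Pf \<Gamma>\<close> is absorbed on the left.\<close>
  moreover have "(K' + 1) * sum Pf \<Gamma> \<le> real N * sum Pf \<Gamma>"
    using N Pf0 unfolding K'_def L_def by (intro mult_right_mono sum_nonneg) auto
  ultimately have fin: "sum Pf \<Gamma> \<le> Z" by (simp add: algebra_simps)
  have "real (n - k) * (\<Sum>g\<in>\<Delta>. (Q n g)\<^sup>2) = (\<Sum>j<n - k. \<Sum>g\<in>\<Delta>. (Q n g)\<^sup>2)" by simp
  also have "\<dots> \<le> (\<Sum>j<n - k. K\<^sup>2 * (\<Sum>g\<in>\<Gamma>. (Q j g)\<^sup>2))"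
  proof (intro sum_mono)
    fix j assume "j \<in> {..<n - k}"
    then have j: "j \<le> n" by simp
    show "(\<Sum>g\<in>\<Delta>. (Q n g)\<^sup>2) \<le> K\<^sup>2 * (\<Sum>g\<in>\<Gamma>. (Q j g)\<^sup>2)"
      by (rule Q_last_le[OF j \<Delta> \<Gamma> supp\<Gamma>[OF j]])
  qed
  also have "\<dots> = K\<^sup>2 * sum Pf \<Gamma>"
    unfolding Pf_def by (simp add: sum_distrib_left sum.swap[of _ \<Gamma>])
  also have "\<dots> \<le> K\<^sup>2 * Z" using fin by (intro mult_left_mono) auto
  finally show ?thesis unfolding Z_def K'_def L_def .
qed

end

section \<open>Connecting words, truncation of the alphabet and the decay statement\<close>

text \<open>A path of the extended shift from \<open>(b, \<one>)\<close> to \<open>(b, s)\<close>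
  spells the word. The group component of a state is the product of the letters before it, so the
  letter of the final state is left out.\<close>

lemma connecting_word:
  assumes "b \<in> I" "s \<in> carrier G"
  obtains u where "u \<noteq> []" "hd u = b" "adm u" "Pw u = s"
proof -
  have path: "\<exists>u. u \<noteq> [] \<and> hd u = fst x \<and> adm (u @ [fst y]) \<and> snd y = snd x \<otimes> Pw u"
    if "(x, y) \<in> (ext_transition I A G \<Psi>)\<^sup>+" for x y
    using that
  proof (induction rule: trancl_induct)
    case (base y)
    then show ?case using Psi
      by (intro exI[of _ "[fst x]"]) (auto simp: ext_transition_def admissible_Cons)
  next
    case (step y z)
    then obtain u where u: "u \<noteq> []" "hd u = fst x" "adm (u @ [fst y])" "snd y = snd x \<otimes> Pw u"
      by blast
    have yz: "fst y \<in> I" "fst z \<in> I" "A (fst y) (fst z)" "snd z = snd y \<otimes> \<Psi> (fst y)"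
      using step(2) by (auto simp: ext_transition_def)
    have "snd x \<in> carrier G" using tranclD[OF step(1)] by (auto simp: ext_transition_def)
    moreover have "set u \<subseteq> I" using u(3) by (auto simp: admissible_def)
    ultimately have "snd z = snd x \<otimes> Pw (u @ [fst y])"
      using yz u(4) Psi by (simp add: Pw_append m_assoc)
    moreover have "adm ((u @ [fst y]) @ [fst z])"
      using u(3) yz by (subst admissible_append) (auto simp: admissible_Cons)
    ultimately show ?case using u by (intro exI[of _ "u @ [fst y]"]) auto
  qed
  have "((b, \<one>), (b, s)) \<in> (ext_transition I A G \<Psi>)\<^sup>+"
    using irred assms unfolding ext_irreducible_def by auto
  from path[OF this] obtain u where u: "u \<noteq> []" "hd u = b" "adm (u @ [b])" "s = \<one> \<otimes> Pw u"
    by auto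
  then have "set u \<subseteq> I" by (auto simp: admissible_def)
  moreover have "adm u" using u(3) by (simp add: admissible_append)
  ultimately show ?thesis using that u by simp
qed

text \<open>Continuity from below along growing alphabets. The bound is stated for all larger
  \<open>M'\<close> because the alphabet is enlarged afterwards to contain prescribed
  letters.\<close>

lemma finite_alphabet_mass:
  assumes "\<gamma> > 0"
  obtains M where "\<And>M'. M' \<ge> M \<Longrightarrow> {x \<in> X. \<forall>i<n. x i < M'} \<in> sets \<mu> \<and>
     prob {x \<in> X. \<forall>i<n. x i < M'} \<ge> 1 - \<gamma>"
proof -
  define S where "S M = {x \<in> X. \<forall>i<n. x i < M}" for M
  have S_eq: "S M = (\<Union>w\<in>words {..<M} n. cyl w)" for M
  proof -
    have "x \<in> (\<Union>w\<in>words {..<M} n. cyl w)" if "x \<in> S M" for x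
    proof
      show "map x [0..<n] \<in> words {..<M} n" using that by (auto simp: words_def S_def)
      show "x \<in> cyl (map x [0..<n])" using that by (auto simp: cylinder_def S_def)
    qed
    moreover have "x \<in> S M" if w: "w \<in> words {..<M} n" and x: "x \<in> cyl w" for x w
    proof -
      have "x i < M" if "i < n" for i
      proof -
        have "w ! i \<in> {..<M}" using w that nth_mem[of i w] unfolding words_def by blast
        then show ?thesis using w x that by (auto simp: words_def cylinder_def)
      qed
      then show ?thesis using x cylinder_subset unfolding S_def by blast
    qed
    ultimately show ?thesis by blast
  qed
  have S_sets: "S M \<in> sets \<mu>" for M
    unfolding S_eq by (intro sets.finite_UN finite_words) auto
  have "incseq S" unfolding incseq_def S_def by (auto intro: less_le_trans)
  then have "(\<lambda>M. prob (S M)) \<longlonglongrightarrow> prob (\<Union>M. S M)"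
    using S_sets by (intro finite_Lim_measure_incseq) auto
  moreover have "(\<Union>M. S M) = X"
  proof -
    have "x \<in> S (Suc (Max (insert 0 (x ` {..<n}))))" if "x \<in> X" for x
      unfolding S_def using that by (auto simp: less_Suc_eq_le)
    then show ?thesis unfolding S_def by blast
  qed
  ultimately have "(\<lambda>M. prob (S M)) \<longlonglongrightarrow> 1" using prob_space space by simp
  then have "\<forall>\<^sub>F M in sequentially. 1 - \<gamma> < prob (S M)"
    using assms by (intro order_tendstoD(1)) auto
  then obtain M where "\<And>M'. M' \<ge> M \<Longrightarrow> 1 - \<gamma> < prob (S M')"
    unfolding eventually_sequentially by blast
  then show ?thesis using that[of M] S_sets unfolding S_def by (meson less_imp_le)
qed

text \<open>Points of \<open>cyl u\<close> that avoid large letters lie in one of the counted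
  cylinders, and the others have mass at most \<open>\<gamma>\<close>.\<close>

lemma extension_mass:
  assumes S: "{x \<in> X. \<forall>i<n. x i < M} \<in> sets \<mu>" "prob {x \<in> X. \<forall>i<n. x i < M} \<ge> 1 - \<gamma>"
    and u: "length u + l \<le> n"
  shows "m u - \<gamma> \<le> (\<Sum>v\<in>words {i \<in> I. i < M} l. m (u @ v))"
proof -
  let ?S = "{x \<in> X. \<forall>i<n. x i < M}" and ?J = "{i \<in> I. i < M}"
  have fin: "finite (words ?J l)" by (intro finite_words) simp
  have "cyl u \<inter> ?S \<subseteq> (\<Union>v\<in>words ?J l. cyl (u @ v))"
  proof
    fix x assume x: "x \<in> cyl u \<inter> ?S"
    define v where "v = map (\<lambda>i. x (i + length u)) [0..<l]"
    have "v \<in> words ?J l" unfolding v_def words_def using x u by (auto simp: shift_space_def)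
    moreover have "x \<in> cyl (u @ v)"
      unfolding mem_cylinder_append
    proof
      show "x \<in> cyl u" using x by simp
      show "(\<lambda>j. x (j + length u)) \<in> cyl v"
        unfolding v_def using x by (simp add: cylinder_def shift_space_def)
    qed
    ultimately show "x \<in> (\<Union>v\<in>words ?J l. cyl (u @ v))" by blast
  qed
  then have "prob (cyl u \<inter> ?S) \<le> prob (\<Union>v\<in>words ?J l. cyl (u @ v))"
    using fin by (intro finite_measure_mono sets.finite_UN) auto
  also have "\<dots> \<le> (\<Sum>v\<in>words ?J l. m (u @ v))"
    unfolding m_def using fin by (intro finite_measure_subadditive_finite) auto
  finally have 1: "prob (cyl u \<inter> ?S) \<le> (\<Sum>v\<in>words ?J l. m (u @ v))" .
  have meas: "cyl u \<inter> ?S \<in> sets \<mu>" "space \<mu> - ?S \<in> sets \<mu>"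
    by (rule sets.Int[OF cylinder_sets S(1)], rule sets.compl_sets[OF S(1)])
  have "cyl u \<subseteq> cyl u \<inter> ?S \<union> (space \<mu> - ?S)"
    using cylinder_subset unfolding space by blast
  then have "m u \<le> prob (cyl u \<inter> ?S \<union> (space \<mu> - ?S))"
    unfolding m_def by (rule finite_measure_mono[OF _ sets.Un[OF meas]])
  also have "\<dots> \<le> prob (cyl u \<inter> ?S) + prob (space \<mu> - ?S)"
    by (rule measure_Un_le[OF meas])
  also have "prob (space \<mu> - ?S) = 1 - prob ?S" using S by (intro prob_compl)
  finally show ?thesis using 1 S by linarith
qed

lemma finite_successors: "\<exists>\<Lambda>. finite \<Lambda> \<and> \<Lambda> \<subseteq> I \<and> (\<forall>i\<in>I. \<exists>b\<in>\<Lambda>. A i b)"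
proof -
  obtain \<Lambda> where \<Lambda>: "finite \<Lambda>" "\<Lambda> \<subseteq> I"
    and adm: "\<forall>i\<in>I. \<exists>a\<in>\<Lambda>. \<exists>b\<in>\<Lambda>. adm [a, i, b]"
    using bip unfolding bip_def by blast
  have "\<exists>b\<in>\<Lambda>. A i b" if "i \<in> I" for i
    using bspec[OF adm that] by (auto simp: admissible_Cons)
  then show ?thesis using \<Lambda> by blast
qed

text \<open>The order of choices gives uniformity: \<open>N\<close> depends on \<open>K\<close> and
  \<open>\<Lambda>\<close>, \<open>E\<close> on \<open>N\<close>, the connecting words and
  \<open>\<gamma>\<close> on \<open>E\<close>, and \<open>n\<close> on all of these and
  \<open>c\<close>. The alphabet \<open>J\<close> is chosen last, from \<open>W\<close>; this is
  possible because the energy bound does not involve \<open>J\<close>.\<close>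

lemma not_folner_decay:
  assumes nf: "\<not> folner G" and c: "c > 0"
  obtains n where "n \<ge> 1"
    "\<And>F W \<Delta>. (\<And>g. F g \<ge> 0) \<Longrightarrow> (\<And>B. finite B \<Longrightarrow> B \<subseteq> carrier G \<Longrightarrow> (\<Sum>g\<in>B. (F g)\<^sup>2) \<le> 1) \<Longrightarrow>
      finite W \<Longrightarrow> W \<subseteq> words I n \<Longrightarrow> finite \<Delta> \<Longrightarrow> \<Delta> \<subseteq> carrier G \<Longrightarrow>
      (\<Sum>g\<in>\<Delta>. (\<Sum>w\<in>W. m w * F (g \<otimes> inv (Pw w)))\<^sup>2) \<le> c"
proof -
  obtain \<Lambda> where \<Lambda>: "finite \<Lambda>" "\<Lambda> \<subseteq> I" "\<And>i. i \<in> I \<Longrightarrow> \<exists>b\<in>\<Lambda>. A i b"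
    using finite_successors by metis
  have \<Lambda>ne: "\<Lambda> \<noteq> {}" using nonempty \<Lambda>(3) by blast
  define K' where "K' = 2 * K ^ 4 * (real (card \<Lambda>))\<^sup>2"
  obtain N :: nat where N: "real N \<ge> K' + 1" using real_arch_simple by blast
  obtain E where E: "finite E" "E \<subseteq> carrier G"
    and ex: "\<And>F. finite F \<Longrightarrow> F \<subseteq> carrier G \<Longrightarrow> N * card F \<le> card (F <#> E)"
    using not_folner_expanding[OF nf, of N] by blast
  have "\<exists>u. u \<noteq> [] \<and> hd u = b \<and> adm u \<and> Pw u = s" if "s \<in> E" "b \<in> \<Lambda>" for s b
    using connecting_word[of b s] that E \<Lambda> by blast
  then obtain u where u: "\<And>s b. s \<in> E \<Longrightarrow> b \<in> \<Lambda> \<Longrightarrow>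
      u s b \<noteq> [] \<and> hd (u s b) = b \<and> adm (u s b) \<and> Pw (u s b) = s" by metis
  define k where "k = Max (insert 0 ((\<lambda>(s, b). length (u s b)) ` (E \<times> \<Lambda>)))"
  have k: "length (u s b) \<le> k" if "s \<in> E" "b \<in> \<Lambda>" for s b
    unfolding k_def using that E \<Lambda> by (intro Max_ge) auto
  \<comment> \<open>At most half the mass of every connecting word: truncation of the alphabet loses
    at most \<open>\<gamma>\<close> and so leaves at least \<open>\<gamma>\<close>.\<close>
  define \<gamma> where "\<gamma> = Min (insert 1 ((\<lambda>(s, b). m (u s b) / 2) ` (E \<times> \<Lambda>)))"
  have \<gamma>: "\<gamma> > 0" unfolding \<gamma>_def using E \<Lambda> u by (subst Min_gr_iff) (auto intro!: m_pos)
  have \<gamma>_le: "2 * \<gamma> \<le> m (u s b)" if "s \<in> E" "b \<in> \<Lambda>" for s b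
  proof -
    have "\<gamma> \<le> m (u s b) / 2" unfolding \<gamma>_def using that E \<Lambda> by (intro Min_le) auto
    then show ?thesis by simp
  qed
  define Z where "Z = K\<^sup>2 * (K' * real (k + 1) + real (card E) * ((real (card \<Lambda>))\<^sup>2 * (2 * K\<^sup>2 / \<gamma>) * real k))"
  obtain r :: nat where r: "Z / c < real r" using reals_Archimedean2 by blast
  define n where "n = k + Suc r"
  have nZ: "Z < real (n - k) * c"
  proof -
    have "Z < real r * c" using r c by (simp add: field_simps)
    also have "\<dots> \<le> real (n - k) * c" unfolding n_def using c by simp
    finally show ?thesis .
  qed
  obtain M0 where M0: "\<And>M. M \<ge> M0 \<Longrightarrow> {x \<in> X. \<forall>i<n. x i < M} \<in> sets \<mu> \<and>
     prob {x \<in> X. \<forall>i<n. x i < M} \<ge> 1 - \<gamma>"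
    using finite_alphabet_mass[OF \<gamma>] by blast
  show ?thesis
  proof (rule that)
    show "n \<ge> 1" unfolding n_def by simp
    fix F :: "'g \<Rightarrow> real" and W \<Delta>
    assume F0: "\<And>g. F g \<ge> 0" and F1: "\<And>B. finite B \<Longrightarrow> B \<subseteq> carrier G \<Longrightarrow> (\<Sum>g\<in>B. (F g)\<^sup>2) \<le> 1"
      and W: "finite W" "W \<subseteq> words I n" and \<Delta>: "finite \<Delta>" "\<Delta> \<subseteq> carrier G"
    \<comment> \<open>The letters that the finite alphabet must contain: those of the given words
      and of the connecting words.\<close>
    define LS where "LS = \<Union>(set ` W) \<union> (\<Union>s\<in>E. \<Union>b\<in>\<Lambda>. set (u s b))"
    have LS: "finite LS" unfolding LS_def using W E \<Lambda> by auto
    define M where "M = Max (insert M0 (Suc ` LS))"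
    have M: "M \<ge> M0" unfolding M_def using LS by auto
    have LSM: "i < M" if "i \<in> LS" for i
    proof -
      have "Suc i \<le> M" unfolding M_def using LS that by (intro Max_ge) auto
      then show ?thesis by simp
    qed
    define J where "J = {i \<in> I. i < M}"
    have J: "finite J" "J \<subseteq> I" unfolding J_def by auto
    have WJ: "W \<subseteq> words J n"
      using W(2) LSM unfolding J_def LS_def words_def by (auto simp: subset_iff)
    have uJ: "set (u s b) \<subseteq> J" if "s \<in> E" "b \<in> \<Lambda>" for s b
    proof -
      have "set (u s b) \<subseteq> I" using u[OF that] by (auto simp: admissible_def)
      moreover have "set (u s b) \<subseteq> LS" unfolding LS_def using that by blast
      ultimately show ?thesis unfolding J_def using LSM by blast
    qed
    \<comment> \<open>The points at which the sums evaluate \<open>F\<close>. Cutting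
      \<open>F\<close> down to them gives finite support without changing these sums.\<close>
    define B where "B = (\<Union>w\<in>W. (\<lambda>g. g \<otimes> inv (Pw w)) ` \<Delta>)"
    have Pc: "Pw w \<in> carrier G" if "w \<in> W" for w using that W(2) by (auto simp: words_def)
    have B: "finite B" "B \<subseteq> carrier G" unfolding B_def using W \<Delta> Pc by auto
    define F' where "F' g = (if g \<in> B then F g else 0)" for g
    have F'0: "F' g \<ge> 0" for g unfolding F'_def using F0 by simp
    have F'B: "g \<in> B" if "g \<in> carrier G" "F' g \<noteq> 0" for g using that unfolding F'_def by meson
    have F'1: "(\<Sum>g\<in>B. (F' g)\<^sup>2) \<le> 1" using F1[OF B] unfolding F'_def by simp
    have bound: "real (n - k) * (\<Sum>g\<in>\<Delta>. (Q J F' n g)\<^sup>2) \<le> Z"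
      unfolding Z_def K'_def
    proof (rule energy_bound[OF J F'0 B F'B F'1 \<Lambda>(1) \<Lambda>(3) \<Lambda>(2) \<Lambda>ne E ex])
      show "2 * K ^ 4 * (real (card \<Lambda>))\<^sup>2 + 1 \<le> real N" using N unfolding K'_def .
      show "set (u s b) \<subseteq> J \<and> u s b \<noteq> [] \<and> hd (u s b) = b \<and> Pw (u s b) = s \<and> length (u s b) \<le> k"
        if "s \<in> E" "b \<in> \<Lambda>" for s b using u[OF that] uJ[OF that] k[OF that] by simp
      show "k \<le> n" unfolding n_def by simp
      show "\<gamma> \<le> (\<Sum>v\<in>words J (n - j - length (u s b)). m (u s b @ v))"
        if "s \<in> E" "b \<in> \<Lambda>" "j < n - k" for s b j
      proof -
        have l: "length (u s b) + (n - j - length (u s b)) \<le> n"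
          using k[OF that(1,2)] that(3) by simp
        have "m (u s b) - \<gamma> \<le> (\<Sum>v\<in>words J (n - j - length (u s b)). m (u s b @ v))"
          unfolding J_def
          by (rule extension_mass[OF conjunct1[OF M0[OF M]] conjunct2[OF M0[OF M]] l])
        then show ?thesis using \<gamma>_le[OF that(1,2)] by linarith
      qed
    qed (use \<gamma> \<Delta> in auto)
    have "(\<Sum>w\<in>W. m w * F (g \<otimes> inv (Pw w)))\<^sup>2 \<le> (Q J F' n g)\<^sup>2" if g: "g \<in> \<Delta>" for g
    proof -
      have "(\<Sum>w\<in>W. m w * F (g \<otimes> inv (Pw w))) = (\<Sum>w\<in>W. m w * F' (g \<otimes> inv (Pw w)))"
        by (intro sum.cong refl) (use g in \<open>auto simp: F'_def B_def\<close>)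
      also have "\<dots> \<le> (\<Sum>w\<in>words J n. m w * F' (g \<otimes> inv (Pw w)))"
        using WJ J F'0 by (intro sum_mono2 finite_words) auto
      also have "\<dots> = Q J F' n g" using Q_def[OF J F'0 B F'B F'1] by simp
      finally show ?thesis using F0 by (intro power_mono sum_nonneg mult_nonneg_nonneg) auto
    qed
    then have "(\<Sum>g\<in>\<Delta>. (\<Sum>w\<in>W. m w * F (g \<otimes> inv (Pw w)))\<^sup>2) \<le> (\<Sum>g\<in>\<Delta>. (Q J F' n g)\<^sup>2)"
      by (intro sum_mono)
    moreover have "(\<Sum>g\<in>\<Delta>. (Q J F' n g)\<^sup>2) \<le> c"
    proof -
      have "real (n - k) * (\<Sum>g\<in>\<Delta>. (Q J F' n g)\<^sup>2) \<le> real (n - k) * c" using bound nZ by linarith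
      then show ?thesis unfolding n_def by simp
    qed
    ultimately show "(\<Sum>g\<in>\<Delta>. (\<Sum>w\<in>W. m w * F (g \<otimes> inv (Pw w)))\<^sup>2) \<le> c" by linarith
  qed
qed

end

section \<open>Null sets and inverse branches\<close>

context gibbs_extension
begin

text \<open>By Hoelder continuity a superlevel set is a union of cylinders, and there are only
  countably many words.\<close>

lemma phi_measurable [measurable]: "\<phi> \<in> borel_measurable \<mu>"
proof (rule borel_measurableI_greater)
  fix y :: real
  obtain \<beta> c where \<beta>: "\<beta> > 0" and hol: "\<And>\<omega> \<tau> n. \<omega> \<in> X \<Longrightarrow> \<tau> \<in> X \<Longrightarrow> n \<ge> 1 \<Longrightarrow> (\<forall>k<n. \<omega> k = \<tau> k) \<Longrightarrow>
      \<bar>\<phi> \<omega> - \<phi> \<tau>\<bar> \<le> c * exp (- \<beta> * real n)"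
    using hoelder unfolding hoelder_def by metis
  let ?W = "{w. cyl w \<subseteq> {x \<in> X. y < \<phi> x}}"
  have "{x \<in> X. y < \<phi> x} = (\<Union>w\<in>?W. cyl w)"
  proof
    show "{x \<in> X. y < \<phi> x} \<subseteq> (\<Union>w\<in>?W. cyl w)"
    proof
      fix x assume x: "x \<in> {x \<in> X. y < \<phi> x}"
      have "(\<lambda>n. c * exp (- \<beta> * real n)) \<longlonglongrightarrow> 0"
      proof -
        have "(\<lambda>n. c * exp (- \<beta>) ^ n) \<longlonglongrightarrow> c * 0"
          using \<beta> by (intro tendsto_mult tendsto_const LIMSEQ_power_zero) simp
        then show ?thesis by (simp only: exp_of_nat2_mult mult_zero_right)
      qed
      then have "\<forall>\<^sub>F n in sequentially. c * exp (- \<beta> * real n) < \<phi> x - y"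
        using x by (intro order_tendstoD(2)) auto
      \<comment> \<open>\<open>hoelder\<close> only compares points that share at least one
        letter.\<close>
      then have "\<forall>\<^sub>F n in sequentially. c * exp (- \<beta> * real n) < \<phi> x - y \<and> n \<ge> 1"
        using eventually_ge_at_top[of 1] by (rule eventually_conj)
      then obtain n where n: "c * exp (- \<beta> * real n) < \<phi> x - y" "n \<ge> 1"
        using eventually_happens'[OF sequentially_bot] by blast
      let ?w = "map x [0..<n]"
      have xw: "x \<in> cyl ?w" using x by (auto simp: cylinder_def)
      moreover have "cyl ?w \<subseteq> {x \<in> X. y < \<phi> x}"
      proof
        fix z assume z: "z \<in> cyl ?w"
        then have "z \<in> X" "\<forall>k<n. x k = z k" by (auto simp: cylinder_def)
        then have "\<bar>\<phi> x - \<phi> z\<bar> \<le> c * exp (- \<beta> * real n)" using x n by (intro hol) auto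
        then show "z \<in> {x \<in> X. y < \<phi> x}" using n \<open>z \<in> X\<close> by auto
      qed
      ultimately show "x \<in> (\<Union>w\<in>?W. cyl w)" by blast
    qed
  qed auto
  moreover have "(\<Union>w\<in>?W. cyl w) \<in> sets \<mu>"
    by (intro sets.countable_UN' countableI_type) auto
  ultimately show "{x \<in> space \<mu>. y < \<phi> x} \<in> sets \<mu>" by (simp add: space)
qed

lemma branch_domain_sets: "{x \<in> X. case_nat i x \<in> X} \<in> sets \<mu>"
proof -
  have "{x \<in> X. case_nat i x \<in> X} = (\<Union>j\<in>{j. i \<in> I \<and> A i j}. cyl [j])"
    by (auto simp: mem_cylinder_Cons case_nat_in_shift_space left_shift_in_shift_space)
  also have "\<dots> \<in> sets \<mu>" by (intro sets.countable_UN' countableI_type) auto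
  finally show ?thesis .
qed

lemma branch_sets:
  assumes "B \<in> sets \<mu>"
  shows "{x \<in> X. case_nat i x \<in> B} \<in> sets \<mu>"
  using assms unfolding sets
proof (induction B rule: sigma_sets.induct)
  case (Basic B)
  then obtain w where w: "B = cyl w" by blast
  show ?case
  proof (cases w)
    case Nil
    then show ?thesis using w branch_domain_sets sets by simp
  next
    case (Cons j v)
    have "{x \<in> X. case_nat i x \<in> B} = (if i = j then {x \<in> X. case_nat i x \<in> X} \<inter> cyl v else {})"
      using cylinder_subset unfolding w Cons by (auto simp: mem_cylinder_Cons)
    also have "\<dots> \<in> sets \<mu>" using branch_domain_sets by auto
    finally show ?thesis using sets by simp
  qed
next
  case Empty
  then show ?case by (simp add: sigma_sets.Empty)
next
  case (Compl B)
  have eq: "{x \<in> X. case_nat i x \<in> X - B} = {x \<in> X. case_nat i x \<in> X} - {x \<in> X. case_nat i x \<in> B}" by auto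
  have "{x \<in> X. case_nat i x \<in> B} \<in> sets \<mu>" using Compl.IH unfolding sets .
  from sets.Diff[OF branch_domain_sets this] show ?case unfolding eq sets .
next
  case (Union B)
  have "{x \<in> X. case_nat i x \<in> \<Union> (range B)} = (\<Union>k. {x \<in> X. case_nat i x \<in> B k})" by auto
  then show ?case using Union.IH by (simp add: sigma_sets.Union)
qed

section \<open>Nonsingularity of the inverse branches\<close>

text \<open>Over an infinite alphabet a set decided by finitely many coordinates may need infinitely
  many cylinders. Allowing this makes the class closed under complement.\<close>

definition finitary :: "(nat \<Rightarrow> nat) set \<Rightarrow> bool" where
  "finitary S \<longleftrightarrow> S \<subseteq> X \<and> (\<exists>n. \<forall>x\<in>X. \<forall>y\<in>X. (\<forall>k<n. x k = y k) \<longrightarrow> x \<in> S \<longrightarrow> y \<in> S)"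

lemma finitary_eq:
  assumes "finitary S"
  obtains n where "n \<ge> 1" "S = (\<Union>w\<in>{w. length w = n \<and> cyl w \<subseteq> S}. cyl w)"
proof -
  obtain n where S: "S \<subseteq> X" and n: "\<And>x y. x \<in> X \<Longrightarrow> y \<in> X \<Longrightarrow> \<forall>k<n. x k = y k \<Longrightarrow> x \<in> S \<Longrightarrow> y \<in> S"
    using assms unfolding finitary_def by blast
  show ?thesis
  proof (rule that)
    \<comment> \<open>One extra coordinate makes the words nonempty, so that their first letter
      decides whether another letter may be prepended.\<close>
    show "Suc n \<ge> 1" by simp
    show "S = (\<Union>w\<in>{w. length w = Suc n \<and> cyl w \<subseteq> S}. cyl w)"
    proof
      show "S \<subseteq> (\<Union>w\<in>{w. length w = Suc n \<and> cyl w \<subseteq> S}. cyl w)"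
      proof
        fix x assume x: "x \<in> S"
        let ?w = "map x [0..<Suc n]"
        have "x \<in> cyl ?w" using x S by (auto simp: cylinder_def simp del: upt_Suc)
        moreover have "cyl ?w \<subseteq> S"
        proof
          fix z assume "z \<in> cyl ?w"
          then have z: "z \<in> X" "\<forall>k<length ?w. z k = ?w ! k" by (auto simp: cylinder_def simp del: upt_Suc)
          have "x k = z k" if "k < n" for k
          proof -
            have "k < length ?w" using that by simp
            then have "z k = ?w ! k" using z(2) by blast
            also have "\<dots> = x ([0..<Suc n] ! k)" using that by (intro nth_map) simp
            also have "\<dots> = x k" using that by (simp del: upt_Suc)
            finally show ?thesis by simp
          qed
          then show "z \<in> S" using n[of x z] x S z(1) by blast
        qed
        moreover have "length ?w = Suc n" by simp
        ultimately show "x \<in> (\<Union>w\<in>{w. length w = Suc n \<and> cyl w \<subseteq> S}. cyl w)" by blast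
      qed
    qed auto
  qed
qed

lemma finitary_sets: "finitary S \<Longrightarrow> S \<in> sets \<mu>"
proof -
  assume "finitary S"
  then obtain n where "S = (\<Union>w\<in>{w. length w = n \<and> cyl w \<subseteq> S}. cyl w)"
    using finitary_eq by metis
  moreover have "(\<Union>w\<in>{w. length w = n \<and> cyl w \<subseteq> S}. cyl w) \<in> sets \<mu>"
    by (intro sets.countable_UN' countableI_type) auto
  ultimately show ?thesis by simp
qed

lemma finitary_Compl: "finitary S \<Longrightarrow> finitary (X - S)"
  unfolding finitary_def by (metis Diff_iff Diff_subset)

lemma finitary_Un:
  assumes "finitary S" "finitary T"
  shows "finitary (S \<union> T)"
proof -
  obtain n where n: "S \<subseteq> X" "\<And>x y. x \<in> X \<Longrightarrow> y \<in> X \<Longrightarrow> \<forall>k<n. x k = y k \<Longrightarrow> x \<in> S \<Longrightarrow> y \<in> S"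
    using assms(1) unfolding finitary_def by blast
  obtain l where l: "T \<subseteq> X" "\<And>x y. x \<in> X \<Longrightarrow> y \<in> X \<Longrightarrow> \<forall>k<l. x k = y k \<Longrightarrow> x \<in> T \<Longrightarrow> y \<in> T"
    using assms(2) unfolding finitary_def by blast
  have "y \<in> S \<union> T" if "x \<in> X" "y \<in> X" "\<forall>k<max n l. x k = y k" "x \<in> S \<union> T" for x y
    using that n(2)[of x y] l(2)[of x y] by (metis UnE UnI1 UnI2 less_max_iff_disj)
  then show ?thesis unfolding finitary_def using n(1) l(1) by blast
qed

lemma finitary_cylinder: "finitary (cyl w)"
  unfolding finitary_def cylinder_def by (auto intro!: exI[of _ "length w"])

lemma finitary_empty: "finitary {}"
  unfolding finitary_def by auto

text \<open>The Gibbs inequality compares measures only on cylinders; this approximation carries the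
  comparison over to null sets.\<close>
lemma finitary_approximation:
  assumes "B \<in> sets \<mu>" "\<epsilon> > 0"
  shows "\<exists>S. finitary S \<and> prob (B - S) + prob (S - B) < \<epsilon>"
  using assms unfolding sets
proof (induction B arbitrary: \<epsilon> rule: sigma_sets.induct)
  case (Basic B)
  then obtain w where "B = cyl w" by blast
  then show ?case using finitary_cylinder[of w] Basic.prems by (intro exI[of _ B]) simp
next
  case Empty
  then show ?case using finitary_empty by (intro exI[of _ "{}"]) simp
next
  case (Compl B)
  obtain S where S: "finitary S" "prob (B - S) + prob (S - B) < \<epsilon>"
    using Compl by blast
  have "B \<subseteq> X" using Compl.hyps sets.sets_into_space[of B \<mu>] sets space by simp
  moreover have "S \<subseteq> X" using S(1) unfolding finitary_def by blast
  ultimately have "(X - B) - (X - S) = S - B" "(X - S) - (X - B) = B - S" by auto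
  then show ?case using S finitary_Compl[OF S(1)] by (intro exI[of _ "X - S"]) simp
next
  case (Union B)
  have Bs: "B k \<in> sets \<mu>" for k using Union.hyps sets by simp
  define U where "U n = (\<Union>k<n. B k)" for n
  have Us: "U n \<in> sets \<mu>" for n unfolding U_def using Bs by auto
  have "incseq U" unfolding U_def incseq_def by (auto intro: less_le_trans)
  then have "(\<lambda>n. prob (U n)) \<longlonglongrightarrow> prob (\<Union>n. U n)"
    using Us by (intro finite_Lim_measure_incseq) auto
  moreover have "(\<Union>n. U n) = \<Union>(range B)" unfolding U_def by auto
  ultimately have "(\<lambda>n. prob (U n)) \<longlonglongrightarrow> prob (\<Union>(range B))" by simp
  then have "\<forall>\<^sub>F n in sequentially. prob (\<Union>(range B)) - \<epsilon> / 2 < prob (U n)"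
    using Union.prems by (intro order_tendstoD(1)) auto
  then obtain n where n: "prob (\<Union>(range B)) - \<epsilon> / 2 < prob (U n)"
    using eventually_happens'[OF sequentially_bot] by blast
  \<comment> \<open>The bound increases by exactly \<open>\<epsilon> / 8 / 2 ^ l\<close> in step
    \<open>l\<close> and stays below \<open>\<epsilon> / 2\<close>; its last summand makes it
    positive at \<open>l = 0\<close>, where a strict inequality is needed.\<close>
  have part: "\<exists>S. finitary S \<and> prob (U l - S) + prob (S - U l) < \<epsilon> / 2 * (1 - 1 / 2 ^ l) + \<epsilon> / 4 / 2 ^ l" for l
  proof (induction l)
    case 0
    then show ?case using finitary_empty Union.prems by (intro exI[of _ "{}"]) (simp add: U_def)
  next
    case (Suc l)
    then obtain S where S: "finitary S" "prob (U l - S) + prob (S - U l) < \<epsilon> / 2 * (1 - 1 / 2 ^ l) + \<epsilon> / 4 / 2 ^ l"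
      by blast
    have "\<epsilon> / 8 / 2 ^ l > 0" using Union.prems by simp
    then obtain T where T: "finitary T" "prob (B l - T) + prob (T - B l) < \<epsilon> / 8 / 2 ^ l"
      using Union.IH[of "\<epsilon> / 8 / 2 ^ l" l] by blast
    have ms: "U l - S \<in> sets \<mu>" "B l - T \<in> sets \<mu>" "S - U l \<in> sets \<mu>" "T - B l \<in> sets \<mu>"
      using Us Bs finitary_sets S(1) T(1) by auto
    have US: "U (Suc l) = U l \<union> B l" unfolding U_def by (auto simp: lessThan_Suc)
    have "prob (U (Suc l) - (S \<union> T)) \<le> prob ((U l - S) \<union> (B l - T))"
      unfolding US using ms by (intro finite_measure_mono sets.Un) auto
    also have "\<dots> \<le> prob (U l - S) + prob (B l - T)" using ms by (intro measure_Un_le)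
    finally have 1: "prob (U (Suc l) - (S \<union> T)) \<le> prob (U l - S) + prob (B l - T)" .
    have "prob ((S \<union> T) - U (Suc l)) \<le> prob ((S - U l) \<union> (T - B l))"
      unfolding US using ms by (intro finite_measure_mono sets.Un) auto
    also have "\<dots> \<le> prob (S - U l) + prob (T - B l)" using ms by (intro measure_Un_le)
    finally have 2: "prob ((S \<union> T) - U (Suc l)) \<le> prob (S - U l) + prob (T - B l)" .
    have "\<epsilon> / 2 * (1 - 1 / 2 ^ l) + \<epsilon> / 4 / 2 ^ l + \<epsilon> / 8 / 2 ^ l \<le> \<epsilon> / 2 * (1 - 1 / 2 ^ Suc l) + \<epsilon> / 4 / 2 ^ Suc l"
      using Union.prems by (simp add: field_simps)
    then show ?case using 1 2 S(2) T(2) finitary_Un[OF S(1) T(1)]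
      by (intro exI[of _ "S \<union> T"]) linarith
  qed
  obtain S where S: "finitary S" "prob (U n - S) + prob (S - U n) < \<epsilon> / 2 * (1 - 1 / 2 ^ n) + \<epsilon> / 4 / 2 ^ n"
    using part by blast
  have bnd: "\<epsilon> / 2 * (1 - 1 / 2 ^ n) + \<epsilon> / 4 / 2 ^ n \<le> \<epsilon> / 2"
    using Union.prems by (simp add: field_simps)
  have Rs: "\<Union>(range B) \<in> sets \<mu>" using Bs by auto
  have UR: "U n \<subseteq> \<Union>(range B)" unfolding U_def by auto
  have "prob (\<Union>(range B) - S) \<le> prob ((\<Union>(range B) - U n) \<union> (U n - S))"
    using Rs Us finitary_sets[OF S(1)] by (intro finite_measure_mono sets.Un sets.Diff) auto
  also have "\<dots> \<le> prob (\<Union>(range B) - U n) + prob (U n - S)"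
    using Rs Us finitary_sets[OF S(1)] by (intro measure_Un_le sets.Diff)
  also have "prob (\<Union>(range B) - U n) = prob (\<Union>(range B)) - prob (U n)"
    using Rs Us UR by (intro finite_measure_Diff)
  finally have 1: "prob (\<Union>(range B) - S) \<le> prob (\<Union>(range B)) - prob (U n) + prob (U n - S)" .
  have 2: "prob (S - \<Union>(range B)) \<le> prob (S - U n)"
    using Us finitary_sets[OF S(1)] UR by (intro finite_measure_mono sets.Diff) auto
  show ?case using 1 2 S n bnd by (intro exI[of _ S]) linarith
qed

text \<open>This is \<open>m_append_ge\<close> summed over cylinders: a branch cannot contract
  measure by more than a constant factor. \<open>S\<close> lies in the domain of the branch, so
  every junction is allowed.\<close>

lemma branch_finitary_bound:
  assumes S: "finitary S" "S \<subseteq> {x \<in> X. case_nat i x \<in> X}"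
  shows "m [i] * prob S \<le> K * prob {y \<in> X. y 0 = i \<and> left_shift y \<in> S}"
proof -
  obtain n where n: "n \<ge> 1" and S_eq: "S = (\<Union>w\<in>{w. length w = n \<and> cyl w \<subseteq> S}. cyl w)"
    using finitary_eq[OF S(1)] by blast
  define W where "W = {w. length w = n \<and> cyl w \<subseteq> S}"
  have S_W: "S = (\<Union>w\<in>W. cyl w)" using S_eq unfolding W_def .
  have T_W: "{y \<in> X. y 0 = i \<and> left_shift y \<in> S} = (\<Union>w\<in>W. cyl (i # w))"
    unfolding S_W by (auto simp: mem_cylinder_Cons)
  have cW: "countable W" by (rule countableI_type)
  have step: "ennreal (m [i]) * emeasure \<mu> (cyl w) \<le> ennreal K * emeasure \<mu> (cyl (i # w))"
    if w: "w \<in> W" for w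
  proof -
    have "m [i] * m w \<le> K * m (i # w)"
    proof (cases "adm w")
      case True
      then obtain x where x: "x \<in> cyl w" using cylinder_nonempty by blast
      then have "x \<in> S" using w unfolding W_def by blast
      then have "i \<in> I" "A i (x 0)" using S(2) by (auto simp: case_nat_in_shift_space)
      moreover have "x 0 = hd w" using x w n unfolding W_def
        by (cases w) (auto simp: mem_cylinder_Cons)
      ultimately have "adm ([i] @ w)" using True by (auto simp: admissible_Cons)
      then show ?thesis using m_append_ge by fastforce
    next
      case False
      then show ?thesis using K1 by (simp add: m_not_admissible)
    qed
    then show ?thesis unfolding emeasure_eq_measure m_def[symmetric] using K1
      by (simp add: ennreal_mult[symmetric] ennreal_leI)
  qed
  have "ennreal (m [i]) * emeasure \<mu> S = ennreal (m [i]) * (\<integral>\<^sup>+w. emeasure \<mu> (cyl w) \<partial>count_space W)"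
    unfolding S_W using cW by (subst emeasure_UN_countable) (auto simp: disjoint_family_on_def W_def cylinder_disjoint)
  also have "\<dots> = (\<integral>\<^sup>+w. ennreal (m [i]) * emeasure \<mu> (cyl w) \<partial>count_space W)"
    by (intro nn_integral_cmult[symmetric]) auto
  also have "\<dots> \<le> (\<integral>\<^sup>+w. ennreal K * emeasure \<mu> (cyl (i # w)) \<partial>count_space W)"
    using step by (intro nn_integral_mono) auto
  also have "\<dots> = ennreal K * (\<integral>\<^sup>+w. emeasure \<mu> (cyl (i # w)) \<partial>count_space W)"
    by (intro nn_integral_cmult) auto
  also have "\<dots> = ennreal K * emeasure \<mu> {y \<in> X. y 0 = i \<and> left_shift y \<in> S}"
  proof -
    have "disjoint_family_on (\<lambda>w. cyl (i # w)) W"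
      unfolding disjoint_family_on_def W_def using cylinder_disjoint by auto
    then show ?thesis unfolding T_W using cW by (subst emeasure_UN_countable) auto
  qed
  finally have "ennreal (m [i] * prob S) \<le> ennreal (K * prob {y \<in> X. y 0 = i \<and> left_shift y \<in> S})"
    using K1 by (simp add: emeasure_eq_measure ennreal_mult)
  then show ?thesis using K1 by (subst (asm) ennreal_le_iff) auto
qed

text \<open>The preimage \<open>B\<close> of \<open>E\<close> under the branch is approximated by a
  finitary \<open>S\<close>. The image of \<open>S\<close> is small, since it lies in
  \<open>E\<close> up to points whose shift is in \<open>S - B\<close>; hence \<open>S\<close>, and
  with it \<open>B\<close>, is small.\<close>

lemma branch_null:
  assumes E: "E \<in> null_sets \<mu>"
  shows "{x \<in> X. case_nat i x \<in> E} \<in> null_sets \<mu>"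
proof (cases "i \<in> I")
  case False
  have "E \<subseteq> X" using E sets.sets_into_space[of E \<mu>] space by auto
  then have eq: "{x \<in> X. case_nat i x \<in> E} = {}" using False by (auto simp: case_nat_in_shift_space)
  show ?thesis unfolding eq by simp
next
  case True
  have EX: "E \<subseteq> X" using E sets.sets_into_space[of E \<mu>] space by auto
  let ?D = "{x \<in> X. case_nat i x \<in> X}"
  define B where "B = {x \<in> X. case_nat i x \<in> E}"
  have Bs: "B \<in> sets \<mu>" unfolding B_def using E by (intro branch_sets) auto
  have BD: "B \<subseteq> ?D" unfolding B_def using EX by auto
  have mi: "m [i] > 0" using True by (intro m_pos) (simp add: admissible_Cons)
  have Dfin: "finitary ?D"
    unfolding finitary_def
    by (intro conjI exI[of _ 1]) (auto simp: case_nat_in_shift_space)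
  have bound: "m [i] * prob B \<le> (K + 1) * \<epsilon>" if \<epsilon>: "\<epsilon> > 0" for \<epsilon>
  proof -
    obtain S0 where S0: "finitary S0" "prob (B - S0) + prob (S0 - B) < \<epsilon>"
      using finitary_approximation[OF Bs \<epsilon>] by blast
    \<comment> \<open>This is \<open>S0 \<inter> ?D\<close>, written with complements and a union
      because \<open>finitary_Compl\<close> and \<open>finitary_Un\<close> are at hand.\<close>
    define S where "S = X - ((X - S0) \<union> (X - ?D))"
    have S: "finitary S" unfolding S_def
      by (intro finitary_Compl finitary_Un S0 Dfin)
    have "S0 \<subseteq> X" using S0(1) unfolding finitary_def by blast
    then have S_eq: "S = S0 \<inter> ?D" unfolding S_def by auto
    have s0: "S0 \<in> sets \<mu>" "S \<in> sets \<mu>" using finitary_sets S0(1) S by auto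
    have 1: "prob (B - S) \<le> prob (B - S0)"
      using BD Bs s0 unfolding S_eq by (intro finite_measure_mono) auto
    have 2: "prob (S - B) \<le> prob (S0 - B)"
      using Bs s0 unfolding S_eq by (intro finite_measure_mono) auto
    have diff: "S - B \<in> sets \<mu>" "B - S \<in> sets \<mu>" using Bs s0 by auto
    have "prob {y \<in> X. y 0 = i \<and> left_shift y \<in> S} \<le> prob (E \<union> {y \<in> X. left_shift y \<in> S - B})"
    proof (rule finite_measure_mono)
      show "E \<union> {y \<in> X. left_shift y \<in> S - B} \<in> sets \<mu>" using E shift_sets[OF diff(1)] by auto
      show "{y \<in> X. y 0 = i \<and> left_shift y \<in> S} \<subseteq> E \<union> {y \<in> X. left_shift y \<in> S - B}"
        unfolding B_def by (auto simp: case_nat_left_shift left_shift_in_shift_space)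
    qed
    also have "\<dots> \<le> prob E + prob {y \<in> X. left_shift y \<in> S - B}"
      using E shift_sets[OF diff(1)] by (intro measure_Un_le) auto
    also have "\<dots> = prob (S - B)"
      using E shift_measure[OF diff(1)] by (simp add: null_sets_def measure_def)
    finally have 3: "prob {y \<in> X. y 0 = i \<and> left_shift y \<in> S} \<le> prob (S - B)" .
    have 4: "m [i] * prob S \<le> K * prob {y \<in> X. y 0 = i \<and> left_shift y \<in> S}"
      by (rule branch_finitary_bound[OF S]) (simp add: S_eq)
    have 5: "prob B \<le> prob (S \<union> (B - S))"
      using Bs s0 diff by (intro finite_measure_mono) auto
    have 6: "prob (S \<union> (B - S)) \<le> prob S + prob (B - S)"
      by (rule measure_Un_le[OF s0(2) diff(2)])
    have n1: "prob (B - S) \<le> \<epsilon>" "prob (S - B) \<le> \<epsilon>"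
      using 1 2 S0(2) measure_nonneg[of \<mu> "B - S0"] measure_nonneg[of \<mu> "S0 - B"] by linarith+
    have "K * prob {y \<in> X. y 0 = i \<and> left_shift y \<in> S} \<le> K * \<epsilon>"
      using 3 n1(2) K1 by (intro mult_left_mono) linarith+
    then have 7: "m [i] * prob S \<le> K * \<epsilon>" using 4 by linarith
    have "m [i] * prob (B - S) \<le> 1 * \<epsilon>"
      using m_le_1 n1(1) by (intro mult_mono) auto
    moreover have "m [i] * prob B \<le> m [i] * (prob S + prob (B - S))"
      using 5 6 by (intro mult_left_mono) auto
    ultimately show ?thesis using 7 by (simp add: algebra_simps)
  qed
  have "m [i] * prob B \<le> 0"
  proof (rule ccontr)
    assume n: "\<not> m [i] * prob B \<le> 0"
    have "m [i] * prob B \<le> (K + 1) * (m [i] * prob B / (2 * (K + 1)))"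
      using n K1 by (intro bound) auto
    also have "\<dots> = m [i] * prob B / 2" using K1 by (simp add: field_simps)
    finally show False using n by linarith
  qed
  then have "prob B = 0" using mi measure_nonneg[of \<mu> B] by (simp add: mult_le_0_iff)
  then show ?thesis using Bs unfolding B_def[symmetric] by (simp add: null_sets_def emeasure_eq_measure)
qed

lemma pre_null:
  assumes E: "E \<in> null_sets \<mu>"
  shows "{x \<in> X. pre w x \<in> E} \<in> null_sets \<mu>"
  using E
proof (induction w arbitrary: E)
  case Nil
  have "E \<subseteq> X" using Nil sets.sets_into_space[of E \<mu>] space by auto
  then have eq: "{x \<in> X. pre [] x \<in> E} = E" by auto
  show ?case unfolding eq by (rule Nil)
next
  case (Cons i w)
  have "E \<subseteq> X" using Cons.prems sets.sets_into_space[of E \<mu>] space by auto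
  then have eq: "{x \<in> X. pre (i # w) x \<in> E} = {x \<in> X. pre w x \<in> {y \<in> X. case_nat i y \<in> E}}"
    by (auto simp: case_nat_in_shift_space)
  show ?case unfolding eq by (rule Cons.IH[OF branch_null[OF Cons.prems]])
qed

text \<open>There are countably many words, so one null set serves all inverse branches of all
  orders simultaneously.\<close>

lemma AE_pre:
  assumes "AE x in \<mu>. R x"
  shows "AE x in \<mu>. \<forall>w. pre w x \<in> X \<longrightarrow> R (pre w x)"
proof -
  obtain N where N: "N \<in> null_sets \<mu>" "{x \<in> space \<mu>. \<not> R x} \<subseteq> N"
    using assms unfolding eventually_ae_filter by blast
  have "AE x in \<mu>. \<not> (x \<in> X \<and> pre w x \<in> N)" for w
    using AE_not_in[OF pre_null[OF N(1), of w]] by simp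
  then have "AE x in \<mu>. \<forall>w. \<not> (x \<in> X \<and> pre w x \<in> N)" by (subst AE_all_countable) simp
  moreover have "AE x in \<mu>. x \<in> X" using AE_space[of \<mu>] by (simp add: space)
  ultimately show ?thesis
  proof eventually_elim
    case (elim x)
    show ?case
    proof (intro allI impI)
      fix w assume "pre w x \<in> X"
      moreover have "pre w x \<notin> N" using elim by blast
      ultimately show "R (pre w x)" using N(2) space by blast
    qed
  qed
qed

end

section \<open>The Perron-Frobenius operator\<close>

lemma pre_drop: "(\<lambda>j. pre u y (j + length u)) = y"
proof (induction u)
  case (Cons i u)
  have "(\<lambda>j. pre (i # u) y (j + length (i # u))) = (\<lambda>j. pre u y (j + length u))" by simp
  then show ?case using Cons by simp
qed simp

text \<open>\<open>infsum\<close> is 0 where the series does not converge absolutely. That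
  convergence is a countable condition on finite sums, so a case distinction between two measurable
  functions remains.\<close>

lemma borel_measurable_infsum_nat:
  fixes H :: "nat \<Rightarrow> 'a \<Rightarrow> real"
  assumes [measurable]: "\<And>i. H i \<in> borel_measurable M"
  shows "(\<lambda>x. \<Sum>\<^sub>\<infinity>i. H i x) \<in> borel_measurable M"
proof -
  have "(\<lambda>i. H i x) summable_on UNIV \<longleftrightarrow> (\<exists>b::nat. \<forall>n. (\<Sum>i<n. \<bar>H i x\<bar>) \<le> real b)" for x
  proof
    assume "(\<lambda>i. H i x) summable_on UNIV"
    then have s: "(\<lambda>i. norm (H i x)) summable_on UNIV" by (rule summable_on_iff_abs_summable_on_real[THEN iffD1])
    obtain b :: nat where b: "(\<Sum>\<^sub>\<infinity>i. norm (H i x)) \<le> real b" using real_arch_simple by blast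
    have "(\<Sum>i<n. \<bar>H i x\<bar>) \<le> real b" for n
      using finite_sum_le_infsum[OF s, of "{..<n}"] b by simp
    then show "\<exists>b::nat. \<forall>n. (\<Sum>i<n. \<bar>H i x\<bar>) \<le> real b" by blast
  next
    assume "\<exists>b::nat. \<forall>n. (\<Sum>i<n. \<bar>H i x\<bar>) \<le> real b"
    then obtain b where b: "\<forall>n. (\<Sum>i<n. \<bar>H i x\<bar>) \<le> real b" by (elim exE)
    have "summable (\<lambda>i. norm (H i x))"
    proof (rule bounded_imp_summable[of _ "real b"])
      fix n
      show "(\<Sum>i\<le>n. norm (H i x)) \<le> real b"
        using b[rule_format, of "Suc n"] by (simp only: lessThan_Suc_atMost real_norm_def)
    qed simp
    then show "(\<lambda>i. H i x) summable_on UNIV"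
      by (rule norm_summable_imp_summable_on)
  qed
  moreover have "(\<Sum>\<^sub>\<infinity>i. H i x) = (\<Sum>i. H i x)" if "(\<lambda>i. H i x) summable_on UNIV" for x
    using has_sum_imp_sums[OF has_sum_infsum[OF that]] by (simp add: sums_iff)
  ultimately have "(\<lambda>x. \<Sum>\<^sub>\<infinity>i. H i x) =
      (\<lambda>x. if \<exists>b::nat. \<forall>n. (\<Sum>i<n. \<bar>H i x\<bar>) \<le> real b then (\<Sum>i. H i x) else 0)"
    by (auto simp: fun_eq_iff infsum_not_exists)
  then show ?thesis by simp
qed

context gibbs_extension
begin

abbreviation "T \<equiv> PF_op I A G \<Psi> \<phi>"

definition br :: "nat \<Rightarrow> (nat \<Rightarrow> nat) \<Rightarrow> nat list set" where
  "br n x = {w. length w = n \<and> pre w x \<in> X}"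

definition wt :: "nat list \<Rightarrow> (nat \<Rightarrow> nat) \<Rightarrow> real" where
  "wt w x = exp (birkhoff_sum \<phi> (length w) (pre w x))"

lemma wt_pos: "wt w x > 0" by (simp add: wt_def)

lemma wt_append: "wt (u @ w) x = wt u (pre w x) * wt w x"
  by (simp add: wt_def pre_append birkhoff_sum_add pre_drop exp_add)

lemma br_words: "br n x \<subseteq> words I n"
  unfolding br_def words_def by (auto simp: pre_in_shift_space admissible_def)

lemma wt_le:
  assumes "w \<in> br n x"
  shows "wt w x \<le> C * exp (real n * P) * m w"
  using gibbs_lower[OF pre_in_cylinder[of w x]] assms unfolding wt_def br_def by auto

lemma wt_ge:
  assumes "w \<in> br n x"
  shows "m w * exp (real n * P) \<le> C * wt w x"
  using gibbs_upper[OF pre_in_cylinder[of w x]] assms unfolding wt_def br_def by auto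

lemma m_summable:
  assumes "W \<subseteq> words I n"
  shows "m summable_on W"
proof (rule nonneg_bdd_above_summable_on)
  show "bdd_above (sum m ` {F. F \<subseteq> W \<and> finite F})"
    by (rule bdd_aboveI2[of _ _ 1], rule sum_m_le_1) (use assms in \<open>auto simp: words_def\<close>)
qed simp

lemma m_infsum_le: "W \<subseteq> words I n \<Longrightarrow> infsum m W \<le> 1"
  by (rule infsum_le_finite_sums[OF m_summable], assumption, rule sum_m_le_1) (auto simp: words_def)

text \<open>By \<open>wt_le\<close> the weights are dominated by \<open>m\<close>, whose sum over
  words of one length is at most 1. Summability over infinitely many branches comes from
  this.\<close>

lemma
  assumes b: "\<And>w. w \<in> br n x \<Longrightarrow> \<bar>h w\<bar> \<le> b" and b0: "b \<ge> 0"
  shows wt_summable: "(\<lambda>w. wt w x * h w) summable_on br n x"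
    and wt_infsum_le: "\<bar>\<Sum>\<^sub>\<infinity>w\<in>br n x. wt w x * h w\<bar> \<le> C * exp (real n * P) * b"
proof -
  define c where "c = C * exp (real n * P)"
  have c: "c > 0" unfolding c_def using C1 by simp
  have le: "norm (wt w x * h w) \<le> norm (m w * (c * b))" if w: "w \<in> br n x" for w
  proof -
    have "\<bar>wt w x * h w\<bar> = wt w x * \<bar>h w\<bar>" using wt_pos by (simp add: abs_mult less_imp_le)
    also have "\<dots> \<le> (c * m w) * b"
      using wt_le[OF w] b[OF w] c wt_pos[of w x] unfolding c_def by (intro mult_mono) auto
    also have "\<dots> = norm (m w * (c * b))" using c b0 by simp
    finally show ?thesis by simp
  qed
  have ms: "m summable_on br n x" by (rule m_summable[OF br_words])
  have "(\<lambda>w. m w * (c * b)) summable_on br n x" by (rule summable_on_cmult_left[OF ms])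
  then have s0: "(\<lambda>w. norm (m w * (c * b))) summable_on br n x" by (rule summable_on_iff_abs_summable_on_real[THEN iffD1])
  have s1: "(\<lambda>w. norm (wt w x * h w)) summable_on br n x"
    by (rule Infinite_Sum.abs_summable_on_comparison_test[OF s0 le])
  then show "(\<lambda>w. wt w x * h w) summable_on br n x" by (rule Infinite_Sum.abs_summable_summable)
  have "\<bar>\<Sum>\<^sub>\<infinity>w\<in>br n x. wt w x * h w\<bar> \<le> (\<Sum>\<^sub>\<infinity>w\<in>br n x. norm (wt w x * h w))"
    using norm_infsum_bound[OF s1] by simp
  also have "\<dots> \<le> (\<Sum>\<^sub>\<infinity>w\<in>br n x. norm (m w * (c * b)))" by (rule infsum_mono[OF s1 s0 le])
  also have "\<dots> = infsum m (br n x) * \<bar>c * b\<bar>" by (simp add: abs_mult infsum_cmult_left')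
  also have "\<dots> \<le> 1 * (c * b)"
    using c b0 m_infsum_le[OF br_words] by (intro mult_mono) auto
  finally show "\<bar>\<Sum>\<^sub>\<infinity>w\<in>br n x. wt w x * h w\<bar> \<le> C * exp (real n * P) * b" unfolding c_def by simp
qed

text \<open>Preimages of \<open>(x, g)\<close> correspond to letters \<open>i\<close> that can
  precede \<open>x\<close>, and the group component must solve
  \<open>h \<otimes> \<Psi> i = g\<close>.\<close>

lemma PF_op_br:
  assumes x: "x \<in> X" and g: "g \<in> carrier G"
  shows "T f (x, g) = (\<Sum>\<^sub>\<infinity>w\<in>br 1 x. wt w x * f (pre w x, g \<otimes> inv (Pw w)))"
proof -
  let ?S = "{y \<in> X \<times> carrier G. skew G \<Psi> y = (x, g)}"
  let ?h = "\<lambda>w. (pre w x, g \<otimes> inv (Pw w))"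
  have letter: "\<exists>i. w = [i] \<and> i \<in> I \<and> case_nat i x \<in> X \<and> Pw w = \<Psi> i" if "w \<in> br 1 x" for w
    using that Psi unfolding br_def by (auto simp: length_Suc_conv case_nat_in_shift_space)
  have "bij_betw ?h (br 1 x) ?S"
    unfolding bij_betw_def
  proof
    show "inj_on ?h (br 1 x)"
    proof (rule inj_onI)
      fix v w assume vw: "v \<in> br 1 x" "w \<in> br 1 x" "?h v = ?h w"
      obtain i j where ij: "v = [i]" "w = [j]" using letter vw by metis
      then have "case_nat i x = case_nat j x" using vw by simp
      then have "i = j" by (metis nat.case(1))
      then show "v = w" using ij by simp
    qed
    show "?h ` br 1 x = ?S"
    proof
      show "?h ` br 1 x \<subseteq> ?S"
      proof
        fix y assume "y \<in> ?h ` br 1 x"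
        then obtain w where w: "w \<in> br 1 x" "y = ?h w" by blast
        obtain i where i: "w = [i]" "i \<in> I" "case_nat i x \<in> X" "Pw w = \<Psi> i" using letter[OF w(1)] by blast
        have "\<Psi> i \<in> carrier G" using Psi i by blast
        then show "y \<in> ?S" using w i g by (simp add: skew_def m_assoc del: Pw_Cons)
      qed
      show "?S \<subseteq> ?h ` br 1 x"
      proof
        fix y assume y: "y \<in> ?S"
        obtain z h where zh: "y = (z, h)" by (cases y)
        have z: "z \<in> X" "h \<in> carrier G" "left_shift z = x" "h \<otimes> \<Psi> (z 0) = g"
          using y zh by (auto simp: skew_def)
        have c: "case_nat (z 0) x = z" using case_nat_left_shift[of z "z 0"] z(3) by simp
        have i: "z 0 \<in> I" using z(1) by (auto simp: shift_space_def)
        have psi: "\<Psi> (z 0) \<in> carrier G" using Psi i by blast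
        have mem: "[z 0] \<in> br 1 x" unfolding br_def using c z(1) by simp
        have eq: "?h [z 0] = y" using zh z c psi by (auto simp: m_assoc)
        show "y \<in> ?h ` br 1 x" by (rule image_eqI[where x = "[z 0]"]) (rule eq[symmetric], rule mem)
      qed
    qed
  qed
  then have "T f (x, g) = (\<Sum>\<^sub>\<infinity>w\<in>br 1 x. exp (\<phi> (fst (?h w))) * f (?h w))"
    unfolding PF_op_def by (rule infsum_reindex_bij_betw[symmetric])
  also have "\<dots> = (\<Sum>\<^sub>\<infinity>w\<in>br 1 x. wt w x * f (?h w))"
    by (intro infsum_cong) (auto simp: br_def wt_def birkhoff_sum_def)
  finally show ?thesis .
qed

text \<open>Functions are bounded only off a null set, while the iterates are evaluated pointwise;
  the formula for them is proved on sets that no inverse branch leaves.\<close>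

definition branch_closed :: "(nat \<Rightarrow> nat) set \<Rightarrow> bool" where
  "branch_closed S \<longleftrightarrow> S \<subseteq> X \<and> (\<forall>x\<in>S. \<forall>w. pre w x \<in> X \<longrightarrow> pre w x \<in> S)"

text \<open>Boundedness of \<open>f\<close> gives absolute summability, which justifies merging the
  iterated sums into one sum over words of length \<open>n\<close>.\<close>

lemma PF_op_funpow:
  assumes S: "branch_closed S" and b: "\<And>x g. x \<in> S \<Longrightarrow> g \<in> carrier G \<Longrightarrow> \<bar>f (x, g)\<bar> \<le> b"
    and x: "x \<in> S" and g: "g \<in> carrier G"
  shows "(T ^^ n) f (x, g) = (\<Sum>\<^sub>\<infinity>w\<in>br n x. wt w x * f (pre w x, g \<otimes> inv (Pw w)))"
  using b
proof (induction n arbitrary: f b)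
  case 0
  have "x \<in> X" using x S unfolding branch_closed_def by blast
  then have "br 0 x = {[]}" unfolding br_def by auto
  then show ?case using g by (simp add: wt_def birkhoff_sum_def)
next
  case (Suc n)
  have PwI: "Pw w \<in> carrier G" "set w \<subseteq> I" if "w \<in> br k y" for w k y
    using that br_words[of k y] by (auto simp: words_def)
  have inS: "pre w y \<in> S" if "y \<in> S" "w \<in> br k y" for w k y
    using that S unfolding branch_closed_def br_def by blast
  have SX: "y \<in> X" if "y \<in> S" for y using that S unfolding branch_closed_def by blast
  have Tb: "\<bar>T f (y, h)\<bar> \<le> C * exp (real 1 * P) * b" if y: "y \<in> S" and h: "h \<in> carrier G" for y h
  proof -
    have "\<bar>f (pre w y, h \<otimes> inv (Pw w))\<bar> \<le> b" if "w \<in> br 1 y" for w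
      using Suc.prems inS[OF y that] h PwI[OF that] by auto
    moreover have "b \<ge> 0" using Suc.prems[OF y h] by linarith
    ultimately have "\<bar>\<Sum>\<^sub>\<infinity>w\<in>br 1 y. wt w y * f (pre w y, h \<otimes> inv (Pw w))\<bar> \<le> C * exp (real 1 * P) * b"
      by (rule wt_infsum_le)
    then show ?thesis using PF_op_br[OF SX[OF y] h] by simp
  qed
  define H where "H w = f (pre w x, g \<otimes> inv (Pw w))" for w
  have Hb: "\<bar>H w\<bar> \<le> b" if "w \<in> br (Suc n) x" for w
    unfolding H_def using Suc.prems inS[OF x that] g PwI[OF that] by auto
  have bij: "bij_betw (\<lambda>p. snd p @ fst p) (Sigma (br n x) (\<lambda>w. br 1 (pre w x))) (br (Suc n) x)"
  proof (rule bij_betwI[of _ _ _ "\<lambda>w. (tl w, [hd w])"])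
    show "(\<lambda>p. snd p @ fst p) \<in> Sigma (br n x) (\<lambda>w. br 1 (pre w x)) \<rightarrow> br (Suc n) x"
      by (auto simp: br_def pre_append)
    show "(\<lambda>w. (tl w, [hd w])) \<in> br (Suc n) x \<rightarrow> Sigma (br n x) (\<lambda>w. br 1 (pre w x))"
      by (auto simp: br_def length_Suc_conv case_nat_in_shift_space)
  qed (auto simp: br_def length_Suc_conv)
  have sum: "(\<lambda>w. wt w x * H w) summable_on br (Suc n) x" 
  proof (rule wt_summable[OF Hb])
    show "b \<ge> 0" using Suc.prems[OF x g] by linarith
  qed
  then have sum': "(\<lambda>p. wt (snd p @ fst p) x * H (snd p @ fst p)) summable_on Sigma (br n x) (\<lambda>w. br 1 (pre w x))"
    using summable_on_reindex_bij_betw[OF bij, of "\<lambda>w. wt w x * H w"] by simp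
  \<comment> \<open>The innermost factor is peeled off and the induction hypothesis applied to
    \<open>T f\<close>, which is bounded on \<open>S\<close> by another constant; hence the
    induction is over all \<open>f\<close> and \<open>b\<close>.\<close>
  have "(T ^^ Suc n) f (x, g) = (T ^^ n) (T f) (x, g)" by (simp add: funpow_swap1)
  also have "\<dots> = (\<Sum>\<^sub>\<infinity>w\<in>br n x. wt w x * T f (pre w x, g \<otimes> inv (Pw w)))"
    using Tb by (rule Suc.IH)
  also have "\<dots> = (\<Sum>\<^sub>\<infinity>w\<in>br n x. \<Sum>\<^sub>\<infinity>u\<in>br 1 (pre w x). wt (u @ w) x * H (u @ w))"
  proof (rule infsum_cong)
    fix w assume w: "w \<in> br n x"
    have gw: "g \<otimes> inv (Pw w) \<in> carrier G" using g PwI[OF w] by simp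
    have "wt w x * T f (pre w x, g \<otimes> inv (Pw w)) = wt w x *
        (\<Sum>\<^sub>\<infinity>u\<in>br 1 (pre w x). wt u (pre w x) * f (pre u (pre w x), g \<otimes> inv (Pw w) \<otimes> inv (Pw u)))"
      using PF_op_br[OF SX[OF inS[OF x w]] gw] by simp
    also have "\<dots> = (\<Sum>\<^sub>\<infinity>u\<in>br 1 (pre w x). wt w x * (wt u (pre w x) * f (pre u (pre w x), g \<otimes> inv (Pw w) \<otimes> inv (Pw u))))"
      by (rule infsum_cmult_right'[symmetric])
    also have "\<dots> = (\<Sum>\<^sub>\<infinity>u\<in>br 1 (pre w x). wt (u @ w) x * H (u @ w))"
    proof (rule infsum_cong)
      fix u assume u: "u \<in> br 1 (pre w x)"
      have "g \<otimes> inv (Pw (u @ w)) = g \<otimes> inv (Pw w) \<otimes> inv (Pw u)"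
        using g PwI[OF w] PwI[OF u] by (simp add: Pw_append inv_mult_group m_assoc)
      then show "wt w x * (wt u (pre w x) * f (pre u (pre w x), g \<otimes> inv (Pw w) \<otimes> inv (Pw u))) = wt (u @ w) x * H (u @ w)"
        unfolding H_def by (simp add: wt_append pre_append)
    qed
    finally show "wt w x * T f (pre w x, g \<otimes> inv (Pw w)) = (\<Sum>\<^sub>\<infinity>u\<in>br 1 (pre w x). wt (u @ w) x * H (u @ w))" .
  qed
  also have "\<dots> = (\<Sum>\<^sub>\<infinity>p\<in>Sigma (br n x) (\<lambda>w. br 1 (pre w x)). wt (snd p @ fst p) x * H (snd p @ fst p))"
    using infsum_Sigma_banach[OF sum'] by simp
  also have "\<dots> = (\<Sum>\<^sub>\<infinity>w\<in>br (Suc n) x. wt w x * H w)"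
    using infsum_reindex_bij_betw[OF bij, of "\<lambda>w. wt w x * H w"] by simp
  finally show ?case unfolding H_def .
qed

lemma branch_measurable:
  assumes h: "h \<in> borel_measurable \<mu>"
  shows "(\<lambda>x. if case_nat i x \<in> X then h (case_nat i x) else (0::real)) \<in> borel_measurable \<mu>"
proof (rule measurableI)
  fix B :: "real set" assume B: "B \<in> sets borel"
  let ?D = "{x \<in> X. case_nat i x \<in> X}"
  have hB: "h -` B \<inter> X \<in> sets \<mu>" using measurable_sets[OF h B] by (simp add: space)
  have "(\<lambda>x. if case_nat i x \<in> X then h (case_nat i x) else 0) -` B \<inter> space \<mu> =
      {x \<in> X. case_nat i x \<in> h -` B \<inter> X} \<union> (if 0 \<in> B then X - ?D else {})"
    by (auto simp: space split: if_splits)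
  also have "\<dots> \<in> sets \<mu>"
    using branch_sets[OF hB] sets.compl_sets[OF branch_domain_sets] by (auto simp: space)
  finally show "(\<lambda>x. if case_nat i x \<in> X then h (case_nat i x) else 0) -` B \<inter> space \<mu> \<in> sets \<mu>" .
qed simp

lemma PF_op_measurable:
  assumes f: "\<And>g. g \<in> carrier G \<Longrightarrow> (\<lambda>x. f (x, g)) \<in> borel_measurable \<mu>" and g: "g \<in> carrier G"
  shows "(\<lambda>x. T f (x, g)) \<in> borel_measurable \<mu>"
proof -
  define H where "H i x = (if case_nat i x \<in> X then exp (\<phi> (case_nat i x)) * f (case_nat i x, g \<otimes> inv (\<Psi> i)) else 0)" for i x
  have "H i \<in> borel_measurable \<mu>" for i
  proof (cases "i \<in> I")
    case True
    then have [measurable]: "(\<lambda>x. f (x, g \<otimes> inv (\<Psi> i))) \<in> borel_measurable \<mu>"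
      using f g Psi by simp
    show ?thesis unfolding H_def
      by (rule branch_measurable[of "\<lambda>y. exp (\<phi> y) * f (y, g \<otimes> inv (\<Psi> i))"]) measurable
  next
    case False
    then have "H i = (\<lambda>x. 0)" by (auto simp: H_def case_nat_in_shift_space)
    then show ?thesis by simp
  qed
  then have "(\<lambda>x. \<Sum>\<^sub>\<infinity>i. H i x) \<in> borel_measurable \<mu>" by (rule borel_measurable_infsum_nat)
  moreover have "T f (x, g) = (\<Sum>\<^sub>\<infinity>i. H i x)" if x: "x \<in> X" for x
  proof -
    have "bij_betw (\<lambda>i. [i]) {i. case_nat i x \<in> X} (br 1 x)"
      by (rule bij_betwI[of _ _ _ hd]) (auto simp: br_def length_Suc_conv)
    then have "T f (x, g) = (\<Sum>\<^sub>\<infinity>i\<in>{i. case_nat i x \<in> X}. wt [i] x * f (pre [i] x, g \<otimes> inv (Pw [i])))"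
      unfolding PF_op_br[OF x g] by (rule infsum_reindex_bij_betw[symmetric])
    also have "\<dots> = (\<Sum>\<^sub>\<infinity>i. H i x)"
    proof (rule infsum_cong_neutral)
      fix i assume "i \<in> {i. case_nat i x \<in> X} \<inter> UNIV"
      then have "i \<in> I" "case_nat i x \<in> X" by (auto simp: case_nat_in_shift_space)
      then show "wt [i] x * f (pre [i] x, g \<otimes> inv (Pw [i])) = H i x"
        unfolding H_def using Psi by (simp add: wt_def birkhoff_sum_def)
    qed (auto simp: H_def)
    finally show ?thesis .
  qed
  ultimately show ?thesis by (subst measurable_cong[of \<mu> _ "\<lambda>x. \<Sum>\<^sub>\<infinity>i. H i x"]) (auto simp: space)
qed

lemma PF_op_funpow_measurable:
  assumes "\<And>g. g \<in> carrier G \<Longrightarrow> (\<lambda>x. f (x, g)) \<in> borel_measurable \<mu>" "g \<in> carrier G"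
  shows "(\<lambda>x. (T ^^ n) f (x, g)) \<in> borel_measurable \<mu>"
  using assms
proof (induction n arbitrary: g)
  case (Suc n)
  then show ?case using PF_op_measurable[of "(T ^^ n) f" g] by simp
qed simp

end

section \<open>Operator norms and the spectral radius\<close>

context gibbs_extension
begin

lemma esssup_abs_nonneg: "0 \<le> esssup \<mu> (\<lambda>\<omega>. ereal \<bar>f \<omega>\<bar>)"
proof -
  have "esssup \<mu> (\<lambda>\<omega>. 0 :: ereal) = 0" by (rule esssup_const) (simp add: emeasure_space_1)
  moreover have "esssup \<mu> (\<lambda>\<omega>. 0 :: ereal) \<le> esssup \<mu> (\<lambda>\<omega>. ereal \<bar>f \<omega>\<bar>)" by (rule esssup_mono) auto
  ultimately show ?thesis by simp
qed

text \<open>\<open>F g\<close> is the essential supremum over the fibre of \<open>g\<close>;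
  countability of the group allows one null set for all fibres. Norm estimates become statements
  about the function \<open>F\<close> in the square-summable functions on the group.\<close>

lemma Hinf_majorant:
  assumes f: "in_Hinf \<mu> G f"
  obtains F where "\<And>g. F g \<ge> 0" "AE x in \<mu>. \<forall>g\<in>carrier G. \<bar>f (x, g)\<bar> \<le> F g"
    "\<And>B. finite B \<Longrightarrow> B \<subseteq> carrier G \<Longrightarrow> (\<Sum>g\<in>B. (F g)\<^sup>2) \<le> (nrm f)\<^sup>2"
proof -
  define e where "e g = esssup \<mu> (\<lambda>\<omega>. ereal \<bar>f (\<omega>, g)\<bar>)" for g
  define s where "s = Hinf_sqnorm \<mu> G f"
  have fin: "s < \<infinity>" using f unfolding in_Hinf_def s_def by blast
  have up: "(\<Sum>g\<in>B. (e g)\<^sup>2) \<le> s" if "finite B" "B \<subseteq> carrier G" for B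
    unfolding s_def Hinf_sqnorm_def e_def using that by (intro SUP_upper) auto
  have e0: "e g \<ge> 0" for g unfolding e_def by (rule esssup_abs_nonneg)
  define F where "F g = (if g \<in> carrier G then real_of_ereal (e g) else 0)" for g
  have eF: "e g = ereal (F g)" if g: "g \<in> carrier G" for g
  proof -
    have "(e g)\<^sup>2 \<le> s" using up[of "{g}"] g by simp
    then have "e g \<noteq> \<infinity>" using fin by auto
    then show ?thesis using e0[of g] g unfolding F_def by (cases "e g") auto
  qed
  have F0: "F g \<ge> 0" for g
    using e0[of g] unfolding F_def by (simp add: real_of_ereal_pos)
  have s0: "0 \<le> s" using up[of "{}"] by simp
  have norm: "ereal ((nrm f)\<^sup>2) = s"
    unfolding Hinf_norm_def s_def[symmetric] using s0 fin by (cases s) auto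
  have sumF: "(\<Sum>g\<in>B. (F g)\<^sup>2) \<le> (nrm f)\<^sup>2" if B: "finite B" "B \<subseteq> carrier G" for B
  proof -
    have "ereal (\<Sum>g\<in>B. (F g)\<^sup>2) = (\<Sum>g\<in>B. ereal ((F g)\<^sup>2))" by simp
    also have "\<dots> = (\<Sum>g\<in>B. (e g)\<^sup>2)" using B eF by (intro sum.cong) auto
    also have "\<dots> \<le> ereal ((nrm f)\<^sup>2)" using up[OF B] norm by simp
    finally show ?thesis by simp
  qed
  have AEF: "AE x in \<mu>. \<forall>g\<in>carrier G. \<bar>f (x, g)\<bar> \<le> F g"
    unfolding AE_ball_countable[OF countable_carrier]
  proof
    fix g assume g: "g \<in> carrier G"
    show "AE x in \<mu>. \<bar>f (x, g)\<bar> \<le> F g"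
      using esssup_AE[of "\<lambda>\<omega>. ereal \<bar>f (\<omega>, g)\<bar>" \<mu>] eF[OF g] unfolding e_def by simp
  qed
  show ?thesis by (rule that[OF F0 AEF sumF])
qed

text \<open>The converse of \<open>Hinf_majorant\<close>.\<close>

lemma Hinf_intro:
  assumes meas: "\<And>g. g \<in> carrier G \<Longrightarrow> (\<lambda>x. h (x, g)) \<in> borel_measurable \<mu>"
    and AE: "AE x in \<mu>. \<forall>g\<in>carrier G. \<bar>h (x, g)\<bar> \<le> F g"
    and sumF: "\<And>B. finite B \<Longrightarrow> B \<subseteq> carrier G \<Longrightarrow> (\<Sum>g\<in>B. (F g)\<^sup>2) \<le> b\<^sup>2"
    and b0: "b \<ge> 0"
  shows "in_Hinf \<mu> G h \<and> nrm h \<le> b"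
proof -
  define e where "e g = esssup \<mu> (\<lambda>\<omega>. ereal \<bar>h (\<omega>, g)\<bar>)" for g
  have ms: "(\<lambda>\<omega>. ereal \<bar>h (\<omega>, g)\<bar>) \<in> borel_measurable \<mu>" if "g \<in> carrier G" for g
  proof -
    have [measurable]: "(\<lambda>\<omega>. h (\<omega>, g)) \<in> borel_measurable \<mu>" using meas that by blast
    show ?thesis by measurable
  qed
  have e: "0 \<le> e g \<and> e g \<le> ereal (F g)" if g: "g \<in> carrier G" for g
  proof
    show "0 \<le> e g" unfolding e_def by (rule esssup_abs_nonneg)
    show "e g \<le> ereal (F g)" unfolding e_def
    proof (rule esssup_I[OF ms[OF g]])
      show "AE x in \<mu>. ereal \<bar>h (x, g)\<bar> \<le> ereal (F g)" using AE by eventually_elim (use g in auto)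
    qed
  qed
  have sq: "(e g)\<^sup>2 \<le> ereal ((F g)\<^sup>2)" if g: "g \<in> carrier G" for g
  proof -
    obtain r where "e g = ereal r" using e[OF g] by (cases "e g") auto
    then show ?thesis using e[OF g] by (simp add: power_mono)
  qed
  have le: "Hinf_sqnorm \<mu> G h \<le> ereal (b\<^sup>2)"
    unfolding Hinf_sqnorm_def e_def[symmetric]
  proof (rule SUP_least)
    fix B assume "B \<in> {F. finite F \<and> F \<subseteq> carrier G}"
    then have B: "finite B" "B \<subseteq> carrier G" by auto
    have "(\<Sum>g\<in>B. (e g)\<^sup>2) \<le> (\<Sum>g\<in>B. ereal ((F g)\<^sup>2))" using B sq by (intro sum_mono) auto
    also have "\<dots> = ereal (\<Sum>g\<in>B. (F g)\<^sup>2)" by simp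
    also have "\<dots> \<le> ereal (b\<^sup>2)" using sumF[OF B] by simp
    finally show "(\<Sum>g\<in>B. (e g)\<^sup>2) \<le> ereal (b\<^sup>2)" .
  qed
  moreover have "0 \<le> Hinf_sqnorm \<mu> G h"
    unfolding Hinf_sqnorm_def by (rule SUP_upper2[of "{}"]) auto
  ultimately have "real_of_ereal (Hinf_sqnorm \<mu> G h) \<le> b\<^sup>2"
    by (cases "Hinf_sqnorm \<mu> G h") auto
  then have "nrm h \<le> sqrt (b\<^sup>2)" unfolding Hinf_norm_def by (rule real_sqrt_le_mono)
  then show ?thesis using le meas b0 unfolding in_Hinf_def by auto
qed

lemma Hinf_norm_nonneg: "0 \<le> nrm h"
proof -
  have "0 \<le> Hinf_sqnorm \<mu> G h"
    unfolding Hinf_sqnorm_def by (rule SUP_upper2[of "{}"]) auto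
  then show ?thesis unfolding Hinf_norm_def by (simp add: real_of_ereal_pos)
qed

text \<open>A cylinder of an admissible word has positive measure, so some point of it obeys the
  almost sure majorant.\<close>

lemma Hinf_norm_lower:
  assumes h: "in_Hinf \<mu> G h" and B: "finite B" "B \<subseteq> carrier G"
    and w: "adm w" "\<And>x g. x \<in> cyl w \<Longrightarrow> g \<in> B \<Longrightarrow> L \<le> \<bar>h (x, g)\<bar>"
    and L: "L \<ge> 0"
  shows "real (card B) * L\<^sup>2 \<le> (nrm h)\<^sup>2"
proof -
  obtain F where F: "\<And>g. F g \<ge> 0" and AE: "AE x in \<mu>. \<forall>g\<in>carrier G. \<bar>h (x, g)\<bar> \<le> F g"
    and sumF: "\<And>B. finite B \<Longrightarrow> B \<subseteq> carrier G \<Longrightarrow> (\<Sum>g\<in>B. (F g)\<^sup>2) \<le> (nrm h)\<^sup>2"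
    using Hinf_majorant[OF h] by blast
  have "\<exists>x\<in>cyl w. \<forall>g\<in>carrier G. \<bar>h (x, g)\<bar> \<le> F g"
  proof (rule ccontr)
    assume n: "\<not> ?thesis"
    have "AE x in \<mu>. x \<notin> cyl w" using AE by eventually_elim (use n in blast)
    then have "emeasure \<mu> (cyl w) = 0"
      using AE_iff_null_sets[of "cyl w" \<mu>] by auto
    then show False using m_pos[OF w(1)] by (simp add: m_def measure_def)
  qed
  then obtain x where x: "x \<in> cyl w" "\<forall>g\<in>carrier G. \<bar>h (x, g)\<bar> \<le> F g" by blast
  have LF: "L \<le> F g" if "g \<in> B" for g
    using w(2)[OF x(1) that] x(2) B that by force
  have "real (card B) * L\<^sup>2 = (\<Sum>g\<in>B. L\<^sup>2)" by simp
  also have "\<dots> \<le> (\<Sum>g\<in>B. (F g)\<^sup>2)" using LF L by (intro sum_mono power_mono) auto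
  finally show ?thesis using sumF[OF B] by linarith
qed

text \<open>Passage from the operator to the group: the Gibbs bounds dominate the
  \<open>n\<close>-th power by \<open>C * exp (real n * P)\<close> times the average of
  \<open>F\<close> over all words of length \<open>n\<close>, independently of
  \<open>x\<close>.\<close>

lemma funpow_Hinf:
  assumes f: "in_Hinf \<mu> G f"
    and F0: "\<And>g. F g \<ge> 0" and AE: "AE x in \<mu>. \<forall>g\<in>carrier G. \<bar>f (x, g)\<bar> \<le> F g"
    and sumF: "\<And>B. finite B \<Longrightarrow> B \<subseteq> carrier G \<Longrightarrow> (\<Sum>g\<in>B. (F g)\<^sup>2) \<le> (nrm f)\<^sup>2"
    and conv: "\<And>W \<Delta>. finite W \<Longrightarrow> W \<subseteq> words I n \<Longrightarrow> finite \<Delta> \<Longrightarrow> \<Delta> \<subseteq> carrier G \<Longrightarrow>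
      (\<Sum>g\<in>\<Delta>. (\<Sum>w\<in>W. m w * F (g \<otimes> inv (Pw w)))\<^sup>2) \<le> c\<^sup>2"
    and c: "c \<ge> 0"
  shows "in_Hinf \<mu> G ((T ^^ n) f) \<and> nrm ((T ^^ n) f) \<le> C * exp (real n * P) * c"
proof -
  define b where "b = nrm f"
  have b0: "b \<ge> 0" unfolding b_def by (rule Hinf_norm_nonneg)
  have Fb: "F g \<le> b" if "g \<in> carrier G" for g
  proof -
    have "(F g)\<^sup>2 \<le> b\<^sup>2" using sumF[of "{g}"] that unfolding b_def by simp
    then show ?thesis using b0 by (rule power2_le_imp_le)
  qed
  \<comment> \<open>Points at which the majorant holds along every inverse branch; of full measure
    by \<open>AE_pre\<close>.\<close>
  define S where "S = {x \<in> X. \<forall>w. pre w x \<in> X \<longrightarrow> (\<forall>g\<in>carrier G. \<bar>f (pre w x, g)\<bar> \<le> F g)}"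
  have S: "branch_closed S"
    unfolding branch_closed_def S_def by (auto simp flip: pre_append)
  have AES: "AE x in \<mu>. x \<in> S"
    using AE_pre[OF AE] AE_space[of \<mu>] unfolding S_def by eventually_elim (auto simp: space)
  have fS: "\<bar>f (x, g)\<bar> \<le> F g" if "x \<in> S" "g \<in> carrier G" for x g
  proof -
    have "\<forall>w. pre w x \<in> X \<longrightarrow> (\<forall>g\<in>carrier G. \<bar>f (pre w x, g)\<bar> \<le> F g)" and "x \<in> X"
      using that(1) unfolding S_def by blast+
    then show ?thesis using that(2) by (metis pre_Nil)
  qed
  have PwI: "Pw w \<in> carrier G" if "w \<in> words I n" for w
    using that by (auto simp: words_def)
  define ce where "ce = C * exp (real n * P)"
  have ce: "ce \<ge> 0" unfolding ce_def using C1 by simp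
  define U where "U g = (\<Sum>\<^sub>\<infinity>w\<in>words I n. m w * F (g \<otimes> inv (Pw w)))" for g
  have Us: "(\<lambda>w. m w * F (g \<otimes> inv (Pw w))) summable_on words I n" if g: "g \<in> carrier G" for g
  proof (rule summable_on_comparison_test)
    show "(\<lambda>w. m w * b) summable_on words I n"
      by (rule summable_on_cmult_left[OF m_summable[OF subset_refl]])
    fix w assume w: "w \<in> words I n"
    then show "m w * F (g \<otimes> inv (Pw w)) \<le> m w * b" using Fb PwI[OF w] g by (intro mult_left_mono) auto
    show "0 \<le> m w * F (g \<otimes> inv (Pw w))" using F0 by simp
  qed
  have bound: "\<bar>(T ^^ n) f (x, g)\<bar> \<le> ce * U g" if x: "x \<in> S" and g: "g \<in> carrier G" for x g
  proof -
    let ?h = "\<lambda>w. f (pre w x, g \<otimes> inv (Pw w))"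
    have hF: "\<bar>?h w\<bar> \<le> F (g \<otimes> inv (Pw w))" if w: "w \<in> br n x" for w
    proof -
      have "pre w x \<in> S" using S x w unfolding branch_closed_def br_def by blast
      moreover have "Pw w \<in> carrier G" using PwI w br_words by blast
      ultimately show ?thesis using fS g by simp
    qed
    have fb: "\<bar>f (y, h)\<bar> \<le> b" if "y \<in> S" "h \<in> carrier G" for y h
      using fS[OF that] Fb[OF that(2)] by linarith
    have hb: "\<bar>?h w\<bar> \<le> b" if w: "w \<in> br n x" for w
    proof -
      have "Pw w \<in> carrier G" using PwI w br_words by blast
      then have "F (g \<otimes> inv (Pw w)) \<le> b" using Fb g by simp
      then show ?thesis using hF[OF w] by linarith
    qed
    have eq: "(T ^^ n) f (x, g) = (\<Sum>\<^sub>\<infinity>w\<in>br n x. wt w x * ?h w)"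
      by (rule PF_op_funpow[OF S _ x g]) (rule fb)
    have s: "(\<lambda>w. wt w x * ?h w) summable_on br n x" by (rule wt_summable[OF hb b0])
    have s1: "(\<lambda>w. norm (wt w x * ?h w)) summable_on br n x"
      by (rule summable_on_iff_abs_summable_on_real[THEN iffD1, OF s])
    have s2: "(\<lambda>w. ce * (m w * F (g \<otimes> inv (Pw w)))) summable_on words I n"
      by (intro summable_on_cmult_right Us g)
    have "\<bar>\<Sum>\<^sub>\<infinity>w\<in>br n x. wt w x * ?h w\<bar> \<le> (\<Sum>\<^sub>\<infinity>w\<in>br n x. norm (wt w x * ?h w))"
      using norm_infsum_bound[OF s1] by simp
    also have "\<dots> \<le> (\<Sum>\<^sub>\<infinity>w\<in>words I n. ce * (m w * F (g \<otimes> inv (Pw w))))"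
    proof (rule infsum_mono_neutral[OF s1 s2])
      fix w assume w: "w \<in> br n x \<inter> words I n"
      have "norm (wt w x * ?h w) = wt w x * \<bar>?h w\<bar>" using wt_pos[of w x] by (simp add: abs_mult)
      also have "\<dots> \<le> (ce * m w) * F (g \<otimes> inv (Pw w))"
        using wt_le[of w n x] hF[of w] w ce F0 unfolding ce_def by (intro mult_mono) auto
      finally show "norm (wt w x * ?h w) \<le> ce * (m w * F (g \<otimes> inv (Pw w)))" by (simp add: mult.assoc)
    next
      fix w assume "w \<in> br n x - words I n"
      then show "norm (wt w x * ?h w) \<le> 0" using br_words by blast
    next
      fix w
      show "0 \<le> ce * (m w * F (g \<otimes> inv (Pw w)))" using ce F0 by simp
    qed
    also have "\<dots> = ce * U g" unfolding U_def by (rule infsum_cmult_right')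
    finally show ?thesis using eq by simp
  qed
  \<comment> \<open>\<open>conv\<close> speaks of finite sets of words. Since
    \<open>\<Delta>\<close> is finite, the bound passes to the limit.\<close>
  have sumU: "(\<Sum>g\<in>\<Delta>. (U g)\<^sup>2) \<le> c\<^sup>2" if \<Delta>: "finite \<Delta>" "\<Delta> \<subseteq> carrier G" for \<Delta>
  proof (rule tendsto_upperbound)
    show "((\<lambda>W. \<Sum>g\<in>\<Delta>. (\<Sum>w\<in>W. m w * F (g \<otimes> inv (Pw w)))\<^sup>2) \<longlongrightarrow> (\<Sum>g\<in>\<Delta>. (U g)\<^sup>2))
        (finite_subsets_at_top (words I n))"
      unfolding U_def using \<Delta> by (intro tendsto_sum tendsto_power infsum_tendsto Us) auto
    show "\<forall>\<^sub>F W in finite_subsets_at_top (words I n). (\<Sum>g\<in>\<Delta>. (\<Sum>w\<in>W. m w * F (g \<otimes> inv (Pw w)))\<^sup>2) \<le> c\<^sup>2"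
      by (intro eventually_finite_subsets_at_top_weakI conv \<Delta>)
  qed simp
  show ?thesis
  proof (rule Hinf_intro)
    show "(\<lambda>x. (T ^^ n) f (x, g)) \<in> borel_measurable \<mu>" if "g \<in> carrier G" for g
      by (rule PF_op_funpow_measurable) (use f that in \<open>auto simp: in_Hinf_def\<close>)
    show "AE x in \<mu>. \<forall>g\<in>carrier G. \<bar>(T ^^ n) f (x, g)\<bar> \<le> ce * U g"
      using AES by eventually_elim (use bound in blast)
    show "(\<Sum>g\<in>B. (ce * U g)\<^sup>2) \<le> (C * exp (real n * P) * c)\<^sup>2" if B: "finite B" "B \<subseteq> carrier G" for B
    proof -
      have "(\<Sum>g\<in>B. (ce * U g)\<^sup>2) = ce\<^sup>2 * (\<Sum>g\<in>B. (U g)\<^sup>2)" by (simp add: power_mult_distrib sum_distrib_left)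
      also have "\<dots> \<le> ce\<^sup>2 * c\<^sup>2" using sumU[OF B] by (intro mult_left_mono) auto
      finally show ?thesis by (simp add: ce_def power_mult_distrib)
    qed
    show "0 \<le> C * exp (real n * P) * c" using ce c unfolding ce_def by simp
  qed
qed

text \<open>Averaging translates cannot increase the square norm on the group, so
  \<open>funpow_Hinf\<close> applies with \<open>c = nrm f\<close>.\<close>

lemma funpow_bounded:
  assumes f: "in_Hinf \<mu> G f"
  shows "in_Hinf \<mu> G ((T ^^ n) f) \<and> nrm ((T ^^ n) f) \<le> C * exp (real n * P) * nrm f"
proof -
  obtain F where F: "\<And>g. F g \<ge> 0" and AE: "AE x in \<mu>. \<forall>g\<in>carrier G. \<bar>f (x, g)\<bar> \<le> F g"
    and sumF: "\<And>B. finite B \<Longrightarrow> B \<subseteq> carrier G \<Longrightarrow> (\<Sum>g\<in>B. (F g)\<^sup>2) \<le> (nrm f)\<^sup>2"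
    using Hinf_majorant[OF f] by blast
  show ?thesis
  proof (rule funpow_Hinf[OF f F AE sumF])
    fix W \<Delta> assume W: "finite W" "W \<subseteq> words I n" and \<Delta>: "finite \<Delta>" "\<Delta> \<subseteq> carrier G"
    have W1: "sum m W \<le> 1" by (rule sum_m_le_1[OF W(1), of n]) (use W(2) in \<open>auto simp: words_def\<close>)
    have "(\<Sum>g\<in>\<Delta>. (\<Sum>w\<in>W. m w * F (g \<otimes> inv (Pw w)))\<^sup>2) \<le> (\<Sum>g\<in>\<Delta>. \<Sum>w\<in>W. m w * (F (g \<otimes> inv (Pw w)))\<^sup>2)"
      by (intro sum_mono weighted_mean_square_le W1) simp
    also have "\<dots> = (\<Sum>w\<in>W. m w * (\<Sum>g\<in>\<Delta>. (F (g \<otimes> inv (Pw w)))\<^sup>2))"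
      by (simp add: sum.swap[of _ \<Delta>] sum_distrib_left)
    also have "\<dots> \<le> (\<Sum>w\<in>W. m w * (nrm f)\<^sup>2)"
    proof (intro sum_mono mult_left_mono)
      fix w assume "w \<in> W"
      then have p: "inv (Pw w) \<in> carrier G" using W(2) by (auto simp: words_def)
      have "inj_on (\<lambda>g. g \<otimes> inv (Pw w)) \<Delta>" using \<Delta> p by (auto simp: inj_on_def subset_iff)
      then have "(\<Sum>g\<in>\<Delta>. (F (g \<otimes> inv (Pw w)))\<^sup>2) = (\<Sum>h\<in>(\<lambda>g. g \<otimes> inv (Pw w)) ` \<Delta>. (F h)\<^sup>2)"
        by (simp add: sum.reindex)
      also have "\<dots> \<le> (nrm f)\<^sup>2" using \<Delta> p by (intro sumF) auto
      finally show "(\<Sum>g\<in>\<Delta>. (F (g \<otimes> inv (Pw w)))\<^sup>2) \<le> (nrm f)\<^sup>2" .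
    qed simp
    also have "\<dots> = sum m W * (nrm f)\<^sup>2" by (simp add: sum_distrib_right)
    also have "\<dots> \<le> 1 * (nrm f)\<^sup>2" using W1 by (intro mult_right_mono) auto
    finally show "(\<Sum>g\<in>\<Delta>. (\<Sum>w\<in>W. m w * F (g \<otimes> inv (Pw w)))\<^sup>2) \<le> (nrm f)\<^sup>2" by simp
  qed (use Hinf_norm_nonneg in auto)
qed

lemma Hinf_scale:
  assumes f: "in_Hinf \<mu> G f" and c: "c \<ge> 0"
  shows "in_Hinf \<mu> G (\<lambda>y. c * f y) \<and> nrm (\<lambda>y. c * f y) \<le> c * nrm f"
proof -
  obtain F where F: "\<And>g. F g \<ge> 0" and AE: "AE x in \<mu>. \<forall>g\<in>carrier G. \<bar>f (x, g)\<bar> \<le> F g"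
    and sumF: "\<And>B. finite B \<Longrightarrow> B \<subseteq> carrier G \<Longrightarrow> (\<Sum>g\<in>B. (F g)\<^sup>2) \<le> (nrm f)\<^sup>2"
    using Hinf_majorant[OF f] by blast
  show ?thesis
  proof (rule Hinf_intro)
    show "(\<lambda>x. c * f (x, g)) \<in> borel_measurable \<mu>" if "g \<in> carrier G" for g
      using f that unfolding in_Hinf_def by (intro borel_measurable_times) auto
    show "AE x in \<mu>. \<forall>g\<in>carrier G. \<bar>c * f (x, g)\<bar> \<le> c * F g"
      using AE by eventually_elim (use c in \<open>auto simp: abs_mult intro!: mult_left_mono\<close>)
    show "(\<Sum>g\<in>B. (c * F g)\<^sup>2) \<le> (c * nrm f)\<^sup>2" if B: "finite B" "B \<subseteq> carrier G" for B
    proof -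
      have "(\<Sum>g\<in>B. (c * F g)\<^sup>2) = c\<^sup>2 * (\<Sum>g\<in>B. (F g)\<^sup>2)" by (simp add: power_mult_distrib sum_distrib_left)
      also have "\<dots> \<le> c\<^sup>2 * (nrm f)\<^sup>2" using sumF[OF B] by (intro mult_left_mono) auto
      finally show ?thesis by (simp add: power_mult_distrib)
    qed
    show "0 \<le> c * nrm f" using c Hinf_norm_nonneg by simp
  qed
qed

text \<open>Holds for every \<open>f\<close>: when the series fails to converge, both sides are 0 by
  the convention for \<open>infsum\<close>, unless \<open>c\<close> is 0 anyway.\<close>

lemma PF_op_scale: "T (\<lambda>y. c * f y) = (\<lambda>y. c * T f y)"
proof
  fix y
  have "exp (\<phi> (fst z)) * (c * f z) = c * (exp (\<phi> (fst z)) * f z)" for z by simp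
  then show "T (\<lambda>y. c * f y) y = c * T f y"
    unfolding PF_op_def by (simp only: infsum_cmult_right')
qed

lemma PF_op_funpow_scale: "(T ^^ n) (\<lambda>y. c * f y) = (\<lambda>y. c * (T ^^ n) f y)"
proof (induction n)
  case (Suc n)
  have "(T ^^ Suc n) (\<lambda>y. c * f y) = T ((T ^^ n) (\<lambda>y. c * f y))" by simp
  also have "\<dots> = T (\<lambda>y. c * (T ^^ n) f y)" by (simp only: Suc.IH)
  also have "\<dots> = (\<lambda>y. c * (T ^^ Suc n) f y)" by (simp add: PF_op_scale)
  finally show ?case .
qed simp

lemma Hinf_zero: "in_Hinf \<mu> G (\<lambda>y. 0) \<and> nrm (\<lambda>y. 0) \<le> 0"
  by (rule Hinf_intro[where F = "\<lambda>g. 0"]) auto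

section \<open>Norms of the powers of the operator\<close>

abbreviation "opn n \<equiv> Hinf_opnorm \<mu> G (T ^^ n)"

lemma opn_upper:
  assumes "in_Hinf \<mu> G f" "nrm f \<le> 1"
  shows "nrm ((T ^^ n) f) \<le> opn n"
  unfolding Hinf_opnorm_def
proof (rule cSup_upper)
  show "bdd_above {nrm ((T ^^ n) f) |f. in_Hinf \<mu> G f \<and> nrm f \<le> 1}"
  proof (rule bdd_aboveI[of _ "C * exp (real n * P)"])
    fix r assume "r \<in> {nrm ((T ^^ n) f) |f. in_Hinf \<mu> G f \<and> nrm f \<le> 1}"
    then obtain f where f: "r = nrm ((T ^^ n) f)" "in_Hinf \<mu> G f" "nrm f \<le> 1" by blast
    have "r \<le> C * exp (real n * P) * nrm f" using funpow_bounded[OF f(2)] f(1) by simp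
    also have "\<dots> \<le> C * exp (real n * P) * 1" using f(3) C1 by (intro mult_left_mono) auto
    finally show "r \<le> C * exp (real n * P)" by simp
  qed
qed (use assms in blast)

lemma opn_least:
  assumes "\<And>f. in_Hinf \<mu> G f \<Longrightarrow> nrm f \<le> 1 \<Longrightarrow> nrm ((T ^^ n) f) \<le> b"
  shows "opn n \<le> b"
  unfolding Hinf_opnorm_def
proof (rule cSup_least)
  have "nrm (\<lambda>y. 0) \<le> 1" using Hinf_zero by simp
  then show "{nrm ((T ^^ n) f) |f. in_Hinf \<mu> G f \<and> nrm f \<le> 1} \<noteq> {}"
    using Hinf_zero by blast
qed (use assms in blast)

lemma opn_nonneg: "0 \<le> opn n"
proof -
  have "nrm (\<lambda>y. 0) \<le> 1" using Hinf_zero by simp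
  then have "nrm ((T ^^ n) (\<lambda>y. 0)) \<le> opn n" using Hinf_zero by (intro opn_upper) auto
  then show ?thesis using Hinf_norm_nonneg order_trans by blast
qed

lemma opn_le: "opn n \<le> C * exp (real n * P)"
proof (rule opn_least)
  fix f assume f: "in_Hinf \<mu> G f" "nrm f \<le> 1"
  have "nrm ((T ^^ n) f) \<le> C * exp (real n * P) * nrm f"
    using funpow_bounded[OF f(1)] by simp
  also have "\<dots> \<le> C * exp (real n * P) * 1" using f(2) C1 by (intro mult_left_mono) auto
  finally show "nrm ((T ^^ n) f) \<le> C * exp (real n * P)" by simp
qed

lemma opn_bound:
  assumes f: "in_Hinf \<mu> G f"
  shows "nrm ((T ^^ n) f) \<le> opn n * nrm f"
proof (cases "nrm f = 0")
  case True
  \<comment> \<open>A function of norm zero cannot be rescaled to norm one, but the crude bound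
    already gives zero.\<close>
  then show ?thesis using funpow_bounded[OF f, of n] by simp
next
  case False
  define r where "r = nrm f"
  have r: "r > 0" using False Hinf_norm_nonneg[of f] unfolding r_def by linarith
  define h where "h = (\<lambda>y. inverse r * f y)"
  have h: "in_Hinf \<mu> G h" "nrm h \<le> 1"
    using Hinf_scale[OF f, of "inverse r"] r unfolding h_def r_def[symmetric] by auto
  have "f = (\<lambda>y. r * h y)" unfolding h_def using r by auto
  then have "(T ^^ n) f = (\<lambda>y. r * (T ^^ n) h y)" using PF_op_funpow_scale[of n r h] by simp
  then have "nrm ((T ^^ n) f) \<le> r * nrm ((T ^^ n) h)"
    using Hinf_scale[of "(T ^^ n) h" r] funpow_bounded[OF h(1)] r by simp
  also have "\<dots> \<le> r * opn n" using opn_upper[OF h] r by (intro mult_left_mono) auto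
  finally show ?thesis unfolding r_def by (simp add: mult.commute)
qed

lemma opn_power: "opn (n * k) \<le> opn n ^ k"
proof (rule opn_least)
  fix f assume f: "in_Hinf \<mu> G f" "nrm f \<le> 1"
  have "in_Hinf \<mu> G ((T ^^ (n * k)) f) \<and> nrm ((T ^^ (n * k)) f) \<le> opn n ^ k"
  proof (induction k)
    case 0
    then show ?case using f by simp
  next
    case (Suc k)
    have eq: "(T ^^ (n * Suc k)) f = (T ^^ n) ((T ^^ (n * k)) f)" by (simp add: funpow_add)
    have "nrm ((T ^^ n) ((T ^^ (n * k)) f)) \<le> opn n * nrm ((T ^^ (n * k)) f)"
      using Suc by (intro opn_bound) auto
    also have "\<dots> \<le> opn n * opn n ^ k" using Suc opn_nonneg by (intro mult_left_mono) auto
    finally show ?case unfolding eq using funpow_bounded Suc by simp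
  qed
  then show "nrm ((T ^^ (n * k)) f) \<le> opn n ^ k" by simp
qed

text \<open>Pigeonhole over the finitely many letters of \<open>\<Lambda>\<close>.\<close>

lemma follower_mass:
  assumes \<Lambda>: "finite \<Lambda>" "\<And>i. i \<in> I \<Longrightarrow> \<exists>b\<in>\<Lambda>. A i b" "\<Lambda> \<subseteq> I" "\<Lambda> \<noteq> {}"
    and W: "finite W" "W \<subseteq> words I n"
  obtains b where "b \<in> \<Lambda>" "sum m W \<le> real (card \<Lambda>) * (\<Sum>w\<in>{w \<in> W. adm (w @ [b])}. m w)"
proof -
  let ?s = "\<lambda>b. \<Sum>w\<in>{w \<in> W. adm (w @ [b])}. m w"
  have le: "sum m W \<le> (\<Sum>b\<in>\<Lambda>. ?s b)"
    by (rule sum_le_follower_sums[OF \<Lambda> W(1)]) (use W(2) in \<open>auto simp: words_def m_not_admissible\<close>)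
  have "Max (?s ` \<Lambda>) \<in> ?s ` \<Lambda>" using \<Lambda> by (intro Max_in) auto
  then obtain b where b: "b \<in> \<Lambda>" "?s b = Max (?s ` \<Lambda>)" by auto
  have "(\<Sum>b\<in>\<Lambda>. ?s b) \<le> (\<Sum>b'\<in>\<Lambda>. ?s b)" using b \<Lambda> by (intro sum_mono) auto
  then show ?thesis using le that[OF b(1)] by simp
qed

text \<open>Test functions are normalised indicators of Folner sets.\<close>
lemma folner_opn_lower:
  assumes fol: "folner G"
  obtains c where "c > 0" "\<And>n. c * exp (real n * P) \<le> opn n"
proof -
  obtain \<Lambda> where \<Lambda>: "finite \<Lambda>" "\<Lambda> \<subseteq> I" "\<And>i. i \<in> I \<Longrightarrow> \<exists>b\<in>\<Lambda>. A i b"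
    using finite_successors by metis
  have \<Lambda>ne: "\<Lambda> \<noteq> {}" using nonempty \<Lambda>(3) by blast
  define l where "l = real (card \<Lambda>)"
  have l: "l \<ge> 1" unfolding l_def using \<Lambda> \<Lambda>ne by (simp add: Suc_le_eq card_gt_0_iff)
  \<comment> \<open>Half the mass survives truncation, a fraction \<open>1 / l\<close> of it has a
    common follower, and half of the Folner set is kept. Together this gives
    \<open>1 / (sqrt 8 * C * l)\<close>, and \<open>sqrt 8\<close> is rounded up to 3.\<close>
  define c where "c = 1 / (3 * C * l)"
  have c: "c > 0" unfolding c_def using C1 l by simp
  have "c * exp (real n * P) \<le> opn n" for n
  proof -
    have half: "(1 / 2 :: real) > 0" by simp
    obtain M where "\<And>M'. M' \<ge> M \<Longrightarrow> {x \<in> X. \<forall>i<n. x i < M'} \<in> sets \<mu> \<and>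
       prob {x \<in> X. \<forall>i<n. x i < M'} \<ge> 1 - 1 / 2"
      using finite_alphabet_mass[OF half, of n] by blast
    from this[OF order_refl]
    have M: "{x \<in> X. \<forall>i<n. x i < M} \<in> sets \<mu>" "prob {x \<in> X. \<forall>i<n. x i < M} \<ge> 1 - 1 / 2"
      by (rule conjunct1, rule conjunct2)
    define W where "W = words {i \<in> I. i < M} n"
    have W: "finite W" "W \<subseteq> words I n" unfolding W_def by (intro finite_words, simp) (auto simp: words_def)
    have mW: "sum m W \<ge> 1 / 2" using extension_mass[OF M, of "[]" n] unfolding W_def by simp
    obtain b where b: "b \<in> \<Lambda>" and bW: "sum m W \<le> l * (\<Sum>w\<in>{w \<in> W. adm (w @ [b])}. m w)"
      unfolding l_def using follower_mass[OF \<Lambda>(1) \<Lambda>(3) \<Lambda>(2) \<Lambda>ne W] by blast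
    define W' where "W' = {w \<in> W. adm (w @ [b])}"
    have W': "finite W'" "W' \<subseteq> W" unfolding W'_def using W by auto
    have mW': "sum m W' \<ge> 1 / (2 * l)" using mW bW l unfolding W'_def by (simp add: field_simps)
    have PwW: "Pw w \<in> carrier G" if "w \<in> W" for w using that W by (auto simp: words_def)
    define E where "E = Pw ` W"
    have E: "finite E" "E \<subseteq> carrier G" unfolding E_def using W PwW by auto
    \<comment> \<open>Summed over all of \<open>E\<close>, the boundary losses amount to at most
      half of \<open>B\<close>.\<close>
    define \<epsilon> where "\<epsilon> = 1 / (2 * (real (card E) + 1))"
    have "\<epsilon> > 0" unfolding \<epsilon>_def by simp
    then obtain B where B: "finite B" "B \<noteq> {}" "B \<subseteq> carrier G"
      and inv: "\<And>s. s \<in> E \<Longrightarrow> real (card ((B #> s) - B)) \<le> \<epsilon> * real (card B)"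
      using fol E unfolding folner_def by metis
    define N where "N = real (card B)"
    have N: "N > 0" unfolding N_def using B by (simp add: card_gt_0_iff)
    \<comment> \<open>Points that stay in \<open>B\<close> after translation by
      \<open>inv (Pw w)\<close> for every \<open>w\<close> in \<open>W\<close>, so that each of
      these words contributes the full value of the test function.\<close>
    define B' where "B' = B - (\<Union>s\<in>E. B - (B #> s))"
    have "real (card (\<Union>s\<in>E. B - (B #> s))) \<le> N / 2"
    proof -
      have "card (\<Union>s\<in>E. B - (B #> s)) \<le> (\<Sum>s\<in>E. card (B - (B #> s)))" by (rule card_UN_le[OF E(1)])
      then have "real (card (\<Union>s\<in>E. B - (B #> s))) \<le> (\<Sum>s\<in>E. real (card (B - (B #> s))))"
        by (metis of_nat_le_iff of_nat_sum)
      also have "\<dots> \<le> (\<Sum>s\<in>E. \<epsilon> * N)"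
      proof (rule sum_mono)
        fix s assume s: "s \<in> E"
        have fin: "finite (B #> s)" using B unfolding r_coset_def by auto
        have "card (B #> s) = card B" using B E s by (intro card_r_coset) auto
        then have "card (B - (B #> s)) = card ((B #> s) - B)"
          using card_Diff_subset_Int[of B "B #> s"] card_Diff_subset_Int[of "B #> s" B] B fin
          by (simp add: Int_commute)
        then show "real (card (B - (B #> s))) \<le> \<epsilon> * N" using inv[OF s] unfolding N_def by simp
      qed
      also have "\<dots> = real (card E) * \<epsilon> * N" by simp
      also have "\<dots> \<le> N / 2" unfolding \<epsilon>_def using N by (simp add: field_simps)
      finally show ?thesis .
    qed
    moreover have "card B \<le> card B' + card (\<Union>s\<in>E. B - (B #> s))"
    proof -
      have "card B \<le> card (B' \<union> (\<Union>s\<in>E. B - (B #> s)))" unfolding B'_def using B E by (intro card_mono) auto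
      then show ?thesis using card_Un_le[of B' "\<Union>s\<in>E. B - (B #> s)"] by linarith
    qed
    ultimately have cB': "real (card B') \<ge> N / 2" unfolding N_def by linarith
    have B': "finite B'" "B' \<subseteq> carrier G" unfolding B'_def using B by auto
    have B'in: "g \<otimes> inv (Pw w) \<in> B" if g: "g \<in> B'" and w: "w \<in> W" for g w
    proof -
      have "g \<in> B #> Pw w" using g w unfolding B'_def E_def by blast
      then obtain h where h: "h \<in> B" "g = h \<otimes> Pw w" unfolding r_coset_def by blast
      then have "g \<otimes> inv (Pw w) = h" using B PwW[OF w] by (auto simp: m_assoc)
      then show ?thesis using h by simp
    qed
    define F where "F g = (if g \<in> B then 1 / sqrt N else 0)" for g
    define f where "f = (\<lambda>y :: (nat \<Rightarrow> nat) \<times> 'g. F (snd y))"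
    have F0: "F g \<ge> 0" for g unfolding F_def using N by simp
    have Fle: "F g \<le> 1 / sqrt N" for g unfolding F_def using N by simp
    have f: "in_Hinf \<mu> G f \<and> nrm f \<le> 1"
    proof (rule Hinf_intro[where F = F])
      show "(\<lambda>x. f (x, g)) \<in> borel_measurable \<mu>" for g unfolding f_def by simp
      show "AE x in \<mu>. \<forall>g\<in>carrier G. \<bar>f (x, g)\<bar> \<le> F g" unfolding f_def using F0 by simp
      show "(\<Sum>g\<in>D. (F g)\<^sup>2) \<le> 1\<^sup>2" if D: "finite D" for D
      proof -
        have "(\<Sum>g\<in>D. (F g)\<^sup>2) = (\<Sum>g\<in>D \<inter> B. (F g)\<^sup>2)"
          using D by (intro sum.mono_neutral_right) (auto simp: F_def)
        also have "\<dots> \<le> (\<Sum>g\<in>B. (F g)\<^sup>2)" using B by (intro sum_mono2) auto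
        also have "\<dots> = (\<Sum>g\<in>B. 1 / N)" using N by (intro sum.cong) (auto simp: F_def power_divide)
        also have "\<dots> = 1" using N unfolding N_def by simp
        finally show ?thesis by simp
      qed
    qed simp
    have Tf: "in_Hinf \<mu> G ((T ^^ n) f)" using funpow_bounded f by blast
    define L where "L = exp (real n * P) / (2 * C * l * sqrt N)"
    have L0: "L \<ge> 0" unfolding L_def using C1 l N by simp
    have closed: "branch_closed X" unfolding branch_closed_def by auto
    \<comment> \<open>The common follower \<open>b\<close> makes all words of \<open>W'\<close>
      inverse branches at every point of \<open>cyl [b]\<close>.\<close>
    have low: "L \<le> \<bar>(T ^^ n) f (x, g)\<bar>" if x: "x \<in> cyl [b]" and g: "g \<in> B'" for x g
    proof -
      have xX: "x \<in> X" "x 0 = b" using x by (auto simp: mem_cylinder_Cons)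
      have gc: "g \<in> carrier G" using g B' by auto
      let ?h = "\<lambda>w. f (pre w x, g \<otimes> inv (Pw w))"
      have fb: "\<bar>f (y, h)\<bar> \<le> 1 / sqrt N" for y h unfolding f_def using F0 Fle by simp
      have eq: "(T ^^ n) f (x, g) = (\<Sum>\<^sub>\<infinity>w\<in>br n x. wt w x * ?h w)"
        by (rule PF_op_funpow[OF closed _ xX(1) gc]) (rule fb)
      have s: "(\<lambda>w. wt w x * ?h w) summable_on br n x"
        by (rule wt_summable[OF fb]) (use N in simp)
      have sub: "W' \<subseteq> br n x"
        unfolding W'_def br_def using W xX by (auto simp: pre_in_shift_space words_def)
      have "L \<le> exp (real n * P) / (C * sqrt N) * sum m W'"
      proof -
        have "exp (real n * P) / (C * sqrt N) * (1 / (2 * l)) \<le> exp (real n * P) / (C * sqrt N) * sum m W'"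
          using mW' C1 N by (intro mult_left_mono) auto
        then show ?thesis unfolding L_def by (simp add: field_simps)
      qed
      also have "\<dots> = (\<Sum>w\<in>W'. (m w * exp (real n * P) / C) * (1 / sqrt N))"
        unfolding sum_distrib_left by (intro sum.cong refl) (simp add: field_simps)
      also have "\<dots> \<le> (\<Sum>w\<in>W'. wt w x * ?h w)"
      proof (rule sum_mono)
        fix w assume w: "w \<in> W'"
        have "?h w = 1 / sqrt N" unfolding f_def F_def using B'in[OF g] w W' by auto
        moreover have "m w * exp (real n * P) / C \<le> wt w x"
          using wt_ge[of w n x] sub w C1 by (auto simp: field_simps)
        ultimately show "(m w * exp (real n * P) / C) * (1 / sqrt N) \<le> wt w x * ?h w"
          using N by (simp only:) (rule mult_right_mono, auto)
      qed
      also have "\<dots> \<le> (\<Sum>\<^sub>\<infinity>w\<in>br n x. wt w x * ?h w)"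
        using F0 wt_pos by (intro finite_sum_le_infsum[OF s W'(1) sub]) (auto simp: f_def less_imp_le)
      finally show ?thesis using eq by simp
    qed
    have "real (card B') * L\<^sup>2 \<le> (nrm ((T ^^ n) f))\<^sup>2"
      by (rule Hinf_norm_lower[OF Tf B' _ low L0]) (use b \<Lambda> in \<open>auto simp: admissible_Cons\<close>)
    moreover have "(c * exp (real n * P))\<^sup>2 \<le> real (card B') * L\<^sup>2"
    proof -
      have "N * L\<^sup>2 = (exp (real n * P))\<^sup>2 / (4 * C\<^sup>2 * l\<^sup>2)"
        unfolding L_def using N by (simp add: power_divide power_mult_distrib)
      then have "N / 2 * L\<^sup>2 = (exp (real n * P))\<^sup>2 / (8 * (C\<^sup>2 * l\<^sup>2))" by simp
      moreover have "(c * exp (real n * P))\<^sup>2 = (exp (real n * P))\<^sup>2 / (9 * (C\<^sup>2 * l\<^sup>2))"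
        unfolding c_def by (simp add: power_divide power_mult_distrib)
      moreover have "(exp (real n * P))\<^sup>2 / (9 * (C\<^sup>2 * l\<^sup>2)) \<le> (exp (real n * P))\<^sup>2 / (8 * (C\<^sup>2 * l\<^sup>2))"
        using C1 l by (intro divide_left_mono) auto
      moreover have "N / 2 * L\<^sup>2 \<le> real (card B') * L\<^sup>2" using cB' by (intro mult_right_mono) auto
      ultimately show ?thesis by linarith
    qed
    ultimately have "(c * exp (real n * P))\<^sup>2 \<le> (nrm ((T ^^ n) f))\<^sup>2" by linarith
    then have "c * exp (real n * P) \<le> nrm ((T ^^ n) f)"
      using Hinf_norm_nonneg by (rule power2_le_imp_le)
    also have "\<dots> \<le> opn n" using f by (intro opn_upper) auto
    finally show ?thesis .
  qed
  then show ?thesis using that c by blast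
qed

lemma folner_opn_ge:
  assumes "folner G"
  shows "exp (real n * P) \<le> opn n"
proof (rule ccontr)
  assume "\<not> ?thesis"
  then have lt: "opn n / exp (real n * P) < 1" by simp
  define r where "r = opn n / exp (real n * P)"
  have r: "0 \<le> r" "r < 1" using lt opn_nonneg unfolding r_def by auto
  obtain c where c: "c > 0" "\<And>n. c * exp (real n * P) \<le> opn n"
    using folner_opn_lower[OF assms] by blast
  have "c \<le> r ^ k" for k
  proof -
    have "c * exp (real (n * k) * P) \<le> opn n ^ k" using c(2)[of "n * k"] opn_power[of n k] by linarith
    moreover have "exp (real (n * k) * P) = exp (real n * P) ^ k"
      by (simp add: exp_of_nat_mult[symmetric] ac_simps)
    ultimately show ?thesis unfolding r_def by (simp add: power_divide field_simps)
  qed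
  moreover obtain k where "r ^ k < c" using real_arch_pow_inv[OF c(1) r(2)] by blast
  ultimately show False by (meson not_le)
qed

text \<open>A single exponent is enough, because the spectral radius is an infimum over
  \<open>n\<close>.\<close>

lemma not_folner_opn_less:
  assumes "\<not> folner G"
  obtains n where "n \<ge> 1" "opn n < exp (real n * P)"
proof -
  \<comment> \<open>Cancels the constant \<open>C\<close> of \<open>funpow_Hinf\<close> and leaves a
    factor \<open>1 / 2\<close> to spare. The decay lemma bounds squared norms, so it is used with
    the square of \<open>c\<close>.\<close>
  define c where "c = 1 / (2 * C)"
  have c: "c > 0" unfolding c_def using C1 by simp
  show thesis
  proof (rule not_folner_decay[OF assms zero_less_power[OF c, of 2]])
    fix n :: nat
    assume n: "n \<ge> 1"
      and decay: "\<And>F W \<Delta>. (\<And>g. F g \<ge> 0) \<Longrightarrow> (\<And>B. finite B \<Longrightarrow> B \<subseteq> carrier G \<Longrightarrow> (\<Sum>g\<in>B. (F g)\<^sup>2) \<le> 1) \<Longrightarrow>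
        finite W \<Longrightarrow> W \<subseteq> words I n \<Longrightarrow> finite \<Delta> \<Longrightarrow> \<Delta> \<subseteq> carrier G \<Longrightarrow>
        (\<Sum>g\<in>\<Delta>. (\<Sum>w\<in>W. m w * F (g \<otimes> inv (Pw w)))\<^sup>2) \<le> c\<^sup>2"
    have "opn n \<le> C * exp (real n * P) * c"
    proof (rule opn_least)
      fix f assume f: "in_Hinf \<mu> G f" "nrm f \<le> 1"
      obtain F where F: "\<And>g. F g \<ge> 0" and AE: "AE x in \<mu>. \<forall>g\<in>carrier G. \<bar>f (x, g)\<bar> \<le> F g"
        and sumF: "\<And>B. finite B \<Longrightarrow> B \<subseteq> carrier G \<Longrightarrow> (\<Sum>g\<in>B. (F g)\<^sup>2) \<le> (nrm f)\<^sup>2"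
        using Hinf_majorant[OF f(1)] by blast
      have "(nrm f)\<^sup>2 \<le> 1" using f(2) Hinf_norm_nonneg by (simp add: power_le_one)
      then have sum1: "(\<Sum>g\<in>B. (F g)\<^sup>2) \<le> 1" if "finite B" "B \<subseteq> carrier G" for B
        using sumF[OF that] by linarith
      have "in_Hinf \<mu> G ((T ^^ n) f) \<and> nrm ((T ^^ n) f) \<le> C * exp (real n * P) * c"
        by (rule funpow_Hinf[OF f(1) F AE sumF decay[OF F sum1]]) (use c in auto)
      then show "nrm ((T ^^ n) f) \<le> C * exp (real n * P) * c" by blast
    qed
    also have "C * exp (real n * P) * c = exp (real n * P) / 2" unfolding c_def using C1 by simp
    also have "\<dots> < exp (real n * P)" by simp
    finally show thesis using that n by blast
  qed
qed

section \<open>The spectral radius\<close>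

abbreviation "\<rho> \<equiv> Hinf_spectral_radius \<mu> G T"

lemma rho_le: "n \<ge> 1 \<Longrightarrow> \<rho> \<le> opn n powr (1 / real n)"
  unfolding Hinf_spectral_radius_def
  by (rule cInf_lower) (auto intro!: bdd_belowI[of _ 0])

lemma rho_ge: "(\<And>n. n \<ge> 1 \<Longrightarrow> b \<le> opn n powr (1 / real n)) \<Longrightarrow> b \<le> \<rho>"
  unfolding Hinf_spectral_radius_def
  by (rule cInf_greatest) (auto intro: exI[of _ 1])

lemma rho_nonneg: "0 \<le> \<rho>"
  by (rule rho_ge) simp

lemma exp_root: "n \<ge> 1 \<Longrightarrow> exp (real n * P) powr (1 / real n) = exp P"
  by (simp add: powr_def)

lemma rho_le_exp: "\<rho> \<le> exp P"
proof (rule tendsto_lowerbound)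
  have "(\<lambda>n. C powr (1 / real n) * exp P) \<longlonglongrightarrow> C powr 0 * exp P"
    using C1 by (intro tendsto_mult tendsto_powr tendsto_const lim_1_over_n) auto
  then show "(\<lambda>n. C powr (1 / real n) * exp P) \<longlonglongrightarrow> exp P" using C1 by simp
  show "\<forall>\<^sub>F n in sequentially. \<rho> \<le> C powr (1 / real n) * exp P"
    using eventually_ge_at_top[of 1]
  proof eventually_elim
    case (elim n)
    have "\<rho> \<le> opn n powr (1 / real n)" by (rule rho_le[OF elim])
    also have "\<dots> \<le> (C * exp (real n * P)) powr (1 / real n)"
      using opn_le opn_nonneg by (intro powr_mono2) auto
    also have "\<dots> = C powr (1 / real n) * exp P"
      using C1 exp_root[OF elim] by (simp add: powr_mult)
    finally show ?case .
  qed
qed simp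

lemma rho_eq_exp_iff: "\<rho> = exp P \<longleftrightarrow> folner G"
proof
  assume fol: "folner G"
  have "exp P \<le> \<rho>"
  proof (rule rho_ge)
    fix n :: nat assume n: "n \<ge> 1"
    have "exp P = exp (real n * P) powr (1 / real n)" using exp_root[OF n] by simp
    also have "\<dots> \<le> opn n powr (1 / real n)"
      using folner_opn_ge[OF fol] by (intro powr_mono2) auto
    finally show "exp P \<le> opn n powr (1 / real n)" .
  qed
  then show "\<rho> = exp P" using rho_le_exp by linarith
next
  assume eq: "\<rho> = exp P"
  show "folner G"
  proof (rule ccontr)
    assume "\<not> folner G"
    then obtain n where n: "n \<ge> 1" "opn n < exp (real n * P)" using not_folner_opn_less by blast
    have "\<rho> \<le> opn n powr (1 / real n)" by (rule rho_le[OF n(1)])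
    also have "\<dots> < exp (real n * P) powr (1 / real n)"
      using n opn_nonneg by (intro powr_less_mono2) auto
    also have "\<dots> = exp P" by (rule exp_root[OF n(1)])
    finally show False using eq by simp
  qed
qed

end

section \<open>The pressure is not minus infinity\<close>

lemma ereal_ln_lower: "z > 0 \<Longrightarrow> ereal z \<le> Z \<Longrightarrow> ereal (ln z) \<le> ereal_ln Z"
  by (cases Z) (auto simp: ereal_ln_def)

context gibbs_extension
begin

primrec rep :: "nat list \<Rightarrow> nat \<Rightarrow> nat list" where
  "rep v 0 = []"
| "rep v (Suc k) = v @ rep v k"

lemma length_rep: "length (rep v k) = k * length v"
  by (induction k) auto

lemma rep_admissible: "v \<noteq> [] \<Longrightarrow> hd v = i \<Longrightarrow> adm (v @ [i]) \<Longrightarrow> adm (rep v k @ [i])"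
proof (induction k)
  case 0
  then show ?case by (simp add: admissible_append)
next
  case (Suc k)
  have "hd (rep v k @ [i]) = i" using Suc.prems by (cases k) auto
  then show ?case using Suc by (simp add: admissible_append[of I A v])
qed

text \<open>Each further turn of the loop at \<open>i\<close> multiplies the mass by at least
  \<open>m v / K\<close>, since the junction is allowed.\<close>

lemma m_rep:
  assumes "v \<noteq> []" "hd v = i" "adm (v @ [i])"
  shows "(m v / K) ^ k \<le> m (rep v k)"
proof (induction k)
  case (Suc k)
  have "adm (rep v (Suc k))"
    using rep_admissible[OF assms, of "Suc k"] unfolding admissible_append[of I A "rep v (Suc k)"] by blast
  then have "m v * m (rep v k) \<le> K * m (rep v (Suc k))" using m_append_ge by simp
  then have "m v / K * m (rep v k) \<le> m (rep v (Suc k))" using K1 by (simp add: field_simps)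
  moreover have "m v / K * (m v / K) ^ k \<le> m v / K * m (rep v k)"
    using Suc K1 by (intro mult_left_mono) auto
  ultimately show ?case by simp
qed simp

lemma gurevic_Z_lower:
  assumes w: "adm (w @ [i])" "w \<noteq> []" "hd w = i"
  shows "ereal (m w * exp (real (length w) * P) / C) \<le> gurevic_Z I A \<phi> i (length w)"
proof -
  have adm: "adm w" using w by (simp add: admissible_append)
  then obtain \<tau> where t: "\<tau> \<in> cyl w" using cylinder_nonempty by blast
  let ?S = "birkhoff_sum \<phi> (length w) ` cyl w"
  \<comment> \<open>A real \<open>Sup\<close> is meaningful only for sets bounded above; the Gibbs
    lower bound on the cylinder's mass supplies this.\<close>
  have "bdd_above ?S"
  proof (rule bdd_aboveI2)
    fix x assume "x \<in> cyl w"
    then have "exp (birkhoff_sum \<phi> (length w) x) \<le> C * exp (real (length w) * P) * m w"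
      by (rule gibbs_lower)
    moreover have "birkhoff_sum \<phi> (length w) x \<le> exp (birkhoff_sum \<phi> (length w) x)"
      using exp_ge_add_one_self[of "birkhoff_sum \<phi> (length w) x"] by linarith
    ultimately show "birkhoff_sum \<phi> (length w) x \<le> C * exp (real (length w) * P) * m w" by linarith
  qed
  then have "birkhoff_sum \<phi> (length w) \<tau> \<le> Sup ?S" using t by (intro cSup_upper) auto
  then have e: "exp (birkhoff_sum \<phi> (length w) \<tau>) \<le> exp (Sup ?S)" by simp
  have "m w * exp (real (length w) * P) / C \<le> exp (birkhoff_sum \<phi> (length w) \<tau>)"
    using gibbs_upper[OF t] C1 by (simp add: field_simps)
  from order_trans[OF this e] have "m w * exp (real (length w) * P) / C \<le> (\<Sum>w\<in>{w}. exp (Sup (birkhoff_sum \<phi> (length w) ` cyl w)))"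
    by simp
  moreover have "w ! 0 = i" using w by (simp add: hd_conv_nth)
  ultimately show ?thesis
    unfolding gurevic_Z_def using w adm by (intro SUP_upper2[of "{w}"]) auto
qed

text \<open>Without this, \<open>real_of_ereal\<close> would turn a pressure of minus infinity into
  the number 0. Mixing provides a loop \<open>v\<close> at \<open>a\<close>; its powers alone force
  exponential growth at the times \<open>k * l\<close>, and arbitrarily large times suffice for a
  limsup.\<close>

lemma gurevic_pressure_lower:
  assumes mixing: "topologically_mixing I A" and a: "a \<in> I"
  shows "gurevic_pressure I A \<phi> a \<noteq> - \<infinity>"
proof -
  obtain w where w: "adm (a # w @ [a])"
    using mixing a unfolding topologically_mixing_def by blast
  define v where "v = a # w"
  have v: "v \<noteq> []" "hd v = a" "adm (v @ [a])" using w unfolding v_def by auto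
  define l where "l = length v"
  have l: "l \<ge> 1" unfolding l_def v_def by simp
  define \<theta> where "\<theta> = m v / K"
  have mv: "m v > 0" using v(3) by (intro m_pos) (simp add: admissible_append)
  have \<theta>: "\<theta> > 0" "\<theta> \<le> 1"
    unfolding \<theta>_def using mv K1 m_le_1[of v] by (auto simp: divide_le_eq_1)
  \<comment> \<open>At time \<open>n\<close> the bound is \<open>ln \<theta>\<close> taken
    \<open>k\<close> times, plus \<open>n * P\<close>, minus \<open>ln C\<close>. As
    \<open>\<theta> \<le> 1\<close>, \<open>C \<ge> 1\<close> and \<open>n\<close> is at least
    \<open>k\<close> and 1, replacing both multiplicities by \<open>n\<close> only lowers
    it.\<close>
  define b where "b = P - ln C + ln \<theta>"
  have lower: "ereal b \<le> ereal_ln (gurevic_Z I A \<phi> a (k * l)) / ereal (real (k * l))" if k: "k \<ge> 1" for k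
  proof -
    define n where "n = k * l"
    have n: "real n \<ge> 1" "real n \<ge> real k"
    proof -
      have "1 * 1 \<le> k * l" using k l by (intro mult_le_mono)
      then show "real n \<ge> 1" unfolding n_def by linarith
      have "k * 1 \<le> k * l" using l by (intro mult_le_mono) auto
      then show "real n \<ge> real k" unfolding n_def by linarith
    qed
    let ?w = "rep v k"
    have len: "length ?w = n" unfolding n_def l_def by (rule length_rep)
    have "?w \<noteq> []" "hd ?w = a" using k v by (cases k; simp)+
    from gurevic_Z_lower[OF rep_admissible[OF v] this]
    have "ereal (m ?w * exp (real n * P) / C) \<le> gurevic_Z I A \<phi> a n" unfolding len .
    moreover have "\<theta> ^ k * exp (real n * P) / C \<le> m ?w * exp (real n * P) / C"
      using m_rep[OF v, of k] C1 unfolding \<theta>_def by (intro divide_right_mono mult_right_mono) auto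
    ultimately have "ereal (\<theta> ^ k * exp (real n * P) / C) \<le> gurevic_Z I A \<phi> a n"
      by (meson ereal_less_eq(3) order_trans)
    then have Z: "ereal (ln (\<theta> ^ k * exp (real n * P) / C)) \<le> ereal_ln (gurevic_Z I A \<phi> a n)"
      using \<theta> C1 by (intro ereal_ln_lower) auto
    have "ln (\<theta> ^ k * exp (real n * P) / C) = real k * ln \<theta> + real n * P - ln C"
      using \<theta> C1 by (simp add: ln_div ln_mult ln_realpow)
    moreover have "real n * ln \<theta> \<le> real k * ln \<theta>"
      using n \<theta> by (intro mult_right_mono_neg) auto
    moreover have "1 * ln C \<le> real n * ln C" using n C1 by (intro mult_right_mono) auto
    ultimately have "real n * b \<le> ln (\<theta> ^ k * exp (real n * P) / C)"
      unfolding b_def by (simp add: algebra_simps)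
    then have "ereal (b * real n) \<le> ereal_ln (gurevic_Z I A \<phi> a n)"
      using Z by (metis ereal_less_eq(3) mult.commute order_trans)
    then have "ereal b * ereal (real n) \<le> ereal_ln (gurevic_Z I A \<phi> a n)" by simp
    then show ?thesis unfolding n_def[symmetric] using n
      by (subst ereal_le_divide_pos) (auto simp: mult.commute)
  qed
  have "ereal b \<le> gurevic_pressure I A \<phi> a"
    unfolding gurevic_pressure_def limsup_INF_SUP
  proof (rule INF_greatest)
    fix n
    have "n * 1 \<le> Suc n * l" using l by (intro mult_le_mono) auto
    then have "Suc n * l \<ge> n" by simp
    then show "ereal b \<le> (SUP k\<in>{n..}. ereal_ln (gurevic_Z I A \<phi> a k) / ereal (real k))"
      using lower[of "Suc n"] by (intro SUP_upper2[of "Suc n * l"]) auto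
  qed
  then show ?thesis by auto
qed

end

theorem theorem1p1:
  fixes I :: "nat set" and A :: "nat \<Rightarrow> nat \<Rightarrow> bool"
    and G :: "('g, 'b) monoid_scheme" and \<Psi> :: "nat \<Rightarrow> 'g"
    and \<phi> :: "(nat \<Rightarrow> nat) \<Rightarrow> real" and a :: nat and \<mu> :: "(nat \<Rightarrow> nat) measure"
  assumes mixing: "topologically_mixing I A"
    and bip: "bip I A"
    and grp: "group G" and cntbl: "countable (carrier G)"
    and Psi: "\<Psi> \<in> I \<rightarrow> carrier G"
    and irred: "ext_irreducible I A G \<Psi>"
    and hoelder: "hoelder I A \<phi>"
    and a: "a \<in> I"
    and finP: "gurevic_pressure I A \<phi> a < \<infinity>"
    and gibbs: "invariant_gibbs_measure I A \<phi> (real_of_ereal (gurevic_pressure I A \<phi> a)) \<mu>"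
  shows "ereal_ln (ereal (Hinf_spectral_radius \<mu> G (PF_op I A G \<Psi> \<phi>))) \<le> gurevic_pressure I A \<phi> a
         \<and> (ereal_ln (ereal (Hinf_spectral_radius \<mu> G (PF_op I A G \<Psi> \<phi>))) = gurevic_pressure I A \<phi> a
           \<longleftrightarrow> amenable G)"
proof -
  define P where "P = real_of_ereal (gurevic_pressure I A \<phi> a)"
  obtain C where C: "C \<ge> 1" "\<forall>w. admissible I A w \<longrightarrow> (\<forall>\<tau>\<in>cylinder I A w.
        inverse C \<le> measure \<mu> (cylinder I A w) / exp (birkhoff_sum \<phi> (length w) \<tau> - real (length w) * P)
        \<and> measure \<mu> (cylinder I A w) / exp (birkhoff_sum \<phi> (length w) \<tau> - real (length w) * P) \<le> C)"
    using gibbs unfolding invariant_gibbs_measure_def P_def by blast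
  have mu: "prob_space \<mu>" "space \<mu> = shift_space I A"
    "sets \<mu> = sigma_sets (shift_space I A) (range (cylinder I A))"
    "left_shift \<in> measurable \<mu> \<mu>" "distr \<mu> \<mu> left_shift = \<mu>"
    using gibbs unfolding invariant_gibbs_measure_def by blast+
  interpret gibbs_extension G I A \<Psi> \<phi> \<mu> P C
  proof (intro gibbs_extension.intro gibbs_extension_axioms.intro)
    show "I \<noteq> {}" using a by blast
    show "\<Psi> i \<in> carrier G" if "i \<in> I" for i using Psi that by blast
    show "inverse C \<le> measure \<mu> (cylinder I A w) / exp (birkhoff_sum \<phi> (length w) \<tau> - real (length w) * P)
        \<and> measure \<mu> (cylinder I A w) / exp (birkhoff_sum \<phi> (length w) \<tau> - real (length w) * P) \<le> C"
      if "admissible I A w" "\<tau> \<in> cylinder I A w" for w \<tau> using C(2) that by blast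
  qed (rule grp bip cntbl irred hoelder mu C(1))+
  have press: "gurevic_pressure I A \<phi> a = ereal P"
    unfolding P_def using gurevic_pressure_lower[OF mixing a] finP
    by (cases "gurevic_pressure I A \<phi> a") auto
  \<comment> \<open>A vanishing spectral radius is read as minus infinity, which lies below the
    finite pressure and differs from it.\<close>
  have ln_eq: "ereal_ln (ereal \<rho>) = (if \<rho> = 0 then - \<infinity> else ereal (ln \<rho>))"
    using rho_nonneg by (auto simp: ereal_ln_def)
  have le: "ln \<rho> \<le> P" if "\<rho> \<noteq> 0"
    using rho_le_exp rho_nonneg that by (metis exp_gt_zero ln_exp ln_le_cancel_iff order_less_le)
  have eq: "ereal_ln (ereal \<rho>) = ereal P \<longleftrightarrow> \<rho> = exp P"
  proof
    assume e: "ereal_ln (ereal \<rho>) = ereal P"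
    then have "\<rho> \<noteq> 0" unfolding ln_eq by auto
    then have "ln \<rho> = P" "\<rho> > 0" using e rho_nonneg unfolding ln_eq by auto
    then show "\<rho> = exp P" by auto
  next
    assume r: "\<rho> = exp P"
    show "ereal_ln (ereal \<rho>) = ereal P" unfolding ln_eq by (simp add: r)
  qed
  have "folner G \<longleftrightarrow> amenable G" using folner_imp_amenable amenable_imp_folner by blast
  then have iff: "ereal_ln (ereal \<rho>) = ereal P \<longleftrightarrow> amenable G" using eq rho_eq_exp_iff by simp
  have bound: "ereal_ln (ereal \<rho>) \<le> ereal P" using le unfolding ln_eq by auto
  show ?thesis unfolding press using bound iff by blast
qed

end
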